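(* Let $D\subset Y$ be the complement of the 6-dimensional Białynicki-Birula cell $C_{z^2\wedge zy\wedge zx}$. The singular locus of $D$ is irreducible of dimension 4 and is equal to the closure $\overline{C_{y^2\wedge yz\wedge xz}}$.
   Context: Work over $\mathbb{C}$. $W$ is a 3-dimensional vector space with basis $\{x,y,z\}$. View elements $R$ of $\mathbb{C}^2\otimes\mathbb{C}^3\otimes W$ as $2\times 3$ matrices with entries in $W$; $(A,B)\in GL(2)\times GL(3)$ acts by $R\mapsto ARB^{-1}$. $Y$ is the GIT quotient of $\mathbb{P}(\mathbb{C}^2\otimes\mathbb{C}^3\otimes W)$ by this action; points of $Y$ are orbits $[R]$ of matrices whose three maximal minors are linearly independent in $S^2W$, and $[R]\mapsto H_R$ (the span of the three maximal minors) is a closed embedding $Y\hookrightarrow\mathrm{Gr}(3,S^2W)\subset\mathbb{P}(\wedge^3S^2W)$. A point of $Y$ is denoted by the corresponding subspace $\langle a,b,c\rangle\subset S^2W$ or by $a\wedge b\wedge c$. $Y$ is a smooth Fano 6-fold. $\mathbb{G}_m$ acts on $Y$ through $t\mapsto(x\mapsto x,\ y\mapsto ty,\ z\mapsto t^3z)$ in $GL(W)$; this action has 13 fixed points. For a fixed point $R_0$, its Białynicki-Birula cell is $C_{R_0}=\{R\in Y:\lim_{t\to\infty}t.R=R_0\}$, a locally closed subvariety isomorphic to an affine space; $Y$ is the disjoint union of these cells. The cell $C_{z^2\wedge zy\wedge zx}$ is the unique 6-dimensional one, and its complement $D$ (with reduced structure) is the hyperplane section of $Y$ of those $R$ for which the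 coefficient of $z^2\wedge zy\wedge zx$ in $[\wedge^3H_R]$ vanishes. *)

theory Defs
  imports "HOL-Analysis.Analysis"
begin

section \<open>Irreducibility and dimension of topological spaces\<close>

definition irreducible_space :: "'a topology \<Rightarrow> bool" where
  "irreducible_space X \<longleftrightarrow> topspace X \<noteq> {} \<and>
     (\<forall>A B. closedin X A \<and> closedin X B \<and> topspace X = A \<union> B \<longrightarrow>
        topspace X = A \<or> topspace X = B)"

definition irreducible_closed_chain :: "'a topology \<Rightarrow> nat \<Rightarrow> (nat \<Rightarrow> 'a set) \<Rightarrow> bool" where
  "irreducible_closed_chain X n Z \<longleftrightarrow>
     (\<forall>i\<le>n. closedin X (Z i) \<and> irreducible_space (subtopology X (Z i))) \<and>
     (\<forall>i<n. Z i \<subset> Z (Suc i))"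

text \<open>For the empty space, this supremum gives dimension 0 rather than -1.\<close>

definition krull_dim :: "'a topology \<Rightarrow> enat" where
  "krull_dim X = Sup {enat n | n. \<exists>Z. irreducible_closed_chain X n Z}"

text \<open>For a variety this is the Krull dimension of the local ring at \<open>p\<close>: the prime ideals of
  that ring correspond to the irreducible closed subsets through \<open>p\<close>.\<close>

definition krull_dim_at :: "'a topology \<Rightarrow> 'a \<Rightarrow> enat" where
  "krull_dim_at X p = Sup {enat n | n. \<exists>Z. irreducible_closed_chain X n Z \<and> p \<in> Z 0}"


section \<open>Projective space over the complex numbers\<close>

text \<open>The projective space of a coordinate space consists of the one-dimensional subspaces.\<close>

definition line :: "complex ^ 'n::finite \<Rightarrow> (complex ^ 'n) set" where
  "line v = vec.span {v}"

definition proj_space :: "(complex ^ 'n::finite) set set" where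
  "proj_space = {line v | v. v \<noteq> 0}"

definition homogeneous_poly :: "nat \<Rightarrow> (complex ^ 'n::finite \<Rightarrow> complex) \<Rightarrow> bool" where
  "homogeneous_poly d f \<longleftrightarrow>
     (\<exists>c. \<forall>v. f v = (\<Sum>\<alpha> | (\<Sum>i\<in>UNIV. \<alpha> i) = d. c \<alpha> * (\<Prod>i\<in>UNIV. (v $ i) ^ \<alpha> i)))"

definition zariski :: "(complex ^ 'n::finite) set topology" where
  "zariski = topology_generated_by
     {{line v | v. v \<noteq> 0 \<and> f v \<noteq> 0} | d f. homogeneous_poly d f}"

text \<open>The complex-analytic topology: the quotient topology from the non-zero vectors.\<close>

definition proj_classical :: "(complex ^ 'n::finite) set topology" where
  "proj_classical = topology (\<lambda>U. U \<subseteq> proj_space \<and> open {v. v \<noteq> 0 \<and> line v \<in> U})"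

lemma openin_proj_classical:
  fixes U :: "(complex ^ 'n::finite) set set"
  shows "openin proj_classical U \<longleftrightarrow> U \<subseteq> proj_space \<and> open {v. v \<noteq> 0 \<and> line v \<in> U}"
proof -
  have "istopology (\<lambda>U::(complex ^ 'n) set set. U \<subseteq> proj_space \<and> open {v. v \<noteq> 0 \<and> line v \<in> U})"
    unfolding istopology_def
  proof (intro conjI allI impI; (elim conjE)?)
    fix S T :: "(complex ^ 'n) set set"
    assume S: "S \<subseteq> proj_space" "open {v. v \<noteq> 0 \<and> line v \<in> S}"
      and T: "T \<subseteq> proj_space" "open {v. v \<noteq> 0 \<and> line v \<in> T}"
    show "S \<inter> T \<subseteq> proj_space" using S by blast
    have "{v. v \<noteq> 0 \<and> line v \<in> S \<inter> T} =
        {v. v \<noteq> 0 \<and> line v \<in> S} \<inter> {v. v \<noteq> 0 \<and> line v \<in> T}" by blast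
    then show "open {v. v \<noteq> 0 \<and> line v \<in> S \<inter> T}" using S T by auto
  next
    fix K :: "(complex ^ 'n) set set set"
    assume K: "\<forall>S\<in>K. S \<subseteq> proj_space \<and> open {v. v \<noteq> 0 \<and> line v \<in> S}"
    show "\<Union>K \<subseteq> proj_space" using K by blast
    have "{v. v \<noteq> 0 \<and> line v \<in> \<Union>K} = (\<Union>S\<in>K. {v. v \<noteq> 0 \<and> line v \<in> S})" by blast
    then show "open {v. v \<noteq> 0 \<and> line v \<in> \<Union>K}" using K by auto
  qed
  then show ?thesis
    unfolding proj_classical_def by (simp only: topology_inverse')
qed

lemma topspace_proj_classical:
  "topspace (proj_classical :: (complex ^ 'n::finite) set topology) = proj_space"
proof -
  have "{v. v \<noteq> 0 \<and> line v \<in> proj_space} = - {0 :: complex ^ 'n}"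
    unfolding proj_space_def by blast
  moreover have "open (- {0 :: complex ^ 'n})"
    by (rule open_Compl) (rule closed_singleton)
  ultimately have "openin proj_classical (proj_space :: (complex ^ 'n) set set)"
    unfolding openin_proj_classical by (simp only: order_refl simp_thms)
  moreover have "topspace (proj_classical :: (complex ^ 'n) set topology) \<subseteq> proj_space"
    using openin_topspace[of "proj_classical :: (complex ^ 'n) set topology"]
    unfolding openin_proj_classical by (rule conjunct1)
  ultimately show ?thesis
    using openin_subset by (intro subset_antisym)
qed

lemma topspace_zariski:
  "topspace (zariski :: (complex ^ 'n::finite) set topology) = proj_space"
proof -
  define f :: "complex ^ 'n \<Rightarrow> complex" where "f = (\<lambda>v. 1)"
  have "{\<alpha> :: 'n \<Rightarrow> nat. (\<Sum>i\<in>UNIV. \<alpha> i) = 0} = {\<lambda>_. 0}"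
    by auto
  then have "homogeneous_poly 0 f"
    unfolding homogeneous_poly_def f_def by (intro exI[of _ "\<lambda>_. 1"]) simp
  then have "openin zariski {line v | v. v \<noteq> 0 \<and> f v \<noteq> 0}"
    unfolding zariski_def
    by - (rule topology_generated_by_Basis, rule CollectI, rule exI[of _ 0], rule exI[of _ f],
        rule conjI, rule refl, assumption)
  moreover have "{line v | v. v \<noteq> 0 \<and> f v \<noteq> 0} = proj_space"
    unfolding proj_space_def f_def by (simp only: one_neq_zero simp_thms)
  ultimately have "proj_space \<subseteq> topspace (zariski :: (complex ^ 'n) set topology)"
    by (metis openin_subset)
  moreover have "topspace (zariski :: (complex ^ 'n) set topology) \<subseteq> proj_space"
    unfolding zariski_def topology_generated_by_topspace
  proof (rule Union_least, elim CollectE exE conjE)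
    fix U d and g :: "complex ^ 'n \<Rightarrow> complex"
    assume "U = {line v | v. v \<noteq> 0 \<and> g v \<noteq> 0}"
    then show "U \<subseteq> proj_space"
      unfolding proj_space_def by blast
  qed
  ultimately show ?thesis
    by (intro subset_antisym)
qed


section \<open>Singular points of projective varieties\<close>

text \<open>For a Zariski closed \<open>S\<close> with its reduced structure, and a point \<open>L \<in> S\<close>, this is the
  Zariski tangent space at a non-zero vector of \<open>L\<close> to the affine cone over \<open>S\<close>; it is cut out by
  the differentials of \<^emph>\<open>all\<close> the forms vanishing on \<open>S\<close>. It contains \<open>L\<close>, and the Zariski tangent
  space to \<open>S\<close> at the point \<open>L\<close> is isomorphic to its quotient by \<open>L\<close>.\<close>

definition cone_tangent_space ::
    "(complex ^ 'n::finite) set set \<Rightarrow> (complex ^ 'n) set \<Rightarrow> (complex ^ 'n) set" where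
  "cone_tangent_space S L =
     {w. \<forall>d f. homogeneous_poly d f \<and> (\<forall>u. u \<noteq> 0 \<and> line u \<in> S \<longrightarrow> f u = 0) \<longrightarrow>
           (\<forall>v\<in>L - {0}. ((\<lambda>s. f (v + s *s w)) has_field_derivative 0) (at 0))}"

definition singular_locus :: "(complex ^ 'n::finite) set set \<Rightarrow> (complex ^ 'n) set set" where
  "singular_locus S =
     {L \<in> S. enat (vec.dim (cone_tangent_space S L) - 1) \<noteq> krull_dim_at (subtopology zariski S) L}"


section \<open>Quadratic forms and their exterior cube\<close>

text \<open>The space \<open>W\<close> is \<^typ>\<open>complex ^ 3\<close>, and \<open>S\<^sup>2W\<close> has the basis of monomials in \<open>x, y, z\<close>.\<close>

type_synonym W = "complex ^ 3"

definition xW :: W where "xW = axis 1 1"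
definition yW :: W where "yW = axis 2 1"
definition zW :: W where "zW = axis 3 1"

datatype mon = XX | XY | XZ | YY | YZ | ZZ

lemma UNIV_mon: "UNIV = {XX, XY, XZ, YY, YZ, ZZ}"
  using mon.exhaust by auto

instance mon :: finite
  by standard (simp add: UNIV_mon)

type_synonym S2W = "complex ^ mon"

definition sym_mult :: "W \<Rightarrow> W \<Rightarrow> S2W"  (infixl "\<bullet>\<^sub>S" 70) where
  "u \<bullet>\<^sub>S v = (\<chi> m. case m of
     XX \<Rightarrow> u$1 * v$1
   | XY \<Rightarrow> u$1 * v$2 + u$2 * v$1
   | XZ \<Rightarrow> u$1 * v$3 + u$3 * v$1
   | YY \<Rightarrow> u$2 * v$2
   | YZ \<Rightarrow> u$2 * v$3 + u$3 * v$2
   | ZZ \<Rightarrow> u$3 * v$3)"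

text \<open>The basis of \<open>\<And>\<^sup>3S\<^sup>2W\<close> consists of the wedges of increasing triples of monomials; the order
  chosen on the monomials only affects signs.\<close>

instantiation mon :: linorder
begin

definition mon_rank :: "mon \<Rightarrow> nat" where
  "mon_rank m = (case m of XX \<Rightarrow> 0 | XY \<Rightarrow> 1 | XZ \<Rightarrow> 2 | YY \<Rightarrow> 3 | YZ \<Rightarrow> 4 | ZZ \<Rightarrow> 5)"

definition less_eq_mon :: "mon \<Rightarrow> mon \<Rightarrow> bool" where
  "m \<le> m' \<longleftrightarrow> mon_rank m \<le> mon_rank m'"

definition less_mon :: "mon \<Rightarrow> mon \<Rightarrow> bool" where
  "m < m' \<longleftrightarrow> mon_rank m < mon_rank m'"

instance
proof
  fix a b c :: mon
  show "a < b \<longleftrightarrow> a \<le> b \<and> \<not> b \<le> a"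
    unfolding less_eq_mon_def less_mon_def by linarith
  show "a \<le> a"
    unfolding less_eq_mon_def by (rule order_refl)
  show "a \<le> b \<Longrightarrow> b \<le> c \<Longrightarrow> a \<le> c"
    unfolding less_eq_mon_def by (rule order_trans)
  show "a \<le> b \<Longrightarrow> b \<le> a \<Longrightarrow> a = b"
    unfolding less_eq_mon_def by (cases a; cases b) (simp_all add: mon_rank_def)
  show "a \<le> b \<or> b \<le> a"
    unfolding less_eq_mon_def by (rule linear)
qed

end

typedef mon_triple = "{t :: mon \<times> mon \<times> mon. case t of (i, j, k) \<Rightarrow> i < j \<and> j < k}"
  by (rule exI[of _ "(XX, XY, XZ)"]) (simp add: less_mon_def mon_rank_def)

instance mon_triple :: finite
proof
  have "finite (Rep_mon_triple ` UNIV)"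
    by (rule finite)
  then show "finite (UNIV :: mon_triple set)"
    by (rule finite_imageD) (simp add: inj_on_def Rep_mon_triple_inject)
qed

type_synonym ext3S2W = "complex ^ mon_triple"

definition wedge3 :: "S2W \<Rightarrow> S2W \<Rightarrow> S2W \<Rightarrow> ext3S2W" where
  "wedge3 a b c = (\<chi> T. case Rep_mon_triple T of (i, j, k) \<Rightarrow>
     det (vector [vector [a$i, a$j, a$k],
                  vector [b$i, b$j, b$k],
                  vector [c$i, c$j, c$k]] :: complex ^ 3 ^ 3))"


section \<open>The variety Y, its torus action and its cells\<close>

text \<open>\<open>R $ i $ j\<close> is the entry of the \<open>2 \<times> 3\<close> matrix \<open>R\<close> in row \<open>i\<close> and column \<open>j\<close>.\<close>

type_synonym mat23 = "W ^ 3 ^ 2"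

definition minor :: "mat23 \<Rightarrow> 3 \<Rightarrow> 3 \<Rightarrow> S2W" where
  "minor R j k = (R$1$j) \<bullet>\<^sub>S (R$2$k) - (R$1$k) \<bullet>\<^sub>S (R$2$j)"

definition minors_wedge :: "mat23 \<Rightarrow> ext3S2W" where
  "minors_wedge R = wedge3 (minor R 1 2) (minor R 1 3) (minor R 2 3)"

text \<open>The three maximal minors of \<open>R\<close> are linearly independent iff their wedge does not vanish.
  The indices are kept in the family because coinciding minors count as dependent.\<close>

definition stable :: "mat23 \<Rightarrow> bool" where
  "stable R \<longleftrightarrow>
     (\<forall>\<alpha> \<beta> \<gamma>. \<alpha> *s minor R 1 2 + \<beta> *s minor R 1 3 + \<gamma> *s minor R 2 3 = 0 \<longrightarrow>
        \<alpha> = 0 \<and> \<beta> = 0 \<and> \<gamma> = 0)"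

text \<open>The orbit of \<open>R\<close> under \<open>GL(2) \<times> GL(3)\<close> is identified with the Pluecker point of the span of
  the maximal minors of \<open>R\<close>. This is the closed embedding of the GIT quotient into
  \<open>Gr(3, S\<^sup>2W) \<subset> P(\<And>\<^sup>3S\<^sup>2W)\<close>, so that the quotient \<open>Yvar\<close> becomes a closed subvariety of projective 19-space.\<close>

definition orbit_point :: "mat23 \<Rightarrow> ext3S2W set" where
  "orbit_point R = line (minors_wedge R)"

definition Yvar :: "ext3S2W set set" where
  "Yvar = {orbit_point R | R. stable R}"

definition torus_W :: "complex \<Rightarrow> W \<Rightarrow> W" where
  "torus_W t u = u$1 *s xW + (t * u$2) *s yW + (t ^ 3 * u$3) *s zW"

definition torus_mat :: "complex \<Rightarrow> mat23 \<Rightarrow> mat23" where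
  "torus_mat t R = (\<chi> i j. torus_W t (R$i$j))"

definition cell :: "ext3S2W set \<Rightarrow> ext3S2W set set" where
  "cell P = {orbit_point R | R. stable R \<and>
     limitin proj_classical (\<lambda>t. orbit_point (torus_mat t R)) P at_infinity}"

definition Dvar :: "ext3S2W set set" where
  "Dvar = Yvar - cell (line (wedge3 (zW \<bullet>\<^sub>S zW) (zW \<bullet>\<^sub>S yW) (zW \<bullet>\<^sub>S xW)))"

end

(*
  Write R = x X + y Y + z Z with complex 2 x 3 matrices X, Y, Z, and let k be the cross product of the
  rows of Z. The Pluecker coordinate that cuts out D equals det(X k, Y k). It is quadratic in k, so its
  differential vanishes where k = 0, i.e. where Z has rank at most 1; where k is non-zero, stability
  gives (X k, Y k) \<noteq> 0, and the coordinate is affine with non-zero slope in some entry of X or Y.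
  Hence D is singular exactly at the nets of conics through the point x = y = 0. At a generic point
  with k = 0 the divisor has two branches whose tangent spaces span, so there the tangent space is all
  of that of Y; the remaining points with k = 0 follow because a polynomial identity that holds
  generically holds everywhere.

  Up to base change, D consists of the nets l u, l v, a v - b u with l in the span of x and y: schemes
  P + (two points on l), where u = v = 0 at P. The locus k = 0 is given by the same formula with u, v in
  the span of x and y and with l arbitrary. Both are images of affine spaces, hence irreducible. Fixing
  these data one after the other yields chains of irreducible closed subsets; no chain is longer, since
  the forms that separate its members are algebraically independent and Y contains a dense affine
  6-space, on which the monomials of bounded degree satisfy too many linear relations.
*)
theory Submission
  imports Defs "HOL-Computational_Algebra.Polynomial"
begin

section \<open>Homogeneous polynomials and polynomial functions\<close>

text \<open>The tangent space is cut out by all forms vanishing on the divisor, and the ideal of the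
  divisor is never computed. What is computed is the differential of such a form after pulling it
  back to matrices along \<open>minors_wedge\<close>; this decides which tangent vectors of Y
  survive. An upper bound for tangent vectors is derived for Y only, from a chart whose inverse is
  given by linear Pluecker coordinates. Charts are homogenised: \<open>minors_wedge\<close> has
  degree 6 in the entries (three minors of degree 2), and 7 homogeneous parameters describe the
  affine cone over a 6-fold. Hence the cone tangent spaces of the divisor have dimension 6 at
  regular points and at least 7 at singular ones, against the local dimension 5. Irreducibility,
  density and identity arguments take place on vector spaces of parameters, where a product of
  nonzero polynomials is nonzero. The local dimension calls for a chain of length 5 starting at the
  given point; this forces the distinction whether l lies in the span of u and v.\<close>

lemma finite_exponents: "finite {\<alpha> :: 'n::finite \<Rightarrow> nat. (\<Sum>i\<in>UNIV. \<alpha> i) = d}"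
proof (rule finite_subset)
  show "{\<alpha> :: 'n \<Rightarrow> nat. (\<Sum>i\<in>UNIV. \<alpha> i) = d} \<subseteq> (UNIV \<rightarrow>\<^sub>E {..d})"
    by (auto simp: PiE_iff intro!: member_le_sum)
  show "finite ((UNIV :: 'n set) \<rightarrow>\<^sub>E {..d})"
    by (intro finite_PiE) auto
qed

lemma homogeneous_poly_zero: "homogeneous_poly d (\<lambda>v. 0)"
  unfolding homogeneous_poly_def by (rule exI[of _ "\<lambda>_. 0"]) simp

lemma homogeneous_poly_const: "homogeneous_poly 0 (\<lambda>v :: complex ^ 'n::finite. c)"
proof -
  have "{\<alpha> :: 'n \<Rightarrow> nat. (\<Sum>i\<in>UNIV. \<alpha> i) = 0} = {\<lambda>_. 0}"
    by auto
  then show ?thesis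
    unfolding homogeneous_poly_def by (intro exI[of _ "\<lambda>_. c"]) simp
qed

lemma homogeneous_poly_add:
  assumes "homogeneous_poly d f" "homogeneous_poly d g"
  shows "homogeneous_poly d (\<lambda>v. f v + g v)"
proof -
  obtain a b where "\<And>v. f v = (\<Sum>\<alpha> | (\<Sum>i\<in>UNIV. \<alpha> i) = d. a \<alpha> * (\<Prod>i\<in>UNIV. (v $ i) ^ \<alpha> i))"
    "\<And>v. g v = (\<Sum>\<alpha> | (\<Sum>i\<in>UNIV. \<alpha> i) = d. b \<alpha> * (\<Prod>i\<in>UNIV. (v $ i) ^ \<alpha> i))"
    using assms unfolding homogeneous_poly_def by blast
  then show ?thesis
    unfolding homogeneous_poly_def
    by (intro exI[of _ "\<lambda>\<alpha>. a \<alpha> + b \<alpha>"]) (simp add: sum.distrib distrib_right)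
qed

lemma homogeneous_poly_cmult:
  assumes "homogeneous_poly d f"
  shows "homogeneous_poly d (\<lambda>v. c * f v)"
proof -
  obtain a where "\<And>v. f v = (\<Sum>\<alpha> | (\<Sum>i\<in>UNIV. \<alpha> i) = d. a \<alpha> * (\<Prod>i\<in>UNIV. (v $ i) ^ \<alpha> i))"
    using assms unfolding homogeneous_poly_def by blast
  then show ?thesis
    unfolding homogeneous_poly_def
    by (intro exI[of _ "\<lambda>\<alpha>. c * a \<alpha>"]) (simp add: sum_distrib_left mult.assoc)
qed

lemma homogeneous_poly_diff:
  assumes "homogeneous_poly d f" "homogeneous_poly d g"
  shows "homogeneous_poly d (\<lambda>v. f v - g v)"
  using homogeneous_poly_add[OF assms(1) homogeneous_poly_cmult[OF assms(2), of "-1"]] by simp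

lemma homogeneous_poly_sum:
  assumes "\<And>i. i \<in> I \<Longrightarrow> homogeneous_poly d (f i)"
  shows "homogeneous_poly d (\<lambda>v. \<Sum>i\<in>I. f i v)"
  using assms
  by (induction I rule: infinite_finite_induct)
    (auto simp: homogeneous_poly_zero intro!: homogeneous_poly_add)

text \<open>Multiplication by one coordinate shifts exponents: \<open>up\<close> maps the exponents
  of degree d bijectively onto those of degree d + 1 with a positive entry at k, and
  \<open>dn\<close> is its inverse. All products of forms are built from this case.\<close>

lemma homogeneous_poly_coord_mult:
  fixes f :: "complex ^ 'n::finite \<Rightarrow> complex"
  assumes "homogeneous_poly d f"
  shows "homogeneous_poly (Suc d) (\<lambda>v. v $ k * f v)"
proof -
  obtain a where a: "\<And>v. f v = (\<Sum>\<alpha> | (\<Sum>i\<in>UNIV. \<alpha> i) = d. a \<alpha> * (\<Prod>i\<in>UNIV. (v $ i) ^ \<alpha> i))"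
    using assms unfolding homogeneous_poly_def by blast
  define up where "up = (\<lambda>\<alpha>::'n \<Rightarrow> nat. \<alpha>(k := Suc (\<alpha> k)))"
  define dn where "dn = (\<lambda>\<beta>::'n \<Rightarrow> nat. \<beta>(k := \<beta> k - 1))"
  have sum_upd: "(\<Sum>i\<in>UNIV. (\<alpha>(k := n)) i) = n + (\<Sum>i\<in>UNIV - {k}. \<alpha> i)" for \<alpha> :: "'n \<Rightarrow> nat" and n
    by (subst sum.remove[of _ k]) auto
  have sum_k: "(\<Sum>i\<in>UNIV. \<alpha> i) = \<alpha> k + (\<Sum>i\<in>UNIV - {k}. \<alpha> i)" for \<alpha> :: "'n \<Rightarrow> nat"
    by (subst sum.remove[of _ k]) auto
  have prod_up: "(\<Prod>i\<in>UNIV. (v $ i) ^ up \<alpha> i) = v $ k * (\<Prod>i\<in>UNIV. (v $ i) ^ \<alpha> i)"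
    for v :: "complex ^ 'n" and \<alpha>
  proof -
    have "(\<Prod>i\<in>UNIV. (v $ i) ^ up \<alpha> i) = v $ k ^ Suc (\<alpha> k) * (\<Prod>i\<in>UNIV - {k}. (v $ i) ^ up \<alpha> i)"
      by (subst prod.remove[of _ k]) (auto simp: up_def)
    also have "(\<Prod>i\<in>UNIV - {k}. (v $ i) ^ up \<alpha> i) = (\<Prod>i\<in>UNIV - {k}. (v $ i) ^ \<alpha> i)"
      by (rule prod.cong) (auto simp: up_def)
    also have "v $ k ^ Suc (\<alpha> k) * \<dots> = v $ k * (v $ k ^ \<alpha> k * (\<Prod>i\<in>UNIV - {k}. (v $ i) ^ \<alpha> i))"
      by simp
    also have "v $ k ^ \<alpha> k * (\<Prod>i\<in>UNIV - {k}. (v $ i) ^ \<alpha> i) = (\<Prod>i\<in>UNIV. (v $ i) ^ \<alpha> i)"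
      by (subst (2) prod.remove[of _ k]) auto
    finally show ?thesis .
  qed
  have "v $ k * f v = (\<Sum>\<beta> | (\<Sum>i\<in>UNIV. \<beta> i) = Suc d.
      (if \<beta> k = 0 then 0 else a (dn \<beta>)) * (\<Prod>i\<in>UNIV. (v $ i) ^ \<beta> i))" for v
  proof -
    have "v $ k * f v = (\<Sum>\<alpha> | (\<Sum>i\<in>UNIV. \<alpha> i) = d. a \<alpha> * (\<Prod>i\<in>UNIV. (v $ i) ^ up \<alpha> i))"
      by (simp add: a sum_distrib_left prod_up mult.left_commute)
    also have "\<dots> = (\<Sum>\<beta>\<in>{\<beta>. (\<Sum>i\<in>UNIV. \<beta> i) = Suc d \<and> \<beta> k \<noteq> 0}.
        a (dn \<beta>) * (\<Prod>i\<in>UNIV. (v $ i) ^ \<beta> i))"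
      by (rule sum.reindex_bij_witness[of _ dn up])
        (auto simp: up_def dn_def sum_upd sum_k)
    also have "\<dots> = (\<Sum>\<beta> | (\<Sum>i\<in>UNIV. \<beta> i) = Suc d.
      (if \<beta> k = 0 then 0 else a (dn \<beta>)) * (\<Prod>i\<in>UNIV. (v $ i) ^ \<beta> i))"
      by (rule sum.mono_neutral_cong_left) (auto simp: finite_exponents)
    finally show ?thesis .
  qed
  then show ?thesis
    unfolding homogeneous_poly_def
    by (intro exI[of _ "\<lambda>\<beta>. if \<beta> k = 0 then 0 else a (dn \<beta>)"]) blast
qed

lemma homogeneous_poly_monomial_mult:
  fixes g :: "complex ^ 'n::finite \<Rightarrow> complex"
  assumes "finite I" "homogeneous_poly d g"
  shows "homogeneous_poly ((\<Sum>i\<in>I. \<alpha> i) + d) (\<lambda>v. (\<Prod>i\<in>I. (v $ i) ^ \<alpha> i) * g v)"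
  using assms
proof (induction I)
  case (insert k I)
  have "homogeneous_poly (n + ((\<Sum>i\<in>I. \<alpha> i) + d)) (\<lambda>v. v $ k ^ n * ((\<Prod>i\<in>I. (v $ i) ^ \<alpha> i) * g v))" for n
    by (induction n)
      (use insert in \<open>auto dest: homogeneous_poly_coord_mult[of _ _ k] simp: mult.assoc\<close>)
  from this[of "\<alpha> k"] show ?case
    using insert.hyps by (simp add: mult.assoc add.assoc)
qed simp

lemma homogeneous_poly_mult:
  fixes f g :: "complex ^ 'n::finite \<Rightarrow> complex"
  assumes "homogeneous_poly d f" "homogeneous_poly e g"
  shows "homogeneous_poly (d + e) (\<lambda>v. f v * g v)"
proof -
  obtain a where a: "\<And>v. f v = (\<Sum>\<alpha> | (\<Sum>i\<in>UNIV. \<alpha> i) = d. a \<alpha> * (\<Prod>i\<in>UNIV. (v $ i) ^ \<alpha> i))"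
    using assms unfolding homogeneous_poly_def by blast
  have "homogeneous_poly (d + e)
      (\<lambda>v. \<Sum>\<alpha> | (\<Sum>i\<in>UNIV. \<alpha> i) = d. a \<alpha> * ((\<Prod>i\<in>UNIV. (v $ i) ^ \<alpha> i) * g v))"
    using homogeneous_poly_monomial_mult[OF finite[of UNIV] assms(2)]
    by (intro homogeneous_poly_sum homogeneous_poly_cmult) auto
  then show ?thesis
    by (simp add: a sum_distrib_right mult.assoc)
qed

lemma homogeneous_poly_power:
  assumes "homogeneous_poly d f"
  shows "homogeneous_poly (n * d) (\<lambda>v. f v ^ n)"
  by (induction n) (auto intro: homogeneous_poly_const homogeneous_poly_mult assms)

lemma homogeneous_poly_coord: "homogeneous_poly 1 (\<lambda>v. v $ k)"
  using homogeneous_poly_coord_mult[OF homogeneous_poly_const, of k 1] by simp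

lemma homogeneous_poly_linear: "homogeneous_poly 1 (\<lambda>v. \<Sum>k\<in>UNIV. c k * v $ k)"
  by (intro homogeneous_poly_sum homogeneous_poly_cmult homogeneous_poly_coord)

lemma homogeneous_poly_scale:
  assumes "homogeneous_poly d f"
  shows "f (c *s v) = c ^ d * f v"
proof -
  obtain a where a: "\<And>v. f v = (\<Sum>\<alpha> | (\<Sum>i\<in>UNIV. \<alpha> i) = d. a \<alpha> * (\<Prod>i\<in>UNIV. (v $ i) ^ \<alpha> i))"
    using assms unfolding homogeneous_poly_def by blast
  show ?thesis
    unfolding a sum_distrib_left
  proof (rule sum.cong)
    fix \<alpha> :: "'a \<Rightarrow> nat" assume "\<alpha> \<in> {\<alpha>. (\<Sum>i\<in>UNIV. \<alpha> i) = d}"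
    then have "(\<Prod>i\<in>UNIV. c ^ \<alpha> i) = c ^ d"
      by (simp add: power_sum[symmetric])
    then show "a \<alpha> * (\<Prod>i\<in>UNIV. (c *s v) $ i ^ \<alpha> i) = c ^ d * (a \<alpha> * (\<Prod>i\<in>UNIV. v $ i ^ \<alpha> i))"
      by (simp add: power_mult_distrib prod.distrib)
  qed simp
qed

section \<open>Polynomial functions and their differentials\<close>

inductive polyfun :: "('a \<Rightarrow> complex) set \<Rightarrow> ('a \<Rightarrow> complex) \<Rightarrow> bool" for C where
  polyfun_const: "polyfun C (\<lambda>_. c)"
| polyfun_coord: "c \<in> C \<Longrightarrow> polyfun C c"
| polyfun_add: "polyfun C f \<Longrightarrow> polyfun C g \<Longrightarrow> polyfun C (\<lambda>v. f v + g v)"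
| polyfun_mult: "polyfun C f \<Longrightarrow> polyfun C g \<Longrightarrow> polyfun C (\<lambda>v. f v * g v)"

lemma polyfun_sum: "(\<And>i. i \<in> I \<Longrightarrow> polyfun C (f i)) \<Longrightarrow> polyfun C (\<lambda>v. \<Sum>i\<in>I. f i v)"
  by (induction I rule: infinite_finite_induct) (auto intro: polyfun.intros)

lemma polyfun_prod: "(\<And>i. i \<in> I \<Longrightarrow> polyfun C (f i)) \<Longrightarrow> polyfun C (\<lambda>v. \<Prod>i\<in>I. f i v)"
  by (induction I rule: infinite_finite_induct) (auto intro: polyfun.intros)

lemma polyfun_power: "polyfun C f \<Longrightarrow> polyfun C (\<lambda>v. f v ^ n)"
  by (induction n) (auto intro: polyfun.intros)

lemma polyfun_diff:
  assumes "polyfun C f" "polyfun C g"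
  shows "polyfun C (\<lambda>v. f v - g v)"
  using polyfun_add[OF assms(1) polyfun_mult[OF polyfun_const[of C "-1"] assms(2)]] by simp

lemma polyfun_homogeneous:
  assumes "homogeneous_poly d f" "\<And>k. polyfun C (\<lambda>x. \<Phi> x $ k)"
  shows "polyfun C (\<lambda>x. f (\<Phi> x))"
proof -
  obtain a where a: "\<And>v. f v = (\<Sum>\<alpha> | (\<Sum>i\<in>UNIV. \<alpha> i) = d. a \<alpha> * (\<Prod>i\<in>UNIV. (v $ i) ^ \<alpha> i))"
    using assms unfolding homogeneous_poly_def by blast
  show ?thesis
    unfolding a by (intro polyfun_sum polyfun_mult polyfun_const polyfun_prod polyfun_power assms)
qed

text \<open>Testing on curves puts the chain rule into the definition. Only the derivatives at 0 of
  the coordinates in \<open>C\<close> enter, so the same notion serves vectors and nested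
  matrices.\<close>

definition has_differential ::
    "('a \<Rightarrow> complex) set \<Rightarrow> ('a \<Rightarrow> complex) \<Rightarrow> ('a \<Rightarrow> 'a \<Rightarrow> complex) \<Rightarrow> bool" where
  "has_differential C f D \<longleftrightarrow>
     (\<forall>\<gamma> w. (\<forall>c\<in>C. ((\<lambda>s. c (\<gamma> s)) has_field_derivative c w) (at 0)) \<longrightarrow>
        ((\<lambda>s. f (\<gamma> s)) has_field_derivative D (\<gamma> 0) w) (at 0))"

text \<open>Sum and product rule. Besides existence, two facts are recorded: the differential is
  polynomial in the base point, which the density argument at singular points uses, and linear in
  the direction, where linear combinations are read off the coordinates.\<close>

lemma polyfun_differential:
  assumes "polyfun C f"
  shows "\<exists>D. has_differential C f D \<and> (\<forall>w. polyfun C (\<lambda>v. D v w)) \<and>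
    (\<forall>v a b w1 w2 w3. (\<forall>c\<in>C. c w3 = a * c w1 + b * c w2) \<longrightarrow> D v w3 = a * D v w1 + b * D v w2)"
  using assms
proof induction
  case (polyfun_const c)
  show ?case
    by (rule exI[of _ "\<lambda>_ _. 0"]) (auto simp: has_differential_def intro: polyfun.intros)
next
  case (polyfun_coord c)
  then show ?case
    by (intro exI[of _ "\<lambda>v w. c w"]) (auto simp: has_differential_def intro: polyfun.intros)
next
  case (polyfun_add f g)
  then obtain D E where "has_differential C f D \<and> (\<forall>w. polyfun C (\<lambda>v. D v w)) \<and>
      (\<forall>v a b w1 w2 w3. (\<forall>c\<in>C. c w3 = a * c w1 + b * c w2) \<longrightarrow> D v w3 = a * D v w1 + b * D v w2)"
    "has_differential C g E \<and> (\<forall>w. polyfun C (\<lambda>v. E v w)) \<and>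
      (\<forall>v a b w1 w2 w3. (\<forall>c\<in>C. c w3 = a * c w1 + b * c w2) \<longrightarrow> E v w3 = a * E v w1 + b * E v w2)"
    by blast
  then show ?case
    by (intro exI[of _ "\<lambda>v w. D v w + E v w"])
      (simp add: has_differential_def algebra_simps polyfun.polyfun_add DERIV_add)
next
  case (polyfun_mult f g)
  then obtain D E where D: "has_differential C f D" "\<And>w. polyfun C (\<lambda>v. D v w)"
      "\<And>v a b w1 w2 w3. (\<forall>c\<in>C. c w3 = a * c w1 + b * c w2) \<Longrightarrow> D v w3 = a * D v w1 + b * D v w2"
    and E: "has_differential C g E" "\<And>w. polyfun C (\<lambda>v. E v w)"
      "\<And>v a b w1 w2 w3. (\<forall>c\<in>C. c w3 = a * c w1 + b * c w2) \<Longrightarrow> E v w3 = a * E v w1 + b * E v w2"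
    by blast
  show ?case
  proof (intro exI[of _ "\<lambda>v w. D v w * g v + f v * E v w"] conjI allI impI)
    show "has_differential C (\<lambda>v. f v * g v) (\<lambda>v w. D v w * g v + f v * E v w)"
      unfolding has_differential_def
    proof (intro allI impI)
      fix \<gamma> w
      assume "\<forall>c\<in>C. ((\<lambda>s. c (\<gamma> s)) has_field_derivative c w) (at 0)"
      then have "((\<lambda>s. f (\<gamma> s)) has_field_derivative D (\<gamma> 0) w) (at 0)"
        "((\<lambda>s. g (\<gamma> s)) has_field_derivative E (\<gamma> 0) w) (at 0)"
        using D(1) E(1) unfolding has_differential_def by blast+
      from DERIV_mult[OF this]
      show "((\<lambda>s. f (\<gamma> s) * g (\<gamma> s)) has_field_derivative
          D (\<gamma> 0) w * g (\<gamma> 0) + f (\<gamma> 0) * E (\<gamma> 0) w) (at 0)"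
        by (simp add: mult.commute)
    qed
    show "polyfun C (\<lambda>v. D v w * g v + f v * E v w)" for w
      by (rule polyfun.polyfun_add[OF polyfun.polyfun_mult[OF D(2) polyfun_mult.hyps(2)]
            polyfun.polyfun_mult[OF polyfun_mult.hyps(1) E(2)]])
    show "D v w3 * g v + f v * E v w3 =
        a * (D v w1 * g v + f v * E v w1) + b * (D v w2 * g v + f v * E v w2)"
      if "\<forall>c\<in>C. c w3 = a * c w1 + b * c w2" for v a b w1 w2 w3
      by (simp add: D(3)[OF that] E(3)[OF that] algebra_simps)
  qed
qed

section \<open>Polynomials in one variable and along lines\<close>

definition polynomial_on :: "('s \<Rightarrow> complex) \<Rightarrow> nat \<Rightarrow> ('s \<Rightarrow> complex) \<Rightarrow> bool" where
  "polynomial_on \<iota> d g \<longleftrightarrow> (\<exists>P. degree P \<le> d \<and> (\<forall>s. g s = poly P (\<iota> s)))"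

lemma polynomial_on_const: "polynomial_on \<iota> d (\<lambda>_. c)"
  unfolding polynomial_on_def by (rule exI[of _ "[:c:]"]) simp

lemma polynomial_on_affine: "1 \<le> d \<Longrightarrow> polynomial_on \<iota> d (\<lambda>s. a + \<iota> s * b)"
  unfolding polynomial_on_def by (rule exI[of _ "[:a, b:]"]) simp

lemma polynomial_on_mono: "polynomial_on \<iota> d g \<Longrightarrow> d \<le> e \<Longrightarrow> polynomial_on \<iota> e g"
  unfolding polynomial_on_def using order_trans by blast

lemma polynomial_on_add:
  "polynomial_on \<iota> d f \<Longrightarrow> polynomial_on \<iota> d g \<Longrightarrow> polynomial_on \<iota> d (\<lambda>s. f s + g s)"
  unfolding polynomial_on_def by (metis degree_add_le poly_add)

lemma polynomial_on_diff:
  "polynomial_on \<iota> d f \<Longrightarrow> polynomial_on \<iota> d g \<Longrightarrow> polynomial_on \<iota> d (\<lambda>s. f s - g s)"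
  unfolding polynomial_on_def by (metis degree_diff_le poly_diff)

lemma polynomial_on_mult:
  "polynomial_on \<iota> d f \<Longrightarrow> polynomial_on \<iota> e g \<Longrightarrow> polynomial_on \<iota> (d + e) (\<lambda>s. f s * g s)"
  unfolding polynomial_on_def
  by (metis add_mono degree_mult_le order_trans poly_mult)

lemma polynomial_on_sum:
  "(\<And>i. i \<in> I \<Longrightarrow> polynomial_on \<iota> d (f i)) \<Longrightarrow> polynomial_on \<iota> d (\<lambda>s. \<Sum>i\<in>I. f i s)"
  by (induction I rule: infinite_finite_induct)
    (auto intro: polynomial_on_add polynomial_on_const)

lemma polynomial_on_power:
  "polynomial_on \<iota> d f \<Longrightarrow> polynomial_on \<iota> (n * d) (\<lambda>s. f s ^ n)"
  by (induction n) (auto intro: polynomial_on_mult polynomial_on_const)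

lemma polynomial_on_prod:
  "(\<And>i. i \<in> I \<Longrightarrow> polynomial_on \<iota> (d i) (f i)) \<Longrightarrow>
    polynomial_on \<iota> (\<Sum>i\<in>I. d i) (\<lambda>s. \<Prod>i\<in>I. f i s)"
  by (induction I rule: infinite_finite_induct)
    (auto intro: polynomial_on_mult polynomial_on_const)

lemma polynomial_on_homogeneous:
  fixes f :: "complex ^ 'n::finite \<Rightarrow> complex"
  assumes "homogeneous_poly d f" "\<And>k. polynomial_on \<iota> m (\<lambda>s. \<Phi> s $ k)"
  shows "polynomial_on \<iota> (d * m) (\<lambda>s. f (\<Phi> s))"
proof -
  obtain a where a: "\<And>v. f v = (\<Sum>\<alpha> | (\<Sum>i\<in>UNIV. \<alpha> i) = d. a \<alpha> * (\<Prod>i\<in>UNIV. (v $ i) ^ \<alpha> i))"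
    using assms unfolding homogeneous_poly_def by blast
  show ?thesis
    unfolding a
  proof (rule polynomial_on_sum)
    fix \<alpha> :: "'n \<Rightarrow> nat" assume \<alpha>: "\<alpha> \<in> {\<alpha>. (\<Sum>i\<in>UNIV. \<alpha> i) = d}"
    have "polynomial_on \<iota> (\<Sum>i\<in>UNIV. \<alpha> i * m) (\<lambda>s. \<Prod>i\<in>UNIV. (\<Phi> s $ i) ^ \<alpha> i)"
      by (intro polynomial_on_prod polynomial_on_power assms)
    also have "(\<Sum>i\<in>UNIV. \<alpha> i * m) = d * m"
      using \<alpha> by (simp add: sum_distrib_right[symmetric])
    finally show "polynomial_on \<iota> (d * m) (\<lambda>s. a \<alpha> * (\<Prod>i\<in>UNIV. (\<Phi> s $ i) ^ \<alpha> i))"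
      using polynomial_on_mult[OF polynomial_on_const[of \<iota> 0 "a \<alpha>"]] by simp
  qed
qed

text \<open>Real lines suffice: they already determine a polynomial.\<close>

definition polynomial_on_lines :: "('a::real_vector \<Rightarrow> complex) \<Rightarrow> bool" where
  "polynomial_on_lines p \<longleftrightarrow>
     (\<forall>u w. \<exists>d. polynomial_on complex_of_real d (\<lambda>s. p (u + s *\<^sub>R w)))"

text \<open>Restrict both functions to the real line from a point with p nonzero to a point with q
  nonzero: there they are nonzero polynomials, yet their product has infinitely many roots.\<close>

lemma polynomial_on_lines_mult_eq_0:
  fixes p q :: "'a::real_vector \<Rightarrow> complex"
  assumes "polynomial_on_lines p" "polynomial_on_lines q" "\<And>x. p x * q x = 0"
  shows "(\<forall>x. p x = 0) \<or> (\<forall>x. q x = 0)"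
proof (rule ccontr)
  assume "\<not> ?thesis"
  then obtain u w where u: "p u \<noteq> 0" and w: "q w \<noteq> 0"
    by blast
  obtain P Q where P: "\<And>s. p (u + s *\<^sub>R (w - u)) = poly P (complex_of_real s)"
    and Q: "\<And>s. q (u + s *\<^sub>R (w - u)) = poly Q (complex_of_real s)"
    using assms(1,2) unfolding polynomial_on_lines_def polynomial_on_def by metis
  have "P \<noteq> 0" using P[of 0] u by auto
  moreover have "Q \<noteq> 0" using Q[of 1] w by auto
  ultimately have "finite {x. poly (P * Q) x = 0}"
    using poly_roots_finite[of "P * Q"] by simp
  moreover have "range complex_of_real \<subseteq> {x. poly (P * Q) x = 0}"
    using assms(3)[of "u + s *\<^sub>R (w - u)" for s] by (auto simp: P Q)
  moreover have "infinite (range complex_of_real)"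
    by (simp add: finite_image_iff inj_on_def infinite_UNIV_char_0)
  ultimately show False
    using finite_subset by blast
qed

lemma polynomial_on_lines_mult:
  assumes "polynomial_on_lines p" "polynomial_on_lines q"
  shows "polynomial_on_lines (\<lambda>x. p x * q x)"
  unfolding polynomial_on_lines_def
proof (intro allI)
  fix u w
  obtain d e where "polynomial_on complex_of_real d (\<lambda>s. p (u + s *\<^sub>R w))"
    "polynomial_on complex_of_real e (\<lambda>s. q (u + s *\<^sub>R w))"
    using assms unfolding polynomial_on_lines_def by blast
  from polynomial_on_mult[OF this]
  show "\<exists>d. polynomial_on complex_of_real d (\<lambda>s. p (u + s *\<^sub>R w) * q (u + s *\<^sub>R w))" ..
qed

lemma polynomial_on_lines_diff:
  assumes "polynomial_on_lines p" "polynomial_on_lines q"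
  shows "polynomial_on_lines (\<lambda>x. p x - q x)"
  unfolding polynomial_on_lines_def
proof (intro allI)
  fix u w
  obtain d e where "polynomial_on complex_of_real d (\<lambda>s. p (u + s *\<^sub>R w))"
    "polynomial_on complex_of_real e (\<lambda>s. q (u + s *\<^sub>R w))"
    using assms unfolding polynomial_on_lines_def by blast
  then have "polynomial_on complex_of_real (max d e) (\<lambda>s. p (u + s *\<^sub>R w) - q (u + s *\<^sub>R w))"
    by (intro polynomial_on_diff) (auto elim: polynomial_on_mono)
  then show "\<exists>d. polynomial_on complex_of_real d (\<lambda>s. p (u + s *\<^sub>R w) - q (u + s *\<^sub>R w))" ..
qed

lemma polynomial_on_lines_const: "polynomial_on_lines (\<lambda>x. c)"
  unfolding polynomial_on_lines_def by (blast intro: polynomial_on_const)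

lemma polynomial_on_lines_add:
  assumes "polynomial_on_lines p" "polynomial_on_lines q"
  shows "polynomial_on_lines (\<lambda>x. p x + q x)"
  using polynomial_on_lines_diff[OF assms(1) polynomial_on_lines_diff[OF polynomial_on_lines_const[of 0] assms(2)]]
  by simp

lemma polynomial_on_lines_polyfun:
  assumes "polyfun C f" "\<And>c. c \<in> C \<Longrightarrow> polynomial_on_lines (\<lambda>x. c (\<Phi> x))"
  shows "polynomial_on_lines (\<lambda>x. f (\<Phi> x))"
  using assms
  by induction (simp_all add: polynomial_on_lines_const polynomial_on_lines_add polynomial_on_lines_mult)

section \<open>Zariski closed sets and irreducibility\<close>

lemma mem_line_iff: "u \<in> line v \<longleftrightarrow> (\<exists>c. u = c *s v)"
  unfolding line_def by (auto simp: vec.span_singleton)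

lemma line_scale: "c \<noteq> 0 \<Longrightarrow> line (c *s v) = line v"
  unfolding set_eq_iff mem_line_iff
  by (metis nonzero_eq_divide_eq vector_smult_assoc)

lemma line_eqD:
  assumes "line u = line v" "u \<noteq> 0"
  obtains c where "c \<noteq> 0" "u = c *s v"
proof -
  have "u \<in> line v" using assms(1) mem_line_iff[of u u] by (metis vector_smult_lid)
  then show ?thesis using that assms(2) unfolding mem_line_iff by force
qed

lemma homogeneous_poly_line:
  assumes "homogeneous_poly d f" "line u = line v" "u \<noteq> 0" "v \<noteq> 0"
  shows "f u = 0 \<longleftrightarrow> f v = 0"
proof -
  obtain c where "c \<noteq> 0" "u = c *s v" using line_eqD[OF assms(2,3)] by blast
  then show ?thesis using homogeneous_poly_scale[OF assms(1)] by simp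
qed

definition vanishes_on :: "(complex ^ 'n::finite \<Rightarrow> complex) \<Rightarrow> (complex ^ 'n) set set \<Rightarrow> bool" where
  "vanishes_on f S \<longleftrightarrow> (\<forall>u. u \<noteq> 0 \<and> line u \<in> S \<longrightarrow> f u = 0)"

lemma vanishes_on_subset: "vanishes_on f T \<Longrightarrow> S \<subseteq> T \<Longrightarrow> vanishes_on f S"
  unfolding vanishes_on_def by blast

text \<open>Strictness of an inclusion, witnessed by a form; the dimension bounds compute with these
  witnesses.\<close>

abbreviation separated :: "(complex ^ 'n::finite) set set \<Rightarrow> (complex ^ 'n) set set \<Rightarrow> bool" where
  "separated S T \<equiv> \<exists>d f. homogeneous_poly d f \<and> vanishes_on f S \<and> \<not> vanishes_on f T"

lemma vanishes_on_line:
  assumes "homogeneous_poly d f" "v \<noteq> 0"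
  shows "vanishes_on f {line v} \<longleftrightarrow> f v = 0"
  using homogeneous_poly_line[OF assms(1)] assms(2) unfolding vanishes_on_def by blast

text \<open>Intersections of generating open sets are again of this kind, by multiplying the forms,
  so the generating sets are a basis.\<close>

lemma openin_zariskiD:
  fixes U :: "(complex ^ 'n::finite) set set"
  assumes "openin zariski U" "v \<noteq> 0" "line v \<in> U"
  shows "\<exists>d f. homogeneous_poly d f \<and> f v \<noteq> 0 \<and> (\<forall>u. u \<noteq> 0 \<and> f u \<noteq> 0 \<longrightarrow> line u \<in> U)"
  using openin_topology_generated_by[OF assms(1)[unfolded zariski_def]] assms(3)
proof induction
  case (Int a b)
  then obtain d f e g where "homogeneous_poly d f" "f v \<noteq> 0" "\<forall>u. u \<noteq> 0 \<and> f u \<noteq> 0 \<longrightarrow> line u \<in> a"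
    "homogeneous_poly e g" "g v \<noteq> 0" "\<forall>u. u \<noteq> 0 \<and> g u \<noteq> 0 \<longrightarrow> line u \<in> b"
    by blast
  then show ?case
    by (intro exI[of _ "d + e"] exI[of _ "\<lambda>v. f v * g v"]) (simp add: homogeneous_poly_mult)
next
  case (UN K)
  then show ?case by blast
next
  case (Basis s)
  then obtain d f where f: "homogeneous_poly d f" "s = {line u | u. u \<noteq> 0 \<and> f u \<noteq> 0}"
    by blast
  then obtain u where "u \<noteq> 0" "f u \<noteq> 0" "line u = line v"
    using Basis.prems by auto
  then have "f v \<noteq> 0" using homogeneous_poly_line[OF f(1)] assms(2) by blast
  then show ?case using f by blast
qed simp

lemma closedin_zariski_zero_locus:
  assumes "homogeneous_poly d f" "X \<subseteq> proj_space"
  shows "closedin (subtopology zariski X) {L \<in> X. vanishes_on f {L}}"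
proof -
  let ?U = "{line v | v. v \<noteq> 0 \<and> f v \<noteq> 0}"
  have "openin zariski ?U"
    unfolding zariski_def by (rule topology_generated_by_Basis) (use assms(1) in blast)
  moreover have "X - {L \<in> X. vanishes_on f {L}} = X \<inter> ?U"
    unfolding vanishes_on_def by auto
  ultimately have "openin (subtopology zariski X) (X - {L \<in> X. vanishes_on f {L}})"
    unfolding openin_subtopology by (intro exI[of _ ?U]) (simp add: inf_commute)
  moreover have "topspace (subtopology zariski X) = X"
    using assms(2) by (simp add: topspace_zariski inf_absorb2)
  ultimately show ?thesis
    unfolding closedin_def by auto
qed

definition zariski_closure_in ::
    "(complex ^ 'n::finite) set set \<Rightarrow> (complex ^ 'n) set set \<Rightarrow> (complex ^ 'n) set set" where
  "zariski_closure_in X S =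
     {L \<in> X. \<forall>d f. homogeneous_poly d f \<and> vanishes_on f S \<longrightarrow> vanishes_on f {L}}"

lemma closedin_zariski_closure_in:
  assumes "X \<subseteq> proj_space"
  shows "closedin (subtopology zariski X) (zariski_closure_in X S)"
proof -
  let ?F = "(\<lambda>f. {L \<in> X. vanishes_on f {L}}) ` {f. (\<exists>d. homogeneous_poly d f) \<and> vanishes_on f S}"
  \<comment> \<open>The zero form keeps the family nonempty, as \<open>closedin_Inter\<close>
    demands.\<close>
  have "(\<lambda>v. 0) \<in> {f. (\<exists>d. homogeneous_poly d f) \<and> vanishes_on f S}"
    using homogeneous_poly_zero unfolding vanishes_on_def by blast
  then have ne: "?F \<noteq> {}" by blast
  moreover have "closedin (subtopology zariski X) C" if "C \<in> ?F" for C
    using that closedin_zariski_zero_locus[OF _ assms] by blast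
  ultimately have "closedin (subtopology zariski X) (\<Inter>?F)"
    by (rule closedin_Inter)
  moreover have "\<Inter>?F = zariski_closure_in X S"
  proof (rule set_eqI)
    fix L
    have "L \<in> \<Inter>?F \<longleftrightarrow> (\<forall>f. (\<exists>d. homogeneous_poly d f) \<and> vanishes_on f S \<longrightarrow> L \<in> X \<and> vanishes_on f {L})"
      by simp
    also have "\<dots> \<longleftrightarrow> L \<in> zariski_closure_in X S"
      using \<open>(\<lambda>v. 0) \<in> _\<close> unfolding zariski_closure_in_def mem_Collect_eq by blast
    finally show "L \<in> \<Inter>?F \<longleftrightarrow> L \<in> zariski_closure_in X S" .
  qed
  ultimately show ?thesis by simp
qed

lemma zariski_closedinD:
  assumes "closedin (subtopology zariski X) C" "X \<subseteq> proj_space" "v \<noteq> 0" "line v \<in> X" "line v \<notin> C"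
  shows "\<exists>d f. homogeneous_poly d f \<and> f v \<noteq> 0 \<and> vanishes_on f C"
proof -
  have "openin (subtopology zariski X) (X - C)"
    using assms(1,2) unfolding closedin_def by (simp add: topspace_zariski inf_absorb2)
  then obtain U where U: "openin zariski U" "X - C = U \<inter> X"
    unfolding openin_subtopology by blast
  then obtain d f where "homogeneous_poly d f" "f v \<noteq> 0" "\<forall>u. u \<noteq> 0 \<and> f u \<noteq> 0 \<longrightarrow> line u \<in> U"
    using openin_zariskiD[of U v] assms by blast
  moreover have "C \<subseteq> X"
    using closedin_subset[OF assms(1)] by (simp add: topspace_zariski)
  ultimately show ?thesis
    using U(2) unfolding vanishes_on_def by blast
qed

lemma zariski_closure_of:
  assumes "X \<subseteq> proj_space" "S \<subseteq> X"
  shows "subtopology zariski X closure_of S = zariski_closure_in X S"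
proof (rule closure_of_unique)
  show "S \<subseteq> zariski_closure_in X S"
    using assms(2) unfolding zariski_closure_in_def vanishes_on_def by blast
  show "closedin (subtopology zariski X) (zariski_closure_in X S)"
    by (rule closedin_zariski_closure_in[OF assms(1)])
  fix T assume T: "S \<subseteq> T" "closedin (subtopology zariski X) T"
  show "zariski_closure_in X S \<subseteq> T"
  proof
    fix L assume L: "L \<in> zariski_closure_in X S"
    then obtain v where v: "v \<noteq> 0" "L = line v" "L \<in> X"
      using assms(1) unfolding zariski_closure_in_def proj_space_def by blast
    show "L \<in> T"
    proof (rule ccontr)
      assume "L \<notin> T"
      then obtain d f where "homogeneous_poly d f" "f v \<noteq> 0" "vanishes_on f T"
        using zariski_closedinD[OF T(2) assms(1)] v by blast
      then show False
        using L vanishes_on_subset[OF _ T(1)] v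
        unfolding zariski_closure_in_def vanishes_on_def by blast
    qed
  qed
qed

text \<open>Irreducibility of a set of points, phrased as primality of its vanishing ideal.\<close>

definition prime_locus :: "(complex ^ 'n::finite) set set \<Rightarrow> bool" where
  "prime_locus S \<longleftrightarrow> S \<noteq> {} \<and>
     (\<forall>d e f g. homogeneous_poly d f \<and> homogeneous_poly e g \<and> vanishes_on (\<lambda>v. f v * g v) S \<longrightarrow>
        vanishes_on f S \<or> vanishes_on g S)"

lemma prime_locusD:
  assumes "prime_locus S" "homogeneous_poly d f" "homogeneous_poly e g"
    "vanishes_on (\<lambda>v. f v * g v) S"
  shows "vanishes_on f S \<or> vanishes_on g S"
  using assms unfolding prime_locus_def by blast

text \<open>Two forms with vanishing product decompose S into their zero loci; conversely, proper
  closed sets covering S are contained in the zero loci of two such forms.\<close>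

lemma irreducible_space_zariski_iff:
  assumes "S \<subseteq> proj_space"
  shows "irreducible_space (subtopology zariski S) \<longleftrightarrow> prime_locus S"
proof -
  have top: "topspace (subtopology zariski S) = S"
    using assms by (auto simp: topspace_zariski)
  show ?thesis
  proof
    assume irr: "irreducible_space (subtopology zariski S)"
    show "prime_locus S"
      unfolding prime_locus_def
    proof (intro conjI allI impI)
      show "S \<noteq> {}" using irr unfolding irreducible_space_def top by blast
      fix d e f g
      assume *: "homogeneous_poly d f \<and> homogeneous_poly e g \<and> vanishes_on (\<lambda>v. f v * g v) S"
      let ?A = "{L \<in> S. vanishes_on f {L}}" and ?B = "{L \<in> S. vanishes_on g {L}}"
      have "S = ?A \<union> ?B"
      proof (rule set_eqI)
        fix L
        show "L \<in> S \<longleftrightarrow> L \<in> ?A \<union> ?B"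
        proof (cases "L \<in> S")
          case True
          then obtain v where "v \<noteq> 0" "L = line v"
            using assms unfolding proj_space_def by blast
          moreover from this have "f v * g v = 0"
            using * True unfolding vanishes_on_def by blast
          ultimately show ?thesis
            using * True vanishes_on_line[of d f v] vanishes_on_line[of e g v] by auto
        qed simp
      qed
      moreover have "closedin (subtopology zariski S) ?A" "closedin (subtopology zariski S) ?B"
        using closedin_zariski_zero_locus[OF _ assms] * by auto
      ultimately have "S = ?A \<or> S = ?B"
        using irr[unfolded irreducible_space_def top, THEN conjunct2, rule_format, of ?A ?B] by simp
      then show "vanishes_on f S \<or> vanishes_on g S"
        unfolding vanishes_on_def by auto
    qed
  next
    assume pr: "prime_locus S"
    show "irreducible_space (subtopology zariski S)"
      unfolding irreducible_space_def top
    proof (intro conjI allI impI)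
      show "S \<noteq> {}" using pr unfolding prime_locus_def by blast
      fix A B
      assume *: "closedin (subtopology zariski S) A \<and> closedin (subtopology zariski S) B \<and> S = A \<union> B"
      show "S = A \<or> S = B"
      proof (rule ccontr)
        assume "\<not> (S = A \<or> S = B)"
        then obtain L M where L: "L \<in> S" "L \<notin> A" and M: "M \<in> S" "M \<notin> B"
          using * by blast
        obtain u v where "u \<noteq> 0" "v \<noteq> 0" and uv: "L = line u" "M = line v"
          using L M assms unfolding proj_space_def by blast
        obtain d f where f: "homogeneous_poly d f" "f u \<noteq> 0" "vanishes_on f A"
          using zariski_closedinD[of S A u] * assms \<open>u \<noteq> 0\<close> L uv by blast
        obtain e g where g: "homogeneous_poly e g" "g v \<noteq> 0" "vanishes_on g B"
          using zariski_closedinD[of S B v] * assms \<open>v \<noteq> 0\<close> M uv by blast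
        have "vanishes_on (\<lambda>v. f v * g v) S"
          using f g * unfolding vanishes_on_def by auto
        then have "vanishes_on f S \<or> vanishes_on g S"
          using prime_locusD[OF pr f(1) g(1)] by blast
        then show False
          using f g L M uv \<open>u \<noteq> 0\<close> \<open>v \<noteq> 0\<close> unfolding vanishes_on_def by blast
      qed
    qed
  qed
qed

lemma prime_locus_closure:
  assumes "prime_locus S" "S \<subseteq> X"
  shows "prime_locus (zariski_closure_in X S)"
proof -
  have sub: "S \<subseteq> zariski_closure_in X S"
    using assms(2) unfolding zariski_closure_in_def vanishes_on_def by blast
  have van: "vanishes_on f (zariski_closure_in X S)" if "homogeneous_poly d f" "vanishes_on f S" for d f
    using that unfolding zariski_closure_in_def vanishes_on_def by blast
  show ?thesis
    unfolding prime_locus_def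
  proof (intro conjI allI impI)
    show "zariski_closure_in X S \<noteq> {}"
      using sub assms(1) unfolding prime_locus_def by blast
    show "vanishes_on f (zariski_closure_in X S) \<or> vanishes_on g (zariski_closure_in X S)"
      if *: "homogeneous_poly d f \<and> homogeneous_poly e g \<and>
        vanishes_on (\<lambda>v. f v * g v) (zariski_closure_in X S)" for d e f g
      using prime_locusD[OF assms(1), of d f e g] van * vanishes_on_subset[OF _ sub] by blast
  qed
qed

text \<open>Forms pull back to polynomials on the parameter space, where a vanishing product has a
  vanishing factor.\<close>

lemma prime_locus_image:
  fixes \<Phi> :: "'a::real_vector \<Rightarrow> complex ^ 'n::finite"
  assumes "\<And>k. polynomial_on_lines (\<lambda>x. \<Phi> x $ k)" "\<Phi> x0 \<noteq> 0"
  shows "prime_locus {line (\<Phi> x) | x. \<Phi> x \<noteq> 0}"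
proof -
  let ?S = "{line (\<Phi> x) | x. \<Phi> x \<noteq> 0}"
  have poly: "polynomial_on_lines (\<lambda>x. f (\<Phi> x))" if "homogeneous_poly d f" for d f
  proof -
    have "polyfun (range (\<lambda>k v. v $ k)) f"
      using polyfun_homogeneous[OF that, of "range (\<lambda>k v. v $ k)" "\<lambda>x. x"]
      by (auto intro: polyfun_coord)
    then show ?thesis
      by (rule polynomial_on_lines_polyfun) (use assms(1) in auto)
  qed
  obtain i where i: "\<Phi> x0 $ i \<noteq> 0" using assms(2) by (auto simp: vec_eq_iff)
  have van: "vanishes_on f ?S" if "homogeneous_poly d f" "\<And>x. f (\<Phi> x) = 0" for d f
    using that homogeneous_poly_line[OF that(1)] unfolding vanishes_on_def by blast
  show ?thesis
    unfolding prime_locus_def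
  proof (intro conjI allI impI)
    show "?S \<noteq> {}" using assms(2) by blast
    fix d e f g
    assume *: "homogeneous_poly d f \<and> homogeneous_poly e g \<and> vanishes_on (\<lambda>v. f v * g v) ?S"
    \<comment> \<open>The additional factor \<open>\<Phi> x $ i\<close> makes the product vanish
      also at parameters with \<open>\<Phi> x = 0\<close>, which give no point of the locus; being
      nonzero at \<open>x0\<close>, it can be cancelled again.\<close>
    have "f (\<Phi> x) * (g (\<Phi> x) * \<Phi> x $ i) = 0" for x
      using * unfolding vanishes_on_def by (cases "\<Phi> x = 0") auto
    moreover have "polynomial_on_lines (\<lambda>x. g (\<Phi> x) * \<Phi> x $ i)"
      using poly[OF homogeneous_poly_coord_mult[of e g i]] * by (simp add: mult.commute)
    ultimately consider "\<forall>x. f (\<Phi> x) = 0" | "\<forall>x. g (\<Phi> x) * \<Phi> x $ i = 0"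
      using polynomial_on_lines_mult_eq_0[OF poly] * by blast
    then show "vanishes_on f ?S \<or> vanishes_on g ?S"
    proof cases
      case 1 then show ?thesis using van * by blast
    next
      case 2
      then have "\<forall>x. g (\<Phi> x) = 0"
        using polynomial_on_lines_mult_eq_0[of "\<lambda>x. g (\<Phi> x)" "\<lambda>x. \<Phi> x $ i"] poly assms(1) i * by blast
      then show ?thesis using van * by blast
    qed
  qed
qed

text \<open>The members of the chain are the closures of the given sets in X. A closure has the same
  vanishing forms, which preserves primality, and a separating form keeps consecutive closures
  distinct.\<close>

lemma krull_dim_at_ge:
  fixes X :: "(complex ^ 'n::finite) set set"
  assumes X: "X \<subseteq> proj_space"
    and I: "\<And>i. i \<le> n \<Longrightarrow> I i \<subseteq> X" "\<And>i. i \<le> n \<Longrightarrow> prime_locus (I i)"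
    and mono: "\<And>i. i < n \<Longrightarrow> I i \<subseteq> I (Suc i)"
    and strict: "\<And>i. i < n \<Longrightarrow>
      separated (I i) (I (Suc i))"
    and p: "p \<in> I 0"
  shows "enat n \<le> krull_dim_at (subtopology zariski X) p"
proof -
  let ?Z = "\<lambda>i. zariski_closure_in X (I i)"
  have sub: "I i \<subseteq> ?Z i" if "i \<le> n" for i
    using I(1)[OF that] unfolding zariski_closure_in_def vanishes_on_def by blast
  have ZX: "?Z i \<subseteq> X" for i unfolding zariski_closure_in_def by blast
  have "irreducible_closed_chain (subtopology zariski X) n ?Z"
    unfolding irreducible_closed_chain_def
  proof (intro conjI allI impI)
    fix i assume i: "i \<le> n"
    show "closedin (subtopology zariski X) (?Z i)"
      by (rule closedin_zariski_closure_in[OF X])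
    have "irreducible_space (subtopology zariski (?Z i))"
      using irreducible_space_zariski_iff[of "?Z i"] prime_locus_closure I i X ZX
      by (meson order_trans)
    then show "irreducible_space (subtopology (subtopology zariski X) (?Z i))"
      by (simp add: subtopology_subtopology inf_absorb2[OF ZX])
  next
    fix i assume i: "i < n"
    obtain d f where f: "homogeneous_poly d f" "vanishes_on f (I i)" "\<not> vanishes_on f (I (Suc i))"
      using strict[OF i] by blast
    have "?Z i \<subseteq> ?Z (Suc i)"
      using vanishes_on_subset[OF _ mono[OF i]] unfolding zariski_closure_in_def by blast
    moreover have "?Z i \<noteq> ?Z (Suc i)"
    proof
      assume eq: "?Z i = ?Z (Suc i)"
      have "I (Suc i) \<subseteq> ?Z i" using sub[of "Suc i"] i eq by auto
      then show False
        using f unfolding zariski_closure_in_def vanishes_on_def by blast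
    qed
    ultimately show "?Z i \<subset> ?Z (Suc i)" by blast
  qed
  moreover have "p \<in> ?Z 0" using sub[of 0] p by auto
  ultimately show ?thesis
    unfolding krull_dim_at_def by (intro Sup_upper) blast
qed

lemma krull_dim_at_ge_list:
  assumes "X \<subseteq> proj_space" "\<forall>A\<in>set Is. prime_locus A \<and> A \<subseteq> X"
    and "\<forall>i<n. Is ! i \<subseteq> Is ! Suc i \<and> separated (Is ! i) (Is ! Suc i)"
    and "length Is = Suc n" "p \<in> Is ! 0"
  shows "enat n \<le> krull_dim_at (subtopology zariski X) p"
  by (rule krull_dim_at_ge[where I = "(!) Is"]) (use assms in auto)

section \<open>Upper bounds for chains of irreducible closed sets\<close>

text \<open>Gaussian elimination, one equation at a time: if the new equation involves the unknown
  \<open>a0\<close>, this unknown is eliminated from the others.\<close>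

lemma exists_nontrivial_solution:
  fixes m :: "'a \<Rightarrow> 'p \<Rightarrow> 'k::field"
  assumes "finite P" "finite A" "card P < card A"
  shows "\<exists>c. (\<exists>a\<in>A. c a \<noteq> 0) \<and> (\<forall>p\<in>P. (\<Sum>a\<in>A. c a * m a p) = 0)"
  using assms
proof (induction P arbitrary: A m rule: finite_induct)
  case empty
  then obtain a where "a \<in> A" by fastforce
  then show ?case by (intro exI[of _ "\<lambda>_. 1"]) auto
next
  case (insert p P)
  show ?case
  proof (cases "\<forall>a\<in>A. m a p = 0")
    case True
    have "card P < card A" using insert by simp
    then obtain c where "\<exists>a\<in>A. c a \<noteq> 0" "\<forall>p\<in>P. (\<Sum>a\<in>A. c a * m a p) = 0"
      using insert.IH[OF insert.prems(1)] by blast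
    then show ?thesis using True by (intro exI[of _ c]) auto
  next
    case False
    then obtain a0 where a0: "a0 \<in> A" "m a0 p \<noteq> 0" by blast
    define m' where "m' = (\<lambda>a q. m a q - m a p / m a0 p * m a0 q)"
    have "card P < card (A - {a0})" using insert a0 by simp
    then obtain c where c: "\<exists>a\<in>A - {a0}. c a \<noteq> 0" "\<forall>q\<in>P. (\<Sum>a\<in>A - {a0}. c a * m' a q) = 0"
      using insert.IH[of "A - {a0}" m'] insert.prems(1) by auto
    define s where "s = (\<Sum>a\<in>A - {a0}. c a * m a p)"
    define c' where "c' = c(a0 := - s / m a0 p)"
    have sum_c': "(\<Sum>a\<in>A. c' a * m a q) = - s / m a0 p * m a0 q + (\<Sum>a\<in>A - {a0}. c a * m a q)" for q
      by (subst sum.remove[OF insert.prems(1) a0(1)]) (auto simp: c'_def intro!: sum.cong)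
    have "(\<Sum>a\<in>A - {a0}. c a * m' a q) = (\<Sum>a\<in>A - {a0}. c a * m a q) - s / m a0 p * m a0 q" for q
      unfolding m'_def s_def
      by (simp add: right_diff_distrib sum_subtractf sum_divide_distrib sum_distrib_right mult.assoc)
    then have "\<forall>q\<in>insert p P. (\<Sum>a\<in>A. c' a * m a q) = 0"
      using c(2) a0(2) unfolding sum_c' by (auto simp: s_def[symmetric])
    moreover have "\<exists>a\<in>A. c' a \<noteq> 0" using c(1) by (auto simp: c'_def)
    ultimately show ?thesis by blast
  qed
qed

text \<open>The grid condition is lifted one variable at a time: in each variable, a polynomial of
  degree at most D with D + 1 roots is zero.\<close>

lemma polynomial_vanishing_on_grid:
  fixes q :: "('i::finite \<Rightarrow> complex) \<Rightarrow> complex"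
  assumes poly: "\<And>u i. polynomial_on (\<lambda>s. s) D (\<lambda>s. q (u(i := s)))"
    and grid: "\<And>u. (\<forall>i. u i \<in> of_nat ` {..D}) \<Longrightarrow> q u = 0"
  shows "q u = 0"
proof -
  have "\<forall>u. (\<forall>i. i \<notin> J \<longrightarrow> u i \<in> of_nat ` {..D}) \<longrightarrow> q u = 0" if "finite J" for J :: "'i set"
    using that
  proof (induction J)
    case (insert j J)
    show ?case
    proof (intro allI impI)
      fix u :: "'i \<Rightarrow> complex"
      assume u: "\<forall>i. i \<notin> insert j J \<longrightarrow> u i \<in> of_nat ` {..D}"
      obtain P where P: "degree P \<le> D" "\<And>s. q (u(j := s)) = poly P s"
        using poly[of u j] unfolding polynomial_on_def by blast
      have "q (u(j := s)) = 0" if "s \<in> of_nat ` {..D}" for s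
        using insert.IH[rule_format, of "u(j := s)"] u that by auto
      then have sub: "of_nat ` {..D} \<subseteq> {x. poly P x = 0}"
        using P(2) by auto
      have "P = 0"
      proof (rule ccontr)
        assume "P \<noteq> 0"
        then have "card (of_nat ` {..D} :: complex set) \<le> degree P"
          using card_mono[OF poly_roots_finite sub] card_poly_roots_bound[of P] by simp
        then show False using P(1) by (simp add: card_image inj_on_def)
      qed
      then show "q u = 0" using P(2)[of "u j"] by simp
    qed
  qed (use grid in blast)
  from this[OF finite[of UNIV]] show ?thesis by simp
qed

text \<open>The head of the list is the exponent of the form with the largest index, and
  \<open>f 0\<close> takes the exponent left over from N, so that all these monomials have the same
  degree.\<close>

fun chain_monomial :: "(nat \<Rightarrow> 'v \<Rightarrow> complex) \<Rightarrow> nat list \<Rightarrow> nat \<Rightarrow> 'v \<Rightarrow> complex" where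
  "chain_monomial f [] N v = f 0 v ^ N"
| "chain_monomial f (j # a) N v = f (Suc (length a)) v ^ j * chain_monomial f a (N - j) v"

lemma homogeneous_chain_monomial:
  assumes "\<And>i. i \<le> length a \<Longrightarrow> homogeneous_poly e (f i)" "sum_list a \<le> N"
  shows "homogeneous_poly (N * e) (chain_monomial f a N)"
  using assms
proof (induction a arbitrary: N)
  case Nil
  then show ?case using homogeneous_poly_power[of e "f 0" N] by simp
next
  case (Cons j a)
  have eq: "j * e + (N - j) * e = N * e"
    using Cons.prems by (simp add: distrib_right[symmetric])
  have "homogeneous_poly (j * e + (N - j) * e) (chain_monomial f (j # a) N)"
    using homogeneous_poly_mult[OF homogeneous_poly_power[of e "f (Suc (length a))" j] Cons.IH[of "N - j"]]
      Cons.prems by (simp add: chain_monomial.simps(2)[abs_def])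
  then show ?case unfolding eq .
qed

lemma finite_box: "finite {a. length a = n \<and> set a \<subseteq> {..d::nat}}"
  using finite_lists_length_eq[of "{..d}" n] by (simp add: conj_commute)

text \<open>The forms separating the members of a chain are algebraically independent.\<close>

lemma chain_monomials_independent:
  fixes f :: "nat \<Rightarrow> complex ^ 'n::finite \<Rightarrow> complex"
  assumes "\<And>i. i \<le> n \<Longrightarrow> homogeneous_poly e (f i)" "\<And>i. i \<le> n \<Longrightarrow> prime_locus (S i)"
    and "\<not> vanishes_on (f 0) (S 0)"
    and "\<And>i. i < n \<Longrightarrow> S i \<subseteq> S (Suc i) \<and> vanishes_on (f (Suc i)) (S i) \<and> \<not> vanishes_on (f (Suc i)) (S (Suc i))"
    and "n * d \<le> N"
    and "vanishes_on (\<lambda>v. \<Sum>a | length a = n \<and> set a \<subseteq> {..d}. c a * chain_monomial f a N v) (S n)"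
    and "length a = n" "set a \<subseteq> {..d}"
  shows "c a = 0"
  using assms
proof (induction n arbitrary: c N a)
  case 0
  have "{a. length a = 0 \<and> set a \<subseteq> {..d}} = {[]}" by auto
  then show ?case
    using 0(3,6,7) unfolding vanishes_on_def by auto
next
  case (Suc n)
  define A where "A = {a. length a = n \<and> set a \<subseteq> {..d}}"
  have finA: "finite A" unfolding A_def by (rule finite_box)
  define F where "F = f (Suc n)"
  define P where "P = (\<lambda>j v. \<Sum>a\<in>A. c (j # a) * chain_monomial f a (N - j) v)"
  have sum_le: "sum_list a \<le> n * d" if "a \<in> A" for a
    using sum_list_mono[of a "\<lambda>x. x" "\<lambda>_. d"] that by (auto simp: A_def sum_list_triv)
  have homP: "homogeneous_poly ((N - j) * e) (P j)" if "j \<le> d" for j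
    unfolding P_def
  proof (intro homogeneous_poly_sum homogeneous_poly_cmult homogeneous_chain_monomial)
    fix a i assume "a \<in> A" "i \<le> length a"
    then show "homogeneous_poly e (f i)" using Suc.prems(1) by (simp add: A_def)
  next
    fix a assume "a \<in> A"
    then show "sum_list a \<le> N - j" using sum_le[of a] that Suc.prems(5) by auto
  qed
  have homF: "homogeneous_poly e F" using Suc.prems(1) unfolding F_def by simp
  have eqA: "{a. length a = Suc n \<and> set a \<subseteq> {..d}} = (\<lambda>(j, a). j # a) ` ({..d} \<times> A)"
    by (auto simp: A_def length_Suc_conv image_iff)
  have "(\<Sum>a | length a = Suc n \<and> set a \<subseteq> {..d}. c a * chain_monomial f a N v) =
      (\<Sum>(j, a)\<in>{..d} \<times> A. c (j # a) * chain_monomial f (j # a) N v)" for v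
    unfolding eqA by (subst sum.reindex) (auto simp: inj_on_def case_prod_unfold)
  also have "\<dots> v = (\<Sum>j\<le>d. F v ^ j * P j v)" for v
    unfolding sum.cartesian_product[symmetric] P_def F_def sum_distrib_left
    by (intro sum.cong) (auto simp: A_def)
  finally have van: "vanishes_on (\<lambda>v. \<Sum>j\<le>d. F v ^ j * P j v) (S (Suc n))"
    using Suc.prems(6) by simp
  \<comment> \<open>The coefficients of lower powers of F are already zero, so the relation is
    divisible by \<open>F ^ J\<close>. Primality on the larger set cancels this power; on the
    smaller set, where F vanishes, the quotient reduces to \<open>P J\<close>, a relation among the
    remaining forms.\<close>
  have "\<forall>a\<in>A. c (J # a) = 0" if "J \<le> d" for J
    using that
  proof (induction J rule: less_induct)
    case (less J)
    have P0: "P j v = 0" if "j < J" for j v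
      unfolding P_def using less that by (intro sum.neutral) auto
    define G where "G = (\<lambda>v. P J v + F v * (\<Sum>j\<in>{J<..d}. F v ^ (j - Suc J) * P j v))"
    have G: "(\<Sum>j\<le>d. F v ^ j * P j v) = F v ^ J * G v" for v
    proof -
      have "{..d} = {..<J} \<union> {J..d}" using less.prems by auto
      then have "(\<Sum>j\<le>d. F v ^ j * P j v) = (\<Sum>j\<in>{J..d}. F v ^ j * P j v)"
        by (intro sum.mono_neutral_right) (auto simp: P0)
      also have "\<dots> = F v ^ J * P J v + (\<Sum>j\<in>{J<..d}. F v ^ j * P j v)"
        using less.prems by (simp add: sum.head)
      also have "(\<Sum>j\<in>{J<..d}. F v ^ j * P j v) =
          F v ^ J * (F v * (\<Sum>j\<in>{J<..d}. F v ^ (j - Suc J) * P j v))"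
        unfolding sum_distrib_left
      proof (rule sum.cong)
        fix j assume "j \<in> {J<..d}"
        then have "F v ^ j = F v ^ (J + Suc (j - Suc J))" by simp
        then show "F v ^ j * P j v = F v ^ J * (F v * (F v ^ (j - Suc J) * P j v))"
          by (simp add: power_add mult.assoc)
      qed simp
      finally show ?thesis by (simp add: G_def distrib_left)
    qed
    have "homogeneous_poly ((N - J) * e) (\<lambda>v. F v * (F v ^ (j - Suc J) * P j v))" if "j \<in> {J<..d}" for j
    proof -
      have "d \<le> N" using Suc.prems(5) by simp
      have "homogeneous_poly (e + ((j - Suc J) * e + (N - j) * e)) (\<lambda>v. F v * (F v ^ (j - Suc J) * P j v))"
        using that homF homP by (intro homogeneous_poly_mult homogeneous_poly_power) auto
      moreover have "e + ((j - Suc J) * e + (N - j) * e) = (N - J) * e"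
      proof -
        have "N - J = Suc ((j - Suc J) + (N - j))" using that \<open>d \<le> N\<close> by auto
        then have "(N - J) * e = Suc ((j - Suc J) + (N - j)) * e" by (rule arg_cong)
        then show ?thesis by (simp add: distrib_right)
      qed
      ultimately show ?thesis by simp
    qed
    then have homG: "homogeneous_poly ((N - J) * e) G"
      unfolding G_def sum_distrib_left using homP less.prems
      by (intro homogeneous_poly_add homogeneous_poly_sum) auto
    have "vanishes_on (\<lambda>v. F v ^ J * G v) (S (Suc n))" using van by (simp add: G)
    then have "vanishes_on (\<lambda>v. F v ^ J) (S (Suc n)) \<or> vanishes_on G (S (Suc n))"
      using prime_locusD[OF Suc.prems(2)[of "Suc n"] homogeneous_poly_power[OF homF] homG] by simp
    moreover have "\<not> vanishes_on (\<lambda>v. F v ^ J) (S (Suc n))"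
      using Suc.prems(4)[of n] unfolding F_def vanishes_on_def by auto
    ultimately have "vanishes_on G (S (Suc n))" by blast
    have "vanishes_on (P J) (S n)"
      unfolding vanishes_on_def
    proof (intro allI impI)
      fix u :: "complex ^ 'n" assume u: "u \<noteq> 0 \<and> line u \<in> S n"
      then have "F u = 0" "G u = 0"
        using Suc.prems(4)[of n] \<open>vanishes_on G (S (Suc n))\<close> unfolding F_def vanishes_on_def by auto
      then show "P J u = 0" unfolding G_def by simp
    qed
    have "n * d \<le> N - J" using Suc.prems(5) less.prems by simp
    show ?case
    proof
      fix b assume b: "b \<in> A"
      show "c (J # b) = 0"
      proof (rule Suc.IH[where N = "N - J" and c = "\<lambda>a. c (J # a)"])
        show "vanishes_on (\<lambda>v. \<Sum>a | length a = n \<and> set a \<subseteq> {..d}. c (J # a) * chain_monomial f a (N - J) v) (S n)"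
          using \<open>vanishes_on (P J) (S n)\<close> unfolding P_def A_def .
        show "n * d \<le> N - J" by fact
        show "length b = n" "set b \<subseteq> {..d}" using b unfolding A_def by auto
      qed (use Suc.prems(1-4) in simp_all)
    qed
  qed
  moreover obtain J b where "a = J # b" using Suc.prems(7) by (cases a) auto
  ultimately show ?case
    using Suc.prems(7,8) unfolding A_def by simp
qed

text \<open>On a grid in affine K-space the monomials in K + 1 separating forms give (d + 1)^(K + 1)
  unknowns against (D + 1)^K equations. Since D grows only linearly with d, a nontrivial relation
  exists, against independence.\<close>

lemma chain_length_le:
  fixes \<phi> :: "('i::finite \<Rightarrow> complex) \<Rightarrow> complex ^ 'n::finite" and n :: nat
  assumes poly: "\<And>u i k. polynomial_on (\<lambda>s. s) m (\<lambda>s. \<phi> (u(i := s)) $ k)"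
    and dense: "\<And>d f. homogeneous_poly d f \<Longrightarrow> (\<And>u. f (\<phi> u) = 0) \<Longrightarrow> vanishes_on f Y"
    and S: "\<And>i. i \<le> n \<Longrightarrow> prime_locus (S i)" "\<And>i. i \<le> n \<Longrightarrow> S i \<subseteq> Y" "\<And>i. i < n \<Longrightarrow> S i \<subseteq> S (Suc i)"
    and Y: "Y \<subseteq> proj_space"
    and strict: "\<And>i. i < n \<Longrightarrow>
      separated (S i) (S (Suc i))"
  shows "n \<le> CARD('i)"
proof (rule ccontr)
  define K where "K = CARD('i)"
  assume "\<not> n \<le> CARD('i)"
  then have nK: "Suc K \<le> n" by (simp add: K_def)
  obtain e g where g: "\<And>i. i < n \<Longrightarrow> homogeneous_poly (e i) (g i) \<and> vanishes_on (g i) (S i) \<and>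
      \<not> vanishes_on (g i) (S (Suc i))"
    using strict by metis
  have "S 0 \<noteq> {}" "S 0 \<subseteq> proj_space" using S(1,2)[of 0] Y unfolding prime_locus_def by auto
  then obtain v where v: "v \<noteq> 0" "line v \<in> S 0" unfolding proj_space_def by blast
  then obtain k where k: "v $ k \<noteq> 0" by (auto simp: vec_eq_iff)
  \<comment> \<open>Powers of the coordinate \<open>k\<close> bring all separating forms to the
    common degree E. This coordinate is nonzero at a point of \<open>S 0\<close>, hence vanishes on
    no member of the chain.\<close>
  define E where "E = (\<Sum>i\<le>K. e i)"
  have eE: "e i \<le> E" if "i \<le> K" for i unfolding E_def using that by (intro member_le_sum) auto
  define f where "f = (\<lambda>i w. case i of 0 \<Rightarrow> (w :: complex ^ 'n) $ k ^ E | Suc j \<Rightarrow> g j w * w $ k ^ (E - e j))"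
  have homf: "homogeneous_poly E (f i)" if "i \<le> Suc K" for i
  proof (cases i)
    case 0
    then show ?thesis using homogeneous_poly_power[OF homogeneous_poly_coord, of E k] by (simp add: f_def)
  next
    case (Suc j)
    then have "homogeneous_poly (e j + (E - e j) * 1) (f i)"
      using homogeneous_poly_mult[OF _ homogeneous_poly_power[OF homogeneous_poly_coord, of "E - e j" k], of "e j" "g j"]
        g[of j] that nK by (simp add: f_def)
    then show ?thesis using eE[of j] Suc that by simp
  qed
  have S0: "S 0 \<subseteq> S i" if "i \<le> n" for i
    using that
  proof (induction i)
    case (Suc i)
    then show ?case using S(3)[of i] by auto
  qed simp
  have step: "S i \<subseteq> S (Suc i) \<and> vanishes_on (f (Suc i)) (S i) \<and> \<not> vanishes_on (f (Suc i)) (S (Suc i))"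
    if "i < Suc K" for i
  proof (intro conjI)
    show "S i \<subseteq> S (Suc i)" using S(3) that nK by simp
    show "vanishes_on (f (Suc i)) (S i)"
      using g[of i] that nK unfolding f_def vanishes_on_def by simp
    show "\<not> vanishes_on (f (Suc i)) (S (Suc i))"
    proof
      assume "vanishes_on (f (Suc i)) (S (Suc i))"
      then have "vanishes_on (g i) (S (Suc i)) \<or> vanishes_on (\<lambda>w. w $ k ^ (E - e i)) (S (Suc i))"
        using prime_locusD[OF S(1)[of "Suc i"] _ homogeneous_poly_power[OF homogeneous_poly_coord], of "e i" "g i"]
          g[of i] that nK by (simp add: f_def)
      then have "vanishes_on (\<lambda>w. w $ k ^ (E - e i)) (S (Suc i))" using g[of i] that nK by simp
      then show False
        using v k S0[of "Suc i"] that nK unfolding vanishes_on_def by auto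
    qed
  qed
  have f0: "\<not> vanishes_on (f 0) (S 0)"
    using v k unfolding vanishes_on_def f_def by auto
  \<comment> \<open>\<open>D\<close> bounds the degree of the pulled back monomials in each
    variable. \<open>M\<close> satisfies D + 1 \<le> M (d + 1), and d = M^K then gives (D + 1)^K
    \<le> d (d + 1)^K < (d + 1)^(K + 1).\<close>
  define M where "M = Suc K * E * m + 1"
  define d where "d = M ^ K"
  define N where "N = Suc K * d"
  define D where "D = N * E * m"
  define A where "A = {a. length a = Suc K \<and> set a \<subseteq> {..d}}"
  define G where "G = (UNIV :: 'i set) \<rightarrow>\<^sub>E (of_nat ` {..D} :: complex set)"
  have "card A = Suc d ^ Suc K"
    using card_lists_length_eq[of "{..d}" "Suc K"] unfolding A_def by (simp add: conj_commute)
  moreover have "card G = Suc D ^ K"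
    unfolding G_def K_def by (simp add: card_PiE card_image inj_on_def)
  moreover have "Suc D ^ K < Suc d ^ Suc K"
  proof -
    have "Suc D \<le> M * Suc d" unfolding D_def N_def M_def by (simp add: algebra_simps)
    then have "Suc D ^ K \<le> (M * Suc d) ^ K" by (intro power_mono) auto
    also have "\<dots> = d * Suc d ^ K" unfolding power_mult_distrib d_def ..
    also have "\<dots> < Suc d ^ Suc K" by simp
    finally show ?thesis .
  qed
  moreover have "finite G" unfolding G_def by (intro finite_PiE) auto
  moreover have finA: "finite A" unfolding A_def by (rule finite_box)
  ultimately obtain c where c: "\<exists>a\<in>A. c a \<noteq> 0"
    "\<forall>p\<in>G. (\<Sum>a\<in>A. c a * chain_monomial f a N (\<phi> p)) = 0"
    using exists_nontrivial_solution[of G A "\<lambda>a p. chain_monomial f a N (\<phi> p)"] by auto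
  define Q where "Q = (\<lambda>v. \<Sum>a\<in>A. c a * chain_monomial f a N v)"
  have homQ: "homogeneous_poly (N * E) Q"
    unfolding Q_def
  proof (intro homogeneous_poly_sum homogeneous_poly_cmult homogeneous_chain_monomial)
    fix a i assume "a \<in> A" "i \<le> length a"
    then show "homogeneous_poly E (f i)" using homf by (simp add: A_def)
  next
    fix a assume "a \<in> A"
    then show "sum_list a \<le> N"
      using sum_list_mono[of a "\<lambda>x. x" "\<lambda>_. d"] by (auto simp: A_def N_def sum_list_triv)
  qed
  have "Q (\<phi> u) = 0" for u
  proof (rule polynomial_vanishing_on_grid[where D = D and q = "\<lambda>u. Q (\<phi> u)"])
    show "polynomial_on (\<lambda>s. s) D (\<lambda>s. Q (\<phi> (u(i := s))))" for u i
      unfolding D_def by (rule polynomial_on_homogeneous[OF homQ poly])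
    show "Q (\<phi> u) = 0" if "\<forall>i. u i \<in> of_nat ` {..D}" for u
      using c(2) that unfolding G_def Q_def by auto
  qed
  then have "vanishes_on Q Y" by (rule dense[OF homQ])
  then have "vanishes_on Q (S (Suc K))" by (rule vanishes_on_subset) (use S(2) nK in simp)
  then have "c a = 0" if "a \<in> A" for a
    using chain_monomials_independent[of "Suc K" E f S d N c a] homf S(1) f0 step nK that
    unfolding Q_def A_def N_def by auto
  then show False using c(1) by blast
qed

lemma irreducible_closed_chainD:
  assumes "irreducible_closed_chain (subtopology zariski X) n Z" "X \<subseteq> proj_space"
  shows "i \<le> n \<Longrightarrow> prime_locus (Z i)" "i \<le> n \<Longrightarrow> Z i \<subseteq> X" "i < n \<Longrightarrow> Z i \<subseteq> Z (Suc i)"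
    "i < n \<Longrightarrow> separated (Z i) (Z (Suc i))"
proof -
  note ch = assms(1)[unfolded irreducible_closed_chain_def]
  have sub: "Z i \<subseteq> X" if "i \<le> n" for i
    using ch closedin_subset that by fastforce
  then show "i \<le> n \<Longrightarrow> Z i \<subseteq> X" .
  show "prime_locus (Z i)" if "i \<le> n"
  proof -
    have "irreducible_space (subtopology (subtopology zariski X) (Z i))"
      using ch that by blast
    then have "irreducible_space (subtopology zariski (Z i))"
      using sub[OF that] by (simp add: subtopology_subtopology inf_absorb2)
    then show ?thesis
      using irreducible_space_zariski_iff sub[OF that] assms(2) by (meson order_trans)
  qed
  show "Z i \<subseteq> Z (Suc i)" if "i < n" using ch that by blast
  show "separated (Z i) (Z (Suc i))"
    if i: "i < n"
  proof -
    obtain L where L: "L \<in> Z (Suc i)" "L \<notin> Z i" using ch i by blast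
    then have "L \<in> X" using sub[of "Suc i"] i by auto
    then obtain v where v: "v \<noteq> 0" "L = line v"
      using assms(2) unfolding proj_space_def by blast
    have "closedin (subtopology zariski X) (Z i)" using ch i by simp
    then obtain d f where "homogeneous_poly d f" "f v \<noteq> 0" "vanishes_on f (Z i)"
      using zariski_closedinD[OF _ assms(2) v(1)] L v \<open>L \<in> X\<close> by blast
    then show ?thesis using v L unfolding vanishes_on_def by blast
  qed
qed

section \<open>Pluecker coordinates\<close>

definition minor3 :: "complex ^ 'm \<Rightarrow> complex ^ 'm \<Rightarrow> complex ^ 'm \<Rightarrow> 'm \<Rightarrow> 'm \<Rightarrow> 'm \<Rightarrow> complex" where
  "minor3 a b c i j k =
     a $ i * (b $ j * c $ k - b $ k * c $ j)
   - a $ j * (b $ i * c $ k - b $ k * c $ i)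
   + a $ k * (b $ i * c $ j - b $ j * c $ i)"

lemma minor3_alternating:
  "minor3 a b c i i k = 0" "minor3 a b c i k i = 0" "minor3 a b c k i i = 0"
  "minor3 a b c j i k = - minor3 a b c i j k" "minor3 a b c i k j = - minor3 a b c i j k"
  unfolding minor3_def by (simp_all add: algebra_simps)

lemma wedge3_nth:
  assumes "i < j" "j < k"
  shows "wedge3 a b c $ Abs_mon_triple (i, j, k) = minor3 a b c i j k"
  using assms unfolding wedge3_def minor3_def
  by (simp add: Abs_mon_triple_inverse det_3 vector_3 algebra_simps)

lemma mon_triple_cases:
  obtains i j k where "T = Abs_mon_triple (i, j, k)" "i < j" "j < k"
proof (cases T)
  case (Abs_mon_triple t)
  then show ?thesis using that by (cases t) auto
qed

lemma wedge3_eq_0D: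
  assumes "wedge3 a b c = 0"
  shows "minor3 a b c i j k = 0"
proof -
  have *: "minor3 a b c i j k = 0" if "i < j" "j < k" for i j k
    using wedge3_nth[OF that, of a b c] assms by simp
  show ?thesis
    using minor3_alternating[of a b c] *
    by (metis linorder_less_linear neg_equal_0_iff_equal)
qed

text \<open>If a and b have a nonzero 2 by 2 minor, the vanishing 3 by 3 minors containing it give a
  relation with cofactors as coefficients; otherwise a and b are already dependent.\<close>

lemma dependent3I:
  fixes a b c :: "complex ^ 'm"
  assumes "\<And>i j k. minor3 a b c i j k = 0"
  shows "\<exists>\<alpha> \<beta> \<gamma>. \<alpha> *s a + \<beta> *s b + \<gamma> *s c = 0 \<and> \<not> (\<alpha> = 0 \<and> \<beta> = 0 \<and> \<gamma> = 0)"
proof (cases "\<exists>i j. a $ i * b $ j - a $ j * b $ i \<noteq> 0")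
  case True
  then obtain i j where ij: "a $ i * b $ j - a $ j * b $ i \<noteq> 0" by blast
  have "(b $ i * c $ j - b $ j * c $ i) *s a + (a $ j * c $ i - a $ i * c $ j) *s b
      + (a $ i * b $ j - a $ j * b $ i) *s c = 0"
  proof (rule vec_eq_iff[THEN iffD2], rule allI)
    fix k
    show "((b $ i * c $ j - b $ j * c $ i) *s a + (a $ j * c $ i - a $ i * c $ j) *s b
      + (a $ i * b $ j - a $ j * b $ i) *s c) $ k = 0 $ k"
      using assms[of i j k] unfolding minor3_def by (simp add: algebra_simps)
  qed
  then show ?thesis using ij by blast
next
  case False
  show ?thesis
  proof (cases "a = 0")
    case True
    then have "1 *s a + 0 *s b + 0 *s c = 0" by simp
    then show ?thesis by (metis zero_neq_one)
  next
    case a: False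
    then obtain i where i: "a $ i \<noteq> 0" by (auto simp: vec_eq_iff)
    have "(- (b $ i)) *s a + (a $ i) *s b + 0 *s c = 0"
      using False by (auto simp: vec_eq_iff algebra_simps)
    then show ?thesis using i by blast
  qed
qed

lemma stable_iff: "stable R \<longleftrightarrow> minors_wedge R \<noteq> 0"
proof
  assume st: "stable R"
  show "minors_wedge R \<noteq> 0"
  proof
    assume "minors_wedge R = 0"
    then have "\<And>i j k. minor3 (minor R 1 2) (minor R 1 3) (minor R 2 3) i j k = 0"
      unfolding minors_wedge_def by (rule wedge3_eq_0D)
    from dependent3I[OF this] show False
      using st unfolding stable_def by blast
  qed
next
  assume nz: "minors_wedge R \<noteq> 0"
  show "stable R"
    unfolding stable_def
  proof (intro allI impI)
    fix \<alpha> \<beta> \<gamma>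
    define a b c where "a = minor R 1 2" "b = minor R 1 3" "c = minor R 2 3"
    assume "\<alpha> *s minor R 1 2 + \<beta> *s minor R 1 3 + \<gamma> *s minor R 2 3 = 0"
    then have rel: "\<alpha> * a $ m + \<beta> * b $ m + \<gamma> * c $ m = 0" for m
      unfolding a_b_c_def by (metis vector_add_component vector_smult_component zero_index)
    have "\<alpha> * minor3 a b c i j k = 0 \<and> \<beta> * minor3 a b c i j k = 0 \<and> \<gamma> * minor3 a b c i j k = 0" for i j k
      using rel[of i] rel[of j] rel[of k] unfolding minor3_def by algebra
    moreover obtain i j k where "minor3 a b c i j k \<noteq> 0"
    proof -
      obtain T where "minors_wedge R $ T \<noteq> 0" using nz by (auto simp: vec_eq_iff)
      then show ?thesis
        using that wedge3_nth unfolding minors_wedge_def a_b_c_def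
        by (cases T rule: mon_triple_cases) metis
    qed
    ultimately show "\<alpha> = 0 \<and> \<beta> = 0 \<and> \<gamma> = 0" by auto
  qed
qed

definition pairing :: "S2W \<Rightarrow> S2W \<Rightarrow> complex" where
  "pairing \<alpha> a = (\<Sum>m\<in>UNIV. \<alpha> $ m * a $ m)"

lemma pairing_linear:
  "pairing \<alpha> (a + b) = pairing \<alpha> a + pairing \<alpha> b" "pairing \<alpha> (a - b) = pairing \<alpha> a - pairing \<alpha> b"
  "pairing \<alpha> (c *s a) = c * pairing \<alpha> a" "pairing \<alpha> (- a) = - pairing \<alpha> a" "pairing \<alpha> 0 = 0"
  unfolding pairing_def
  by (simp_all add: algebra_simps sum.distrib sum_subtractf sum_distrib_left sum_negf)

text \<open>The linear form on the exterior cube that belongs to the wedge of three functionals.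
  With functionals adapted to a frame these are the Pluecker coordinates in that frame.\<close>

definition pluecker :: "S2W \<Rightarrow> S2W \<Rightarrow> S2W \<Rightarrow> ext3S2W \<Rightarrow> complex" where
  "pluecker \<alpha> \<beta> \<gamma> \<omega> = (\<Sum>T\<in>UNIV. wedge3 \<alpha> \<beta> \<gamma> $ T * \<omega> $ T)"

lemma homogeneous_pluecker: "homogeneous_poly 1 (pluecker \<alpha> \<beta> \<gamma>)"
  using homogeneous_poly_linear[of "\<lambda>T. wedge3 \<alpha> \<beta> \<gamma> $ T"] unfolding pluecker_def[abs_def] .

lemma sum_mon_triple:
  "(\<Sum>T\<in>UNIV. g (Rep_mon_triple T)) =
    (\<Sum>i\<in>UNIV. \<Sum>j\<in>UNIV. \<Sum>k\<in>UNIV. if i < j \<and> j < k then g (i, j, k) else (0::complex))"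
proof -
  have "(\<Sum>T\<in>UNIV. g (Rep_mon_triple T)) = sum g (range Rep_mon_triple)"
    by (simp add: sum.reindex inj_on_def Rep_mon_triple_inject)
  also have "range Rep_mon_triple = {t. case t of (i, j, k) \<Rightarrow> i < j \<and> j < k}"
    using type_definition.Rep_range[OF type_definition_mon_triple] .
  also have "sum g \<dots> = (\<Sum>t\<in>UNIV. if (case t of (i, j, k) \<Rightarrow> i < j \<and> j < k) then g t else 0)"
    by (simp add: sum.If_cases)
  also have "\<dots> = (\<Sum>i\<in>UNIV. \<Sum>j\<in>UNIV. \<Sum>k\<in>UNIV. if i < j \<and> j < k then g (i, j, k) else 0)"
    unfolding sum.cartesian_product by (simp add: case_prod_unfold cong: if_cong)
  finally show ?thesis .
qed

lemma sum_mon: "(\<Sum>m\<in>UNIV. f m) = f XX + f XY + f XZ + f YY + f YZ + f ZZ" for f :: "mon \<Rightarrow> complex"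
  unfolding UNIV_mon by (simp add: add.assoc)

lemma sum3_product:
  "(\<Sum>i\<in>UNIV. f i) * (\<Sum>j\<in>UNIV. g j) * (\<Sum>k\<in>UNIV. h k) =
    (\<Sum>i\<in>UNIV. \<Sum>j\<in>UNIV. \<Sum>k\<in>UNIV. f i * g j * (h k :: complex))" for f g h :: "mon \<Rightarrow> complex"
proof -
  have "(\<Sum>i\<in>UNIV. f i) * (\<Sum>j\<in>UNIV. g j) * (\<Sum>k\<in>UNIV. h k) =
      (\<Sum>i\<in>UNIV. f i * (\<Sum>j\<in>UNIV. g j * (\<Sum>k\<in>UNIV. h k)))"
    by (simp only: sum_distrib_right mult.assoc)
  then show ?thesis by (simp only: sum_distrib_left mult.assoc)
qed

text \<open>The Cauchy--Binet formula for a \<open>3 \<times> 6\<close> by \<open>6 \<times> 3\<close> product.\<close>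

lemma pluecker_wedge3:
  "pluecker \<alpha> \<beta> \<gamma> (wedge3 a b c) =
     pairing \<alpha> a * (pairing \<beta> b * pairing \<gamma> c - pairing \<beta> c * pairing \<gamma> b)
   - pairing \<alpha> b * (pairing \<beta> a * pairing \<gamma> c - pairing \<beta> c * pairing \<gamma> a)
   + pairing \<alpha> c * (pairing \<beta> a * pairing \<gamma> b - pairing \<beta> b * pairing \<gamma> a)"
  (is "_ = ?rhs")
proof -
  define D where "D = minor3 \<alpha> \<beta> \<gamma>"
  have D: "D i i k = 0" "D i k i = 0" "D k i i = 0"
    "j < i \<Longrightarrow> D i j k = - D j i k" "k < j \<Longrightarrow> D i j k = - D i k j" for i j k
    using minor3_alternating[of \<alpha> \<beta> \<gamma>] unfolding D_def by metis+
  have "?rhs = (\<Sum>i\<in>UNIV. \<Sum>j\<in>UNIV. \<Sum>k\<in>UNIV. a $ i * b $ j * c $ k * D i j k)"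
  proof -
    have t: "(\<Sum>i\<in>UNIV. \<Sum>j\<in>UNIV. \<Sum>k\<in>UNIV. a $ i * b $ j * c $ k * (p $ i * q $ j * r $ k)) =
        pairing p a * pairing q b * pairing r c" for p q r
      unfolding pairing_def sum3_product by (intro sum.cong refl) (simp add: algebra_simps)
    have "?rhs = pairing \<alpha> a * pairing \<beta> b * pairing \<gamma> c - pairing \<alpha> a * pairing \<gamma> b * pairing \<beta> c
      - pairing \<beta> a * pairing \<alpha> b * pairing \<gamma> c + pairing \<gamma> a * pairing \<alpha> b * pairing \<beta> c
      + pairing \<beta> a * pairing \<gamma> b * pairing \<alpha> c - pairing \<gamma> a * pairing \<beta> b * pairing \<alpha> c"
      by (simp add: algebra_simps)
    also have "\<dots> = (\<Sum>i\<in>UNIV. \<Sum>j\<in>UNIV. \<Sum>k\<in>UNIV. a $ i * b $ j * c $ k * D i j k)"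
      unfolding t[symmetric] sum_subtractf[symmetric] sum.distrib[symmetric] D_def minor3_def
      by (intro sum.cong refl) (simp add: algebra_simps)
    finally show ?thesis .
  qed
  moreover have "pluecker \<alpha> \<beta> \<gamma> (wedge3 a b c) =
      (\<Sum>i\<in>UNIV. \<Sum>j\<in>UNIV. \<Sum>k\<in>UNIV. if i < j \<and> j < k then D i j k * minor3 a b c i j k else 0)"
  proof -
    have "wedge3 \<alpha> \<beta> \<gamma> $ T * wedge3 a b c $ T =
        (case Rep_mon_triple T of (i, j, k) \<Rightarrow> D i j k * minor3 a b c i j k)" for T
      by (cases T rule: mon_triple_cases) (simp add: wedge3_nth Abs_mon_triple_inverse D_def)
    then show ?thesis
      unfolding pluecker_def using sum_mon_triple[of "\<lambda>(i, j, k). D i j k * minor3 a b c i j k"]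
      by (simp only: prod.case)
  qed
  moreover have "\<dots> = (\<Sum>i\<in>UNIV. \<Sum>j\<in>UNIV. \<Sum>k\<in>UNIV. a $ i * b $ j * c $ k * D i j k)"
    by (simp add: sum_mon less_mon_def mon_rank_def D minor3_def algebra_simps)
  ultimately show ?thesis by simp
qed

lemma wedge3_scale: "wedge3 (p *s a) (q *s b) (r *s c) = (p * q * r) *s wedge3 a b c"
proof (rule vec_eq_iff[THEN iffD2], rule allI)
  fix T
  show "wedge3 (p *s a) (q *s b) (r *s c) $ T = ((p * q * r) *s wedge3 a b c) $ T"
    by (cases T rule: mon_triple_cases) (simp add: wedge3_nth minor3_def algebra_simps)
qed

section \<open>Row and column operations, and the affine chart of a frame\<close>

lemma sym_mult_nth [simp]:
  "(u \<bullet>\<^sub>S v) $ XX = u$1 * v$1" "(u \<bullet>\<^sub>S v) $ XY = u$1 * v$2 + u$2 * v$1"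
  "(u \<bullet>\<^sub>S v) $ XZ = u$1 * v$3 + u$3 * v$1" "(u \<bullet>\<^sub>S v) $ YY = u$2 * v$2"
  "(u \<bullet>\<^sub>S v) $ YZ = u$2 * v$3 + u$3 * v$2" "(u \<bullet>\<^sub>S v) $ ZZ = u$3 * v$3"
  unfolding sym_mult_def by simp_all

lemma all_mon: "(\<forall>m. P m) \<longleftrightarrow> P XX \<and> P XY \<and> P XZ \<and> P YY \<and> P YZ \<and> P ZZ"
  by (metis mon.exhaust)

lemma sym_mult_linear:
  "(u + u') \<bullet>\<^sub>S v = u \<bullet>\<^sub>S v + u' \<bullet>\<^sub>S v" "(u - u') \<bullet>\<^sub>S v = u \<bullet>\<^sub>S v - u' \<bullet>\<^sub>S v"
  "(c *s u) \<bullet>\<^sub>S v = c *s (u \<bullet>\<^sub>S v)" "u \<bullet>\<^sub>S (v + v') = u \<bullet>\<^sub>S v + u \<bullet>\<^sub>S v'"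
  "u \<bullet>\<^sub>S (v - v') = u \<bullet>\<^sub>S v - u \<bullet>\<^sub>S v'" "u \<bullet>\<^sub>S (c *s v) = c *s (u \<bullet>\<^sub>S v)"
  "0 \<bullet>\<^sub>S v = 0" "u \<bullet>\<^sub>S 0 = 0"
  by (simp_all add: vec_eq_iff all_mon algebra_simps)

lemma sym_mult_commute: "u \<bullet>\<^sub>S v = v \<bullet>\<^sub>S u"
  by (simp add: vec_eq_iff all_mon algebra_simps)

lemma minor3_combination:
  "minor3 (p1 *s a + p2 *s b + p3 *s c) (q1 *s a + q2 *s b + q3 *s c) (r1 *s a + r2 *s b + r3 *s c) i j k =
    (p1 * (q2 * r3 - q3 * r2) - p2 * (q1 * r3 - q3 * r1) + p3 * (q1 * r2 - q2 * r1)) * minor3 a b c i j k"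
  unfolding minor3_def vector_add_component vector_smult_component by algebra

lemma wedge3_combination:
  "wedge3 (p1 *s a + p2 *s b + p3 *s c) (q1 *s a + q2 *s b + q3 *s c) (r1 *s a + r2 *s b + r3 *s c) =
    (p1 * (q2 * r3 - q3 * r2) - p2 * (q1 * r3 - q3 * r1) + p3 * (q1 * r2 - q2 * r1)) *s wedge3 a b c"
  (is "?l = ?r")
proof (rule vec_eq_iff[THEN iffD2], rule allI)
  fix T
  show "?l $ T = ?r $ T"
    by (cases T rule: mon_triple_cases)
      (simp only: wedge3_nth minor3_combination vector_smult_component)
qed

definition row_col_op :: "complex ^ 2 ^ 2 \<Rightarrow> complex ^ 3 ^ 3 \<Rightarrow> mat23 \<Rightarrow> mat23" where
  "row_col_op A B R = (\<chi> i j. \<Sum>k\<in>UNIV. \<Sum>l\<in>UNIV. (A $ i $ k * B $ l $ j) *s R $ k $ l)"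

lemma minor_row_col_op:
  "minor (row_col_op A B R) p q = (det A * (B$1$p * B$2$q - B$1$q * B$2$p)) *s minor R 1 2
    + (det A * (B$1$p * B$3$q - B$1$q * B$3$p)) *s minor R 1 3
    + (det A * (B$2$p * B$3$q - B$2$q * B$3$p)) *s minor R 2 3"
  unfolding vec_eq_iff all_mon row_col_op_def minor_def
  by (simp add: sum_2 sum_3 det_2; intro conjI; algebra)

text \<open>Each of the three minors picks up det A, and the minors are mixed by the second compound
  of B, whose determinant is the square of det B.\<close>

lemma minors_wedge_row_col_op:
  "minors_wedge (row_col_op A B R) = (det A ^ 3 * det B ^ 2) *s minors_wedge R"
  unfolding minors_wedge_def minor_row_col_op wedge3_combination
proof (rule arg_cong[of _ _ "\<lambda>c. c *s _"])
qed (simp add: det_3, algebra)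

lemma minors_wedge_scale: "minors_wedge (\<chi> i j. t *s R $ i $ j) = t ^ 6 *s minors_wedge R"
proof -
  have "minor (\<chi> i j. t *s R $ i $ j) p q = t ^ 2 *s minor R p q" for p q
    unfolding minor_def by (simp add: vec_eq_iff all_mon power2_eq_square algebra_simps)
  note this [simp]
  show ?thesis
    unfolding minors_wedge_def by (simp add: wedge3_scale power_add[symmetric])
qed

definition dotW :: "W \<Rightarrow> W \<Rightarrow> complex" where
  "dotW p u = p$1 * u$1 + p$2 * u$2 + p$3 * u$3"

lemma dotW_linear [simp]:
  "dotW p (u + v) = dotW p u + dotW p v" "dotW p (u - v) = dotW p u - dotW p v"
  "dotW p (c *s u) = c * dotW p u" "dotW p (- u) = - dotW p u" "dotW p 0 = 0"
  unfolding dotW_def by (simp_all add: algebra_simps)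

text \<open>The functional on quadrics given by polarisation at the points p and q. The factors 2
  stand at the squares because a mixed monomial is a single basis vector; half of
  \<open>polar p p\<close> is evaluation at p.\<close>

definition polar :: "W \<Rightarrow> W \<Rightarrow> S2W" where
  "polar p q = (\<chi> m. case m of
     XX \<Rightarrow> 2 * p$1 * q$1 | XY \<Rightarrow> p$1 * q$2 + p$2 * q$1 | XZ \<Rightarrow> p$1 * q$3 + p$3 * q$1
   | YY \<Rightarrow> 2 * p$2 * q$2 | YZ \<Rightarrow> p$2 * q$3 + p$3 * q$2 | ZZ \<Rightarrow> 2 * p$3 * q$3)"

definition square_eval :: "W \<Rightarrow> S2W" where
  "square_eval p = (1 / 2) *s polar p p"

lemma pairing_polar: "pairing (polar p q) (u \<bullet>\<^sub>S v) = dotW p u * dotW q v + dotW p v * dotW q u"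
  unfolding pairing_def sum_mon polar_def dotW_def by (simp add: algebra_simps)

lemma pairing_square_eval: "pairing (square_eval p) (u \<bullet>\<^sub>S v) = dotW p u * dotW p v"
proof -
  have "pairing (square_eval p) a = pairing (polar p p) a / 2" for a
    unfolding pairing_def square_eval_def by (simp add: sum_divide_distrib)
  from this[of "u \<bullet>\<^sub>S v"] show ?thesis unfolding pairing_polar by simp
qed

lemma pairing_minor [simp]:
  "pairing (polar p q) (minor R j k) = dotW p (R$1$j) * dotW q (R$2$k) + dotW p (R$2$k) * dotW q (R$1$j)
    - dotW p (R$1$k) * dotW q (R$2$j) - dotW p (R$2$j) * dotW q (R$1$k)"
  "pairing (square_eval p) (minor R j k) = dotW p (R$1$j) * dotW p (R$2$k) - dotW p (R$1$k) * dotW p (R$2$j)"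
  unfolding minor_def pairing_linear pairing_polar pairing_square_eval by (simp_all add: algebra_simps)

text \<open>A basis of linear forms with its dual basis of points. Charts are written in a frame
  because several translates under GL(W) are used to reach the points of the divisor.\<close>

locale frame =
  fixes e1 e2 e3 f1 f2 f3 :: W
  assumes dual [simp]: "dotW f1 e1 = 1" "dotW f1 e2 = 0" "dotW f1 e3 = 0"
    "dotW f2 e1 = 0" "dotW f2 e2 = 1" "dotW f2 e3 = 0"
    "dotW f3 e1 = 0" "dotW f3 e2 = 0" "dotW f3 e3 = 1"
begin

lemma expand: "u = dotW f1 u *s e1 + dotW f2 u *s e2 + dotW f3 u *s e3"
proof -
  define F E :: "complex ^ 3 ^ 3" where "F = vector [f1, f2, f3]" and "E = transpose (vector [e1, e2, e3])"
  have "F ** E = mat 1"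
    using dual unfolding F_def E_def dotW_def
    by (simp add: vec_eq_iff forall_3 matrix_matrix_mult_def transpose_def sum_3 mat_def)
  then have "E ** F = mat 1" by (simp add: matrix_left_right_inverse)
  then have "u = E *v (F *v u)"
    by (simp add: matrix_vector_mul_assoc)
  also have "\<dots> = dotW f1 u *s e1 + dotW f2 u *s e2 + dotW f3 u *s e3"
    unfolding F_def E_def dotW_def
    by (simp add: vec_eq_iff forall_3 matrix_vector_mult_def transpose_def sum_3 algebra_simps)
  finally show ?thesis .
qed

lemma eqI:
  assumes "dotW f1 u = dotW f1 v" "dotW f2 u = dotW f2 v" "dotW f3 u = dotW f3 v"
  shows "u = v"
  using expand[of u] expand[of v] assms by simp

end

lemma frame_exists:
  assumes "det (vector [e1, e2, e3] :: complex ^ 3 ^ 3) \<noteq> 0"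
  shows "\<exists>f1 f2 f3. frame e1 e2 e3 f1 f2 f3"
proof -
  define E :: "complex ^ 3 ^ 3" where "E = vector [e1, e2, e3]"
  obtain F where F: "E ** F = mat 1"
    using assms invertible_det_nz[of E] unfolding E_def invertible_def by blast
  have "frame e1 e2 e3 (column 1 F) (column 2 F) (column 3 F)"
    using F unfolding frame_def dotW_def E_def
    by (simp add: vec_eq_iff forall_3 matrix_matrix_mult_def sum_3 mat_def column_def mult.commute)
  then show ?thesis by blast
qed

lemma dual_frame_exists:
  assumes "det (vector [f1, f2, f3] :: complex ^ 3 ^ 3) \<noteq> 0"
  shows "\<exists>e1 e2 e3. frame e1 e2 e3 f1 f2 f3"
proof -
  obtain e1 e2 e3 where "frame f1 f2 f3 e1 e2 e3" using frame_exists[OF assms] by blast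
  then have "frame e1 e2 e3 f1 f2 f3" unfolding frame_def dotW_def by (simp add: mult.commute)
  then show ?thesis by blast
qed

lemma all_option23: "(\<forall>p :: (2 \<times> 3) option. P p) \<longleftrightarrow> P None \<and> P (Some (1, 1)) \<and> P (Some (1, 2))
    \<and> P (Some (1, 3)) \<and> P (Some (2, 1)) \<and> P (Some (2, 2)) \<and> P (Some (2, 3))"
  by (auto simp: split_option_all forall_2 forall_3)

context frame
begin

text \<open>Homogenised, with \<open>None\<close> as the homogenising coordinate. For \<open>c $ None = 1\<close> these are the nets that
  restrict isomorphically to the conics on the line \<open>e\<^sub>3 = 0\<close>, i.e. the schemes disjoint from it.\<close>

definition chart :: "complex ^ ((2 \<times> 3) option) \<Rightarrow> mat23" where
  "chart c = vector [
     vector [c $ None *s e1 + c $ Some (1, 1) *s e3, c $ None *s e2 + c $ Some (1, 2) *s e3, c $ Some (1, 3) *s e3],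
     vector [c $ Some (2, 1) *s e3, c $ None *s e1 + c $ Some (2, 2) *s e3, c $ None *s e2 + c $ Some (2, 3) *s e3]]"

text \<open>Modulo e3 the minors of the chart matrix are e1^2, e1 e2, e2^2 up to the factor
  \<open>(c $ None)^2\<close>. The leading coordinate is the resulting determinant; replacing one
  functional by one involving f3 yields the parameters, and a difference is taken where two of them
  appear as a sum.\<close>

definition chart_coord :: "(2 \<times> 3) option \<Rightarrow> ext3S2W \<Rightarrow> complex" where
  "chart_coord p \<omega> = (case p of
     None \<Rightarrow> pluecker (square_eval f1) (polar f1 f2) (square_eval f2) \<omega>
   | Some (i, j) \<Rightarrow>
      if i = 1 then
        (if j = 1 then pluecker (square_eval f1) (polar f2 f3) (square_eval f2) \<omega>
         else if j = 2 then pluecker (square_eval f1) (polar f1 f2) (polar f2 f3) \<omega>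
           - pluecker (square_eval f1) (polar f1 f3) (square_eval f2) \<omega>
         else - pluecker (square_eval f1) (polar f1 f2) (polar f1 f3) \<omega>)
      else
        (if j = 1 then - pluecker (polar f2 f3) (polar f1 f2) (square_eval f2) \<omega>
         else if j = 2 then pluecker (polar f1 f3) (polar f1 f2) (square_eval f2) \<omega>
           - pluecker (square_eval f1) (polar f2 f3) (square_eval f2) \<omega>
         else pluecker (square_eval f1) (polar f1 f3) (square_eval f2) \<omega>))"

lemma chart_coord_chart: "chart_coord p (minors_wedge (chart c)) = c $ None ^ 5 * c $ p"
proof -
  have "\<forall>p. chart_coord p (minors_wedge (chart c)) = c $ None ^ 5 * c $ p"
    unfolding all_option23 chart_coord_def minors_wedge_def chart_def
    by (simp add: pluecker_wedge3; intro conjI; algebra)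
  then show ?thesis by blast
qed

lemma chart_scale: "chart (t *s c) = (\<chi> i j. t *s chart c $ i $ j)"
  unfolding chart_def by (simp add: vec_eq_iff forall_2 forall_3 algebra_simps)

text \<open>Writing \<open>R = X e\<^sub>1 + Y e\<^sub>2 + Z e\<^sub>3\<close>, the pencil \<open>s X + t Y\<close> has a kernel vector that is quadratic in
  \<open>(s, t)\<close>; its three coefficients are the columns of the base change to the normal form.\<close>

lemma chart_surjective:
  assumes "chart_coord None (minors_wedge R) \<noteq> 0"
  shows "\<exists>c t. c $ None = 1 \<and> t \<noteq> 0 \<and> minors_wedge R = t *s minors_wedge (chart c)"
proof -
  define X where "X = (\<lambda>i j. dotW f1 (R $ i $ j))"
  define Y where "Y = (\<lambda>i j. dotW f2 (R $ i $ j))"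
  define Z where "Z = (\<lambda>i j. dotW f3 (R $ i $ j))"
  define k0 :: "complex ^ 3" where "k0 = vector [X 1 2 * X 2 3 - X 1 3 * X 2 2,
    X 1 3 * X 2 1 - X 1 1 * X 2 3, X 1 1 * X 2 2 - X 1 2 * X 2 1]"
  define k2 :: "complex ^ 3" where "k2 = vector [Y 1 2 * Y 2 3 - Y 1 3 * Y 2 2,
    Y 1 3 * Y 2 1 - Y 1 1 * Y 2 3, Y 1 1 * Y 2 2 - Y 1 2 * Y 2 1]"
  define k1 :: "complex ^ 3" where "k1 = vector [
    X 1 2 * Y 2 3 + Y 1 2 * X 2 3 - X 1 3 * Y 2 2 - Y 1 3 * X 2 2,
    X 1 3 * Y 2 1 + Y 1 3 * X 2 1 - X 1 1 * Y 2 3 - Y 1 1 * X 2 3,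
    X 1 1 * Y 2 2 + Y 1 1 * X 2 2 - X 1 2 * Y 2 1 - Y 1 2 * X 2 1]"
  \<comment> \<open>The kernel identities are X k0 = 0, X k1 + Y k0 = 0, X k2 + Y k1 = 0 and Y k2 =
    0. Hence X B has the columns p, q, 0 and Y B the columns 0, p, q. The adjugate A of the matrix
    with columns p, q turns both into \<delta> times the normal form.\<close>
  define B :: "complex ^ 3 ^ 3" where "B = (\<chi> l j. if j = 1 then k2 $ l else if j = 2 then - k1 $ l else k0 $ l)"
  define p where "p = (\<lambda>i. X i 1 * k2 $ 1 + X i 2 * k2 $ 2 + X i 3 * k2 $ 3)"
  define q where "q = (\<lambda>i. Y i 1 * k0 $ 1 + Y i 2 * k0 $ 2 + Y i 3 * k0 $ 3)"
  define A :: "complex ^ 2 ^ 2" where "A = vector [vector [q 2, - q 1], vector [- p 2, p 1]]"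
  define \<delta> where "\<delta> = p 1 * q 2 - p 2 * q 1"
  define l where "l = chart_coord None (minors_wedge R)"
  have l: "l = det (vector [vector [k0 $ 3, k1 $ 3, k2 $ 3], vector [- k0 $ 2, - k1 $ 2, - k2 $ 2],
      vector [k0 $ 1, k1 $ 1, k2 $ 1]] :: complex ^ 3 ^ 3)"
    unfolding l_def chart_coord_def minors_wedge_def pluecker_wedge3 det_3
    by (simp add: k0_def k1_def k2_def X_def Y_def) algebra
  have "\<delta> = l"
    unfolding l \<delta>_def p_def q_def det_3 by (simp add: k0_def k1_def k2_def) algebra
  moreover have "det B = l"
    unfolding l B_def det_3 by simp
  moreover have "det A = \<delta>" unfolding A_def \<delta>_def det_2 by simp
  ultimately have det: "det A = l" "det B = l" by simp_all
  define R' where "R' = row_col_op A B R"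
  have entry: "dotW f (R' $ i $ j) = (\<Sum>k\<in>UNIV. \<Sum>l\<in>UNIV. A $ i $ k * B $ l $ j * dotW f (R $ k $ l))" for f i j
    unfolding R'_def row_col_op_def by (simp add: sum_2 sum_3)
  define c :: "complex ^ ((2 \<times> 3) option)" where
    "c = (\<chi> m. case m of None \<Rightarrow> \<delta> | Some (i, j) \<Rightarrow> dotW f3 (R' $ i $ j))"
  have XYR: "dotW f1 (R $ i $ j) = X i j" "dotW f2 (R $ i $ j) = Y i j" for i j
    unfolding X_def Y_def by simp_all
  have X': "\<forall>i j. dotW f1 (R' $ i $ j) = dotW f1 (chart c $ i $ j)"
    unfolding forall_2 forall_3 entry XYR sum_2 sum_3 chart_def c_def \<delta>_def A_def B_def p_def q_def
    by (simp add: k0_def k1_def k2_def; intro conjI; algebra)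
  have Y': "\<forall>i j. dotW f2 (R' $ i $ j) = dotW f2 (chart c $ i $ j)"
    unfolding forall_2 forall_3 entry XYR sum_2 sum_3 chart_def c_def \<delta>_def A_def B_def p_def q_def
    by (simp add: k0_def k1_def k2_def; intro conjI; algebra)
  have Z': "\<forall>i j. dotW f3 (R' $ i $ j) = dotW f3 (chart c $ i $ j)"
    unfolding forall_2 forall_3 chart_def c_def by simp
  have "R' = chart c"
    using X' Y' Z' eqI by (simp add: vec_eq_iff[of R'] vec_eq_iff[of "R' $ _"] ) 
  \<comment> \<open>Both determinants equal l, so det A ^ 3 * det B ^ 2 is l ^ 5. Rescaling the
    chart parameters to leading coordinate 1 contributes l ^ 6, and one factor l remains.\<close>
  then have eq: "l ^ 5 *s minors_wedge R = minors_wedge (chart c)"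
    using minors_wedge_row_col_op[of A B R] det unfolding R'_def by (simp add: power_add[symmetric])
  have l0: "l \<noteq> 0" using assms unfolding l_def .
  have "chart c = (\<chi> i j. l *s chart (inverse l *s c) $ i $ j)"
    using l0 by (simp add: chart_scale[symmetric])
  then have "l ^ 5 *s minors_wedge R = l ^ 6 *s minors_wedge (chart (inverse l *s c))"
    unfolding eq by (metis minors_wedge_scale)
  then have "inverse (l ^ 5) *s (l ^ 5 *s minors_wedge R) = inverse (l ^ 5) *s (l ^ 6 *s minors_wedge (chart (inverse l *s c)))"
    by (rule arg_cong)
  then have "minors_wedge R = l *s minors_wedge (chart (inverse l *s c))"
    using l0 by (simp add: field_simps eval_nat_numeral)
  moreover have "(inverse l *s c) $ None = 1"
    using l0 \<open>\<delta> = l\<close> by (simp add: c_def)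
  ultimately show ?thesis using l0 by blast
qed

end

section \<open>Torus limits and cells\<close>

definition mon_weight :: "mon \<Rightarrow> nat" where
  "mon_weight m = (case m of XX \<Rightarrow> 0 | XY \<Rightarrow> 1 | XZ \<Rightarrow> 3 | YY \<Rightarrow> 2 | YZ \<Rightarrow> 4 | ZZ \<Rightarrow> 6)"

definition triple_weight :: "mon_triple \<Rightarrow> nat" where
  "triple_weight T = (case Rep_mon_triple T of (i, j, k) \<Rightarrow> mon_weight i + mon_weight j + mon_weight k)"

definition torus_ext :: "complex \<Rightarrow> ext3S2W \<Rightarrow> ext3S2W" where
  "torus_ext t v = (\<chi> T. t ^ triple_weight T * v $ T)"

lemma triple_weight_Abs:
  "i < j \<Longrightarrow> j < k \<Longrightarrow> triple_weight (Abs_mon_triple (i, j, k)) = mon_weight i + mon_weight j + mon_weight k"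
  unfolding triple_weight_def by (simp add: Abs_mon_triple_inverse)

lemma minors_wedge_torus: "minors_wedge (torus_mat t R) = torus_ext t (minors_wedge R)"
proof -
  have m: "minor (torus_mat t R) p q $ m = t ^ mon_weight m * minor R p q $ m" for p q m
    unfolding minor_def torus_mat_def torus_W_def xW_def yW_def zW_def mon_weight_def
    by (cases m) (simp_all add: axis_def algebra_simps eval_nat_numeral)
  show ?thesis
    unfolding vec_eq_iff
  proof
    fix T
    show "minors_wedge (torus_mat t R) $ T = torus_ext t (minors_wedge R) $ T"
      by (cases T rule: mon_triple_cases)
        (simp add: torus_ext_def minors_wedge_def wedge3_nth triple_weight_Abs minor3_def m power_add algebra_simps)
  qed
qed

text \<open>After division by the power of t at T0, the coordinates of smaller weight tend to 0; a
  nonzero coordinate of equal or larger weight would keep the limit away from the coordinate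
  point.\<close>

lemma limitin_torus_iff:
  fixes v :: ext3S2W
  shows "limitin proj_classical (\<lambda>t. line (torus_ext t v)) (line (axis T0 1)) at_infinity \<longleftrightarrow>
    v $ T0 \<noteq> 0 \<and> (\<forall>T. T \<noteq> T0 \<and> triple_weight T0 \<le> triple_weight T \<longrightarrow> v $ T = 0)"
    (is "?lim \<longleftrightarrow> ?cond")
proof
  let ?n = "triple_weight T0"
  let ?a = "axis T0 1 :: ext3S2W"
  assume lim: ?lim
  \<comment> \<open>A scaling invariant open condition that holds at the limit holds for some large
    t. It is applied to \<open>u $ T0 \<noteq> 0\<close> and to a bound for the ratio of two
    coordinates.\<close>
  have ev: "\<forall>\<^sub>F t in at_infinity. Q (torus_ext t v)"
    if Q: "open {u. u \<noteq> 0 \<and> Q u}" "\<And>c u. c \<noteq> 0 \<Longrightarrow> Q (c *s u) \<longleftrightarrow> Q u" "Q ?a" "\<And>u. Q u \<Longrightarrow> u \<noteq> 0" for Q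
  proof -
    let ?U = "{line u | u. u \<noteq> 0 \<and> Q u}"
    have iff: "line u \<in> ?U \<longleftrightarrow> Q u" if "u \<noteq> 0" for u
    proof
      assume "line u \<in> ?U"
      then obtain w where "w \<noteq> 0" "Q w" "line w = line u" by auto
      then show "Q u" using Q(2) line_eqD[of w u] by metis
    qed (use that in blast)
    have "{u. u \<noteq> 0 \<and> line u \<in> ?U} = {u. u \<noteq> 0 \<and> Q u}" using iff by blast
    then have "openin proj_classical ?U"
      unfolding openin_proj_classical using Q(1) by (auto simp: proj_space_def)
    moreover have "line ?a \<in> ?U" using Q(3,4) by blast
    ultimately have "\<forall>\<^sub>F t in at_infinity. line (torus_ext t v) \<in> ?U"
      using lim unfolding limitin_def by blast
    then show ?thesis
    proof eventually_elim
      case (elim t)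
      then obtain w where w: "w \<noteq> 0" "Q w" "line w = line (torus_ext t v)" by auto
      obtain c where "c \<noteq> 0" "w = c *s torus_ext t v" using line_eqD[OF w(3,1)] .
      then show ?case using w Q(2) by metis
    qed
  qed
  have large: "\<forall>\<^sub>F t in at_infinity. 1 \<le> norm (t :: complex)"
    unfolding eventually_at_infinity by blast
  have "{u :: ext3S2W. u \<noteq> 0 \<and> u $ T0 \<noteq> 0} = {u. u $ T0 \<noteq> 0}" by auto
  moreover have "open {u :: ext3S2W. u $ T0 \<noteq> 0}"
    by (intro open_Collect_neq continuous_intros)
  ultimately have "\<forall>\<^sub>F t in at_infinity. torus_ext t v $ T0 \<noteq> 0"
    by (intro ev) auto
  then have T0: "v $ T0 \<noteq> 0"
    using eventually_happens'[OF trivial_limit_at_infinity] unfolding torus_ext_def by fastforce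
  moreover have "v $ T = 0" if T: "T \<noteq> T0" "?n \<le> triple_weight T" for T
  proof (rule ccontr)
    assume vT: "v $ T \<noteq> 0"
    \<comment> \<open>If the weight of T is not smaller than that of T0, the ratio of these
      coordinates has absolute value at least \<epsilon>, its value at t = 1, for all t with norm at
      least 1. But at the limit the ratio is 0.\<close>
    define \<epsilon> where "\<epsilon> = norm (v $ T) / norm (v $ T0)"
    have \<epsilon>: "\<epsilon> > 0" using vT T0 by (simp add: \<epsilon>_def)
    have "{u :: ext3S2W. u \<noteq> 0 \<and> norm (u $ T) < \<epsilon> * norm (u $ T0)} = {u. norm (u $ T) < \<epsilon> * norm (u $ T0)}"
      by auto
    moreover have "open {u :: ext3S2W. norm (u $ T) < \<epsilon> * norm (u $ T0)}"
      by (intro open_Collect_less continuous_intros)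
    ultimately have "\<forall>\<^sub>F t in at_infinity. norm (torus_ext t v $ T) < \<epsilon> * norm (torus_ext t v $ T0)"
      using \<epsilon> T by (intro ev) (auto simp: norm_mult axis_def mult.left_commute)
    with large have "\<forall>\<^sub>F t in at_infinity. (1 :: real) \<le> norm (t :: complex) \<and>
        norm (torus_ext t v $ T) < \<epsilon> * norm (torus_ext t v $ T0)"
      by eventually_elim simp
    then obtain t :: complex where t: "1 \<le> norm t" "norm (torus_ext t v $ T) < \<epsilon> * norm (torus_ext t v $ T0)"
      using eventually_happens'[OF trivial_limit_at_infinity] by blast
    have "\<epsilon> * norm (v $ T0) = norm (v $ T)" using T0 by (simp add: \<epsilon>_def)
    then have e: "\<epsilon> * (norm t ^ ?n * norm (v $ T0)) = norm t ^ ?n * norm (v $ T)"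
      by (metis mult.left_commute)
    have "norm t ^ triple_weight T * norm (v $ T) < \<epsilon> * (norm t ^ ?n * norm (v $ T0))"
      using t(2) by (simp add: torus_ext_def norm_mult norm_power)
    then have "norm t ^ triple_weight T * norm (v $ T) < norm t ^ ?n * norm (v $ T)"
      unfolding e .
    moreover have "norm t ^ ?n * norm (v $ T) \<le> norm t ^ triple_weight T * norm (v $ T)"
      using t(1) T(2) by (intro mult_right_mono power_increasing) auto
    ultimately show False by simp
  qed
  ultimately show ?cond by blast
next
  let ?n = "triple_weight T0"
  let ?a = "axis T0 1 :: ext3S2W"
  assume cond: ?cond
  define g where "g = (\<lambda>t. \<chi> T. inverse (t ^ ?n) * (t ^ triple_weight T * v $ T))"
  have g: "(g \<longlongrightarrow> v $ T0 *s ?a) at_infinity"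
  proof (rule vec_tendstoI)
    fix T
    show "((\<lambda>t. g t $ T) \<longlongrightarrow> (v $ T0 *s ?a) $ T) at_infinity"
    proof (cases "T = T0")
      case True
      have "\<forall>\<^sub>F t in at_infinity. v $ T0 = g t $ T"
        unfolding eventually_at_infinity
      proof (intro exI[of _ 1] allI impI)
        fix t :: complex assume "1 \<le> norm t"
        then have "t \<noteq> 0" by auto
        then show "v $ T0 = g t $ T" using True by (simp add: g_def)
      qed
      then show ?thesis using True by (simp add: tendsto_eventually axis_def eq_commute)
    next
      case False
      show ?thesis
      proof (cases "v $ T = 0")
        case True
        then show ?thesis using False by (simp add: g_def axis_def)
      next
        case vT: False
        then have lt: "triple_weight T < ?n" using cond False by force
        have "((\<lambda>t::complex. inverse t ^ (?n - triple_weight T) * v $ T) \<longlongrightarrow> 0 ^ (?n - triple_weight T) * v $ T) at_infinity"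
          by (intro tendsto_intros tendsto_inverse_0)
        moreover have "\<forall>\<^sub>F t in at_infinity. inverse t ^ (?n - triple_weight T) * v $ T = g t $ T"
          unfolding eventually_at_infinity
        proof (intro exI[of _ 1] allI impI)
          fix t :: complex assume "1 \<le> norm t"
          then have "t \<noteq> 0" by auto
          moreover have "?n = (?n - triple_weight T) + triple_weight T" using lt by simp
          then have "t ^ ?n = t ^ (?n - triple_weight T) * t ^ triple_weight T" by (metis power_add)
          ultimately show "inverse t ^ (?n - triple_weight T) * v $ T = g t $ T"
            by (simp add: g_def field_simps power_inverse)
        qed
        ultimately have "((\<lambda>t. g t $ T) \<longlongrightarrow> 0 ^ (?n - triple_weight T) * v $ T) at_infinity"
          by (rule Lim_transform_eventually)
        moreover have "0 ^ (?n - triple_weight T) * v $ T = 0" using lt by (simp add: zero_power)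
        ultimately show ?thesis using False by (simp add: axis_def)
      qed
    qed
  qed
  have ne: "v $ T0 *s ?a \<noteq> 0" using cond by (auto simp: vec_eq_iff axis_def)
  have line_a: "line (v $ T0 *s ?a) = line ?a" using cond by (simp add: line_scale)
  show ?lim
    unfolding limitin_def topspace_proj_classical
  proof (intro conjI allI impI)
    show "line ?a \<in> proj_space"
      unfolding proj_space_def mem_Collect_eq using ne line_a[symmetric] by (intro exI conjI)
    fix U assume U: "openin proj_classical U \<and> line ?a \<in> U"
    then have "open {u. u \<noteq> 0 \<and> line u \<in> U}" unfolding openin_proj_classical by blast
    moreover have "v $ T0 *s ?a \<in> {u. u \<noteq> 0 \<and> line u \<in> U}" using U ne line_a by simp
    ultimately have "\<forall>\<^sub>F t in at_infinity. g t \<in> {u. u \<noteq> 0 \<and> line u \<in> U}"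
      using topological_tendstoD[OF g] by blast
    moreover have "\<forall>\<^sub>F t in at_infinity. (1::real) \<le> norm (t :: complex)"
      unfolding eventually_at_infinity by blast
    ultimately show "\<forall>\<^sub>F t in at_infinity. line (torus_ext t v) \<in> U"
    proof eventually_elim
      case (elim t)
      have "t \<noteq> 0" using elim(2) by auto
      moreover have "g t = inverse (t ^ ?n) *s torus_ext t v"
        by (simp add: g_def torus_ext_def vec_eq_iff)
      ultimately have "line (g t) = line (torus_ext t v)" by (simp add: line_scale)
      then show ?case using elim(1) by simp
    qed
  qed
qed

abbreviation "T_top \<equiv> Abs_mon_triple (XZ, YZ, ZZ)"
abbreviation "T_sing \<equiv> Abs_mon_triple (XZ, YY, YZ)"

lemma mon_less: "i < j \<longleftrightarrow> mon_rank i < mon_rank j"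
  by (simp add: less_mon_def)

lemma Abs_mon_triple_eq:
  "i < j \<Longrightarrow> j < k \<Longrightarrow> i' < j' \<Longrightarrow> j' < k' \<Longrightarrow>
    Abs_mon_triple (i, j, k) = Abs_mon_triple (i', j', k') \<longleftrightarrow> i = i' \<and> j = j' \<and> k = k'"
  by (subst Abs_mon_triple_inject) auto

lemma line_top:
  "line (wedge3 (zW \<bullet>\<^sub>S zW) (zW \<bullet>\<^sub>S yW) (zW \<bullet>\<^sub>S xW)) = line (axis T_top 1)"
proof -
  have "wedge3 (zW \<bullet>\<^sub>S zW) (zW \<bullet>\<^sub>S yW) (zW \<bullet>\<^sub>S xW) = (-1) *s axis T_top 1"
    unfolding vec_eq_iff
  proof
    fix T
    show "wedge3 (zW \<bullet>\<^sub>S zW) (zW \<bullet>\<^sub>S yW) (zW \<bullet>\<^sub>S xW) $ T = ((-1) *s axis T_top 1) $ T"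
    proof (cases T rule: mon_triple_cases)
      case (1 i j k)
      then show ?thesis
        by (cases i; cases j; cases k)
          (simp_all add: wedge3_nth minor3_def axis_def xW_def yW_def zW_def Abs_mon_triple_eq mon_less mon_rank_def)
    qed
  qed
  then show ?thesis using line_scale[of "-1"] by simp
qed

lemma line_sing:
  "line (wedge3 (yW \<bullet>\<^sub>S yW) (yW \<bullet>\<^sub>S zW) (xW \<bullet>\<^sub>S zW)) = line (axis T_sing 1)"
proof -
  have "wedge3 (yW \<bullet>\<^sub>S yW) (yW \<bullet>\<^sub>S zW) (xW \<bullet>\<^sub>S zW) = 1 *s axis T_sing 1"
    unfolding vec_eq_iff
  proof
    fix T
    show "wedge3 (yW \<bullet>\<^sub>S yW) (yW \<bullet>\<^sub>S zW) (xW \<bullet>\<^sub>S zW) $ T = (1 *s axis T_sing 1) $ T"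
    proof (cases T rule: mon_triple_cases)
      case (1 i j k)
      then show ?thesis
        by (cases i; cases j; cases k)
          (simp_all add: wedge3_nth minor3_def axis_def xW_def yW_def zW_def Abs_mon_triple_eq mon_less mon_rank_def)
    qed
  qed
  then show ?thesis using line_scale[of 1] by simp
qed

lemma cell_line_axis:
  "cell (line (axis T0 1)) = {line (minors_wedge R) | R. minors_wedge R \<noteq> 0 \<and> minors_wedge R $ T0 \<noteq> 0 \<and>
     (\<forall>T. T \<noteq> T0 \<and> triple_weight T0 \<le> triple_weight T \<longrightarrow> minors_wedge R $ T = 0)}"
  unfolding cell_def orbit_point_def minors_wedge_torus limitin_torus_iff stable_iff by blast

lemma Yvar_eq: "Yvar = {line (minors_wedge R) | R. minors_wedge R \<noteq> 0}"
  unfolding Yvar_def orbit_point_def stable_iff by blast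

lemma Yvar_proj: "Yvar \<subseteq> proj_space"
  unfolding Yvar_eq proj_space_def by blast

lemma triple_weight_top: "T \<noteq> T_top \<Longrightarrow> triple_weight T < triple_weight T_top"
proof (cases T rule: mon_triple_cases)
  case (1 i j k)
  assume "T \<noteq> T_top"
  with 1 show ?thesis
    by (cases i; cases j; cases k)
      (simp_all add: triple_weight_Abs Abs_mon_triple_eq mon_less mon_rank_def mon_weight_def)
qed

lemma Dvar_eq: "Dvar = {line (minors_wedge R) | R. minors_wedge R \<noteq> 0 \<and> minors_wedge R $ T_top = 0}"
proof -
  have "\<forall>T. T \<noteq> T_top \<and> triple_weight T_top \<le> triple_weight T \<longrightarrow> v $ T = 0" for v :: ext3S2W
    using triple_weight_top by (metis leD)
  then have cell: "cell (line (axis T_top 1)) =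
      {line (minors_wedge R) | R. minors_wedge R \<noteq> 0 \<and> minors_wedge R $ T_top \<noteq> 0}"
    unfolding cell_line_axis by simp
  have top: "(minors_wedge R $ T_top = 0) = (minors_wedge R' $ T_top = 0)"
    if "line (minors_wedge R) = line (minors_wedge R')" "minors_wedge R \<noteq> 0" "minors_wedge R' \<noteq> 0" for R R'
    using homogeneous_poly_line[OF homogeneous_poly_coord that] .
  show ?thesis
    unfolding Dvar_def Yvar_eq line_top cell
  proof (rule set_eqI, rule iffI)
    fix L
    assume "L \<in> {line (minors_wedge R) | R. minors_wedge R \<noteq> 0} -
      {line (minors_wedge R) | R. minors_wedge R \<noteq> 0 \<and> minors_wedge R $ T_top \<noteq> 0}"
    then show "L \<in> {line (minors_wedge R) | R. minors_wedge R \<noteq> 0 \<and> minors_wedge R $ T_top = 0}"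
      by auto
  next
    fix L
    assume "L \<in> {line (minors_wedge R) | R. minors_wedge R \<noteq> 0 \<and> minors_wedge R $ T_top = 0}"
    then obtain R where R: "L = line (minors_wedge R)" "minors_wedge R \<noteq> 0" "minors_wedge R $ T_top = 0"
      by auto
    have "L \<notin> {line (minors_wedge R) | R. minors_wedge R \<noteq> 0 \<and> minors_wedge R $ T_top \<noteq> 0}"
    proof
      assume "L \<in> {line (minors_wedge R) | R. minors_wedge R \<noteq> 0 \<and> minors_wedge R $ T_top \<noteq> 0}"
      then obtain R' where "L = line (minors_wedge R')" "minors_wedge R' \<noteq> 0" "minors_wedge R' $ T_top \<noteq> 0"
        by auto
      with top[of R R'] R show False by simp
    qed
    then show "L \<in> {line (minors_wedge R) | R. minors_wedge R \<noteq> 0} -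
      {line (minors_wedge R) | R. minors_wedge R \<noteq> 0 \<and> minors_wedge R $ T_top \<noteq> 0}"
      using R by auto
  qed
qed

text \<open>The cross product of the rows of the coefficient matrix \<open>Z\<close> of \<open>z\<close>: it spans the kernel of \<open>Z\<close> if
  \<open>Z\<close> has rank 2, and vanishes otherwise.\<close>

definition kernel_vec :: "mat23 \<Rightarrow> complex ^ 3" where
  "kernel_vec R = vector [
     R$1$2$3 * R$2$3$3 - R$1$3$3 * R$2$2$3,
     R$1$3$3 * R$2$1$3 - R$1$1$3 * R$2$3$3,
     R$1$1$3 * R$2$2$3 - R$1$2$3 * R$2$1$3]"

lemma kernel_vec_nth:
  "kernel_vec R $ 1 = minor R 2 3 $ ZZ" "kernel_vec R $ 2 = - minor R 1 3 $ ZZ" "kernel_vec R $ 3 = minor R 1 2 $ ZZ"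
  unfolding kernel_vec_def minor_def by simp_all

definition mat_apply :: "mat23 \<Rightarrow> complex ^ 3 \<Rightarrow> W ^ 2" where
  "mat_apply R n = (\<chi> i. \<Sum>j\<in>UNIV. n $ j *s R $ i $ j)"

lemma mat_apply_nth: "mat_apply R n $ i $ m = n$1 * R$i$1$m + n$2 * R$i$2$m + n$3 * R$i$3$m"
  unfolding mat_apply_def by (simp add: sum_3)

definition det_xy :: "W ^ 2 \<Rightarrow> complex" where
  "det_xy c = c$1$1 * c$2$2 - c$2$1 * c$1$2"

lemma minors_wedge_top: "minors_wedge R $ T_top = det_xy (mat_apply R (kernel_vec R))"
proof -
  have "XZ < YZ" "YZ < ZZ" by (simp_all add: mon_less mon_rank_def)
  then show ?thesis
    unfolding minors_wedge_def det_xy_def mat_apply_nth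
    by (simp add: wedge3_nth minor3_def minor_def kernel_vec_def) algebra
qed

section \<open>Normal forms for the points of the divisor\<close>

text \<open>Its net of quadrics is spanned by \<open>l u\<close>, \<open>l v\<close> and \<open>a v - b u\<close>.\<close>

definition psi :: "W \<Rightarrow> W \<Rightarrow> W \<Rightarrow> W \<Rightarrow> W \<Rightarrow> mat23" where
  "psi l u v a b = vector [vector [a, b, l], vector [u, v, 0]]"

lemma psi_nth [simp]:
  "psi l u v a b $ 1 $ 1 = a" "psi l u v a b $ 1 $ 2 = b" "psi l u v a b $ 1 $ 3 = l"
  "psi l u v a b $ 2 $ 1 = u" "psi l u v a b $ 2 $ 2 = v" "psi l u v a b $ 2 $ 3 = 0"
  unfolding psi_def by simp_all

lemma line_eqI: "w = t *s v \<Longrightarrow> t \<noteq> 0 \<Longrightarrow> line v = line w"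
  using line_scale[of t v] by simp

lemma exists_third_column:
  fixes n :: "complex ^ 3"
  assumes "n \<noteq> 0"
  shows "\<exists>B :: complex ^ 3 ^ 3. det B \<noteq> 0 \<and> (\<forall>i. B $ i $ 3 = n $ i)"
proof -
  consider "n $ 3 \<noteq> 0" | "n $ 2 \<noteq> 0" | "n $ 1 \<noteq> 0"
    using assms by (auto simp: vec_eq_iff forall_3)
  then show ?thesis
  proof cases
    case 1
    then show ?thesis
      by (intro exI[of _ "vector [vector [1, 0, n $ 1], vector [0, 1, n $ 2], vector [0, 0, n $ 3]]"])
        (simp add: det_3 forall_3)
  next
    case 2
    then show ?thesis
      by (intro exI[of _ "vector [vector [1, 0, n $ 1], vector [0, 0, n $ 2], vector [0, 1, n $ 3]]"])
        (simp add: det_3 forall_3)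
  next
    case 3
    then show ?thesis
      by (intro exI[of _ "vector [vector [0, 0, n $ 1], vector [1, 0, n $ 2], vector [0, 1, n $ 3]]"])
        (simp add: det_3 forall_3)
  qed
qed

text \<open>A column operation moves R n into the third column, and a row operation moves the
  combination with coefficients \<alpha>, \<beta> into the second row, whose third entry is then 0.
  The two implications keep track of the z-coefficients.\<close>

lemma psi_normal_form:
  assumes n: "n \<noteq> 0" and ab: "\<alpha> \<noteq> 0 \<or> \<beta> \<noteq> 0"
    and zero: "\<alpha> *s mat_apply R n $ 1 + \<beta> *s mat_apply R n $ 2 = 0"
    and nz: "minors_wedge R \<noteq> 0"
  shows "\<exists>l u v a b. minors_wedge (psi l u v a b) \<noteq> 0 \<and> line (minors_wedge R) = line (minors_wedge (psi l u v a b)) \<and>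
    ((\<forall>i. mat_apply R n $ i $ 3 = 0) \<longrightarrow> l $ 3 = 0) \<and>
    ((\<forall>j. \<alpha> * R $ 1 $ j $ 3 + \<beta> * R $ 2 $ j $ 3 = 0) \<longrightarrow> u $ 3 = 0 \<and> v $ 3 = 0)"
proof -
  obtain B :: "complex ^ 3 ^ 3" where B: "det B \<noteq> 0" "\<And>i. B $ i $ 3 = n $ i"
    using exists_third_column[OF n] by blast
  \<comment> \<open>The conjugates complete the row (\<alpha>, \<beta>) to a matrix whose
    determinant is the sum of the squared norms, without a case distinction.\<close>
  define A :: "complex ^ 2 ^ 2" where "A = vector [vector [cnj \<beta>, - cnj \<alpha>], vector [\<alpha>, \<beta>]]"
  have "det A = of_real ((norm \<beta>)\<^sup>2 + (norm \<alpha>)\<^sup>2)"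
    unfolding A_def det_2 by (simp add: complex_norm_square[symmetric] mult.commute del: of_real_power)
  then have A: "det A \<noteq> 0" using ab by (auto simp del: of_real_add of_real_power)
  define R' where "R' = row_col_op A B R"
  have R': "R' $ i $ j = A $ i $ 1 *s (B $ 1 $ j *s R $ 1 $ 1 + B $ 2 $ j *s R $ 1 $ 2 + B $ 3 $ j *s R $ 1 $ 3)
      + A $ i $ 2 *s (B $ 1 $ j *s R $ 2 $ 1 + B $ 2 $ j *s R $ 2 $ 2 + B $ 3 $ j *s R $ 2 $ 3)" for i j
    unfolding R'_def row_col_op_def by (simp add: sum_2 sum_3 vec_eq_iff algebra_simps)
  have col: "R' $ i $ 3 = A $ i $ 1 *s mat_apply R n $ 1 + A $ i $ 2 *s mat_apply R n $ 2" for i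
    unfolding R' B mat_apply_def by (simp add: sum_3)
  have "R' $ 2 $ 3 = 0" unfolding col using zero by (simp add: A_def)
  then have psi: "R' = psi (R'$1$3) (R'$2$1) (R'$2$2) (R'$1$1) (R'$1$2)"
    by (simp add: vec_eq_iff[of R'] vec_eq_iff[of "R' $ _"] forall_2 forall_3)
  have eq: "minors_wedge R' = (det A ^ 3 * det B ^ 2) *s minors_wedge R"
    unfolding R'_def by (rule minors_wedge_row_col_op)
  have t: "det A ^ 3 * det B ^ 2 \<noteq> 0" using A B by simp
  have "minors_wedge R' \<noteq> 0" unfolding eq using t nz by simp
  moreover have "line (minors_wedge R) = line (minors_wedge R')" by (rule line_eqI[OF eq t])
  moreover have "(\<forall>i. mat_apply R n $ i $ 3 = 0) \<longrightarrow> (R'$1$3) $ 3 = 0" unfolding col by simp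
  moreover have "(R'$2$j) $ 3 = 0" if "\<forall>j. \<alpha> * R $ 1 $ j $ 3 + \<beta> * R $ 2 $ j $ 3 = 0" for j
  proof -
    have "(R'$2$j) $ 3 = B $ 1 $ j * (\<alpha> * R $ 1 $ 1 $ 3 + \<beta> * R $ 2 $ 1 $ 3)
        + B $ 2 $ j * (\<alpha> * R $ 1 $ 2 $ 3 + \<beta> * R $ 2 $ 2 $ 3) + B $ 3 $ j * (\<alpha> * R $ 1 $ 3 $ 3 + \<beta> * R $ 2 $ 3 $ 3)"
      unfolding R' by (simp add: A_def algebra_simps)
    then show ?thesis using that by simp
  qed
  ultimately show ?thesis using psi by metis
qed

lemma binary_quadratic_zero:
  fixes p q r :: complex
  shows "\<exists>s t. (s \<noteq> 0 \<or> t \<noteq> 0) \<and> p * s\<^sup>2 + q * s * t + r * t\<^sup>2 = 0"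
proof (cases "p = 0")
  case True
  then show ?thesis by (intro exI[of _ 1] exI[of _ 0]) simp
next
  case False
  define d where "d = csqrt (q\<^sup>2 - 4 * p * r)"
  have "d\<^sup>2 = q\<^sup>2 - 4 * p * r" unfolding d_def by simp
  then have "p * (d - q)\<^sup>2 + q * (d - q) * (2 * p) + r * (2 * p)\<^sup>2 = 0" by algebra
  then show ?thesis using False by (intro exI[of _ "d - q"] exI[of _ "2 * p"]) simp
qed

lemma orthogonal_pair:
  fixes r :: "complex ^ 3"
  shows "\<exists>m n :: complex ^ 3. dotW r m = 0 \<and> dotW r n = 0 \<and> (\<forall>s t. s *s m + t *s n = 0 \<longrightarrow> s = 0 \<and> t = 0)"
proof -
  consider "r $ 1 \<noteq> 0" | "r $ 2 \<noteq> 0" | "r $ 1 = 0" "r $ 2 = 0" by blast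
  then show ?thesis
  proof cases
    case 1
    then show ?thesis
      by (intro exI[of _ "vector [- r $ 2, r $ 1, 0]"] exI[of _ "vector [- r $ 3, 0, r $ 1]"])
        (simp add: dotW_def vec_eq_iff forall_3)
  next
    case 2
    then show ?thesis
      by (intro exI[of _ "vector [r $ 2, - r $ 1, 0]"] exI[of _ "vector [0, - r $ 3, r $ 2]"])
        (simp add: dotW_def vec_eq_iff forall_3)
  next
    case 3
    then show ?thesis
      by (intro exI[of _ "vector [1, 0, 0]"] exI[of _ "vector [0, 1, 0]"])
        (simp add: dotW_def vec_eq_iff forall_3)
  qed
qed

text \<open>Z has proportional rows. A row that generates the row space serves as r, and a
  combination of the two rows is 0.\<close>

lemma kernel_vec_zero_rows:
  assumes "kernel_vec R = 0"
  shows "\<exists>r. \<forall>n. dotW r n = 0 \<longrightarrow> (\<forall>i. mat_apply R n $ i $ 3 = 0)"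
    and "\<exists>\<alpha> \<beta>. (\<alpha> \<noteq> 0 \<or> \<beta> \<noteq> 0) \<and> (\<forall>j. \<alpha> * R $ 1 $ j $ 3 + \<beta> * R $ 2 $ j $ 3 = 0)"
proof -
  define z where "z = (\<lambda>i j. R $ i $ j $ 3)"
  have k: "z 1 2 * z 2 3 = z 1 3 * z 2 2" "z 1 3 * z 2 1 = z 1 1 * z 2 3" "z 1 1 * z 2 2 = z 1 2 * z 2 1"
    using assms unfolding kernel_vec_def z_def by (simp_all add: vec_eq_iff forall_3)
  have ma: "mat_apply R n $ i $ 3 = n$1 * z i 1 + n$2 * z i 2 + n$3 * z i 3" for n i
    unfolding mat_apply_nth z_def ..
  have par: "z 1 i * z 2 j = z 1 j * z 2 i" for i j
    using k exhaust_3[of i] exhaust_3[of j] by (auto simp: mult.commute)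
  show "\<exists>\<alpha> \<beta>. (\<alpha> \<noteq> 0 \<or> \<beta> \<noteq> 0) \<and> (\<forall>j. \<alpha> * R $ 1 $ j $ 3 + \<beta> * R $ 2 $ j $ 3 = 0)"
  proof (cases "\<forall>j. z 1 j = 0")
    case True
    then show "\<exists>\<alpha> \<beta>. (\<alpha> \<noteq> 0 \<or> \<beta> \<noteq> 0) \<and> (\<forall>j. \<alpha> * R $ 1 $ j $ 3 + \<beta> * R $ 2 $ j $ 3 = 0)"
      by (intro exI[of _ 1] exI[of _ 0]) (simp add: z_def)
  next
    case False
    then obtain i where "z 1 i \<noteq> 0" by blast
    then show "\<exists>\<alpha> \<beta>. (\<alpha> \<noteq> 0 \<or> \<beta> \<noteq> 0) \<and> (\<forall>j. \<alpha> * R $ 1 $ j $ 3 + \<beta> * R $ 2 $ j $ 3 = 0)"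
      using par[of i] by (intro exI[of _ "- z 2 i"] exI[of _ "z 1 i"]) (simp add: z_def mult.commute)
  qed
  show "\<exists>r. \<forall>n. dotW r n = 0 \<longrightarrow> (\<forall>i. mat_apply R n $ i $ 3 = 0)"
  proof (cases "\<forall>j. z 1 j = 0")
    case True
    then show ?thesis
      by (intro exI[of _ "vector [z 2 1, z 2 2, z 2 3]"]) (simp add: ma dotW_def forall_2 mult.commute)
  next
    case False
    then obtain i where i: "z 1 i \<noteq> 0" by blast
    show ?thesis
    proof (intro exI[of _ "vector [z 1 1, z 1 2, z 1 3]"] allI impI)
      fix n i' assume "dotW (vector [z 1 1, z 1 2, z 1 3]) n = 0"
      then have n: "n$1 * z 1 1 + n$2 * z 1 2 + n$3 * z 1 3 = 0" by (simp add: dotW_def mult.commute)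
      have "z 1 i * (n$1 * z 2 1 + n$2 * z 2 2 + n$3 * z 2 3) = z 2 i * (n$1 * z 1 1 + n$2 * z 1 2 + n$3 * z 1 3)"
        using par[of i 1] par[of i 2] par[of i 3] by algebra
      then have "n$1 * z 2 1 + n$2 * z 2 2 + n$3 * z 2 3 = 0" using n i by simp
      then show "mat_apply R n $ i' $ 3 = 0" using n exhaust_2[of i'] unfolding ma by auto
    qed
  qed
qed

text \<open>A nonzero n is sought with Z n = 0 and X n, Y n dependent. A nonzero kernel vector has
  this property. Otherwise the kernel of Z contains a plane, on which the determinant of X n, Y n is
  a binary quadratic form, and such a form has a nontrivial zero.\<close>

lemma Dvar_psi_exists:
  assumes nz: "minors_wedge R \<noteq> 0" and top: "minors_wedge R $ T_top = 0"
  shows "\<exists>l u v a b. minors_wedge (psi l u v a b) \<noteq> 0 \<and> line (minors_wedge R) = line (minors_wedge (psi l u v a b)) \<and> l $ 3 = 0"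
proof -
  obtain n where n: "n \<noteq> 0" "\<forall>i. mat_apply R n $ i $ 3 = 0" "det_xy (mat_apply R n) = 0"
  proof (cases "kernel_vec R = 0")
    case False
    have "\<forall>i. mat_apply R (kernel_vec R) $ i $ 3 = 0"
      unfolding forall_2 mat_apply_nth kernel_vec_def by (simp add: algebra_simps)
    then show ?thesis using that False top unfolding minors_wedge_top by blast
  next
    case True
    obtain r where r: "\<And>n. dotW r n = 0 \<Longrightarrow> \<forall>i. mat_apply R n $ i $ 3 = 0"
      using kernel_vec_zero_rows(1)[OF True] by blast
    obtain m m' where m: "dotW r m = 0" "dotW r m' = 0" "\<And>s t. s *s m + t *s m' = 0 \<Longrightarrow> s = 0 \<and> t = 0"
      using orthogonal_pair[of r] by blast
    define M where "M = mat_apply R m"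
    define M' where "M' = mat_apply R m'"
    have comb: "mat_apply R (s *s m + t *s m') $ i $ j = s * M $ i $ j + t * M' $ i $ j" for s t i j
      unfolding mat_apply_nth M_def M'_def by (simp add: algebra_simps)
    obtain s t where st: "s \<noteq> 0 \<or> t \<noteq> 0"
      "(M$1$1 * M$2$2 - M$2$1 * M$1$2) * s\<^sup>2
        + (M$1$1 * M'$2$2 + M'$1$1 * M$2$2 - M$2$1 * M'$1$2 - M'$2$1 * M$1$2) * s * t
        + (M'$1$1 * M'$2$2 - M'$2$1 * M'$1$2) * t\<^sup>2 = 0"
      using binary_quadratic_zero by blast
    have "det_xy (mat_apply R (s *s m + t *s m')) = 0"
      using st(2) unfolding det_xy_def comb by algebra
    moreover have "s *s m + t *s m' \<noteq> 0" using m(3) st(1) by blast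
    moreover have "dotW r (s *s m + t *s m') = 0" using m(1,2) by simp
    ultimately show ?thesis using that r by blast
  qed
  define c where "c = mat_apply R n"
  \<comment> \<open>The two entries of R n lie in the span of x and y and have determinant 0; their
    dependence is the row operation.\<close>
  have "\<exists>\<alpha> \<beta>. (\<alpha> \<noteq> 0 \<or> \<beta> \<noteq> 0) \<and> \<alpha> *s c $ 1 + \<beta> *s c $ 2 = 0"
  proof -
    have c3: "c $ 1 $ 3 = 0" "c $ 2 $ 3 = 0" using n(2) unfolding c_def by auto
    have d: "c$1$1 * c$2$2 = c$2$1 * c$1$2" using n(3) unfolding c_def det_xy_def by simp
    consider "c$1$1 \<noteq> 0" | "c$1$2 \<noteq> 0" | "c$1$1 = 0" "c$1$2 = 0" by blast
    then show ?thesis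
    proof cases
      case 1
      then show ?thesis using d c3
        by (intro exI[of _ "- c$2$1"] exI[of _ "c$1$1"]) (simp add: vec_eq_iff forall_3 mult.commute)
    next
      case 2
      then show ?thesis using d c3
        by (intro exI[of _ "- c$2$2"] exI[of _ "c$1$2"]) (simp add: vec_eq_iff forall_3 mult.commute)
    next
      case 3
      then show ?thesis using c3 by (intro exI[of _ 1] exI[of _ 0]) (simp add: vec_eq_iff forall_3)
    qed
  qed
  then obtain \<alpha> \<beta> where "\<alpha> \<noteq> 0 \<or> \<beta> \<noteq> 0" "\<alpha> *s mat_apply R n $ 1 + \<beta> *s mat_apply R n $ 2 = 0"
    unfolding c_def by blast
  from psi_normal_form[OF n(1) this nz] n(2) show ?thesis by blast
qed

lemma minors_wedge_psi_top: "l $ 3 = 0 \<Longrightarrow> minors_wedge (psi l u v a b) $ T_top = 0"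
  unfolding minors_wedge_top det_xy_def mat_apply_nth kernel_vec_def by simp

lemma Dvar_psi: "Dvar = {line (minors_wedge (psi l u v a b)) | l u v a b. l $ 3 = 0 \<and> minors_wedge (psi l u v a b) \<noteq> 0}"
  (is "_ = ?S")
proof
  show "Dvar \<subseteq> ?S"
  proof
    fix L assume "L \<in> Dvar"
    then obtain R where R: "L = line (minors_wedge R)" "minors_wedge R \<noteq> 0" "minors_wedge R $ T_top = 0"
      unfolding Dvar_eq by blast
    from Dvar_psi_exists[OF R(2,3)] show "L \<in> ?S" using R(1) by blast
  qed
  show "?S \<subseteq> Dvar" unfolding Dvar_eq using minors_wedge_psi_top by blast
qed

text \<open>The nets of quadrics through the point \<open>x = y = 0\<close>; this will be the singular locus.\<close>

definition sing_points :: "ext3S2W set set" where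
  "sing_points = {line (minors_wedge R) | R. minors_wedge R \<noteq> 0 \<and> kernel_vec R = 0}"

text \<open>As Z has rank at most 1, some combination w of the rows is free of z. Its three entries
  lie in the plane spanned by x and y, so a nontrivial n annihilates them; R n becomes the third
  column.\<close>

lemma sing_points_psi:
  "sing_points = {line (minors_wedge (psi l u v a b)) | l u v a b. u $ 3 = 0 \<and> v $ 3 = 0 \<and> minors_wedge (psi l u v a b) \<noteq> 0}"
  (is "_ = ?S")
proof
  show "sing_points \<subseteq> ?S"
  proof
    fix L assume "L \<in> sing_points"
    then obtain R where R: "L = line (minors_wedge R)" "minors_wedge R \<noteq> 0" "kernel_vec R = 0"
      unfolding sing_points_def by blast
    obtain \<alpha> \<beta> where ab: "\<alpha> \<noteq> 0 \<or> \<beta> \<noteq> 0" "\<forall>j. \<alpha> * R $ 1 $ j $ 3 + \<beta> * R $ 2 $ j $ 3 = 0"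
      using kernel_vec_zero_rows(2)[OF R(3)] by blast
    define w where "w = (\<lambda>j. \<alpha> *s R $ 1 $ j + \<beta> *s R $ 2 $ j)"
    define r r' :: W where "r = vector [w 1 $ 1, w 2 $ 1, w 3 $ 1]" and "r' = vector [w 1 $ 2, w 2 $ 2, w 3 $ 2]"
    obtain m m' where m: "dotW r m = 0" "dotW r m' = 0" "\<And>s t. s *s m + t *s m' = 0 \<Longrightarrow> s = 0 \<and> t = 0"
      using orthogonal_pair[of r] by blast
    obtain s t where st: "s \<noteq> 0 \<or> t \<noteq> 0" "s * dotW r' m + t * dotW r' m' = 0"
    proof (cases "dotW r' m = 0")
      case True then show ?thesis using that[of 1 0] by simp
    next
      case False then show ?thesis using that[of "- dotW r' m'" "dotW r' m"] by (simp add: mult.commute)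
    qed
    define n where "n = s *s m + t *s m'"
    have n: "n \<noteq> 0" "dotW r n = 0" "dotW r' n = 0" using m st unfolding n_def by auto
    have "\<alpha> *s mat_apply R n $ 1 + \<beta> *s mat_apply R n $ 2 = 0"
    proof -
      have "(\<alpha> *s mat_apply R n $ 1 + \<beta> *s mat_apply R n $ 2) $ i = n$1 * w 1 $ i + n$2 * w 2 $ i + n$3 * w 3 $ i" for i
        by (simp add: mat_apply_nth w_def algebra_simps)
      moreover have "w j $ 3 = 0" for j using ab(2) by (simp add: w_def)
      ultimately show ?thesis
        using n(2,3) by (simp add: vec_eq_iff forall_3 r_def r'_def dotW_def mult.commute)
    qed
    from psi_normal_form[OF n(1) ab(1) this R(2)] ab(2) show "L \<in> ?S" using R(1) by blast
  qed
  have "kernel_vec (psi l u v a b) = 0" if "u $ 3 = 0" "v $ 3 = 0" for l u v a b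
    using that unfolding kernel_vec_def by (simp add: vec_eq_iff forall_3)
  then show "?S \<subseteq> sing_points" unfolding sing_points_def by blast
qed

section \<open>Irreducibility of Y, of the divisor and of its singular locus\<close>

definition mat_coords :: "(mat23 \<Rightarrow> complex) set" where
  "mat_coords = {\<lambda>R. R $ i $ j $ m | i j m. True}"

lemma polyfun_mat_coord: "polyfun mat_coords (\<lambda>R. R $ i $ j $ m)"
  unfolding mat_coords_def by (intro polyfun_coord) blast

lemma polyfun_minors_wedge: "polyfun mat_coords (\<lambda>R. minors_wedge R $ T)"
proof -
  have m: "polyfun mat_coords (\<lambda>R. minor R p q $ m)" for p q m
    by (cases m) (auto simp: minor_def intro!: polyfun_diff polyfun_add polyfun_mult polyfun_mat_coord)
  show ?thesis
    by (cases T rule: mon_triple_cases)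
      (auto simp: minors_wedge_def wedge3_nth minor3_def intro!: polyfun_diff polyfun_add polyfun_mult m)
qed

lemma polynomial_on_lines_linear:
  assumes "\<And>u w s. p (u + s *\<^sub>R w) = p u + complex_of_real s * p w"
  shows "polynomial_on_lines p"
  unfolding polynomial_on_lines_def assms by (blast intro: polynomial_on_affine[of 1])

lemma prime_locus_minors_wedge:
  fixes \<Phi> :: "'a::real_vector \<Rightarrow> mat23"
  assumes "\<And>i j m. polynomial_on_lines (\<lambda>x. \<Phi> x $ i $ j $ m)" "minors_wedge (\<Phi> x0) \<noteq> 0"
  shows "prime_locus {line (minors_wedge (\<Phi> x)) | x. minors_wedge (\<Phi> x) \<noteq> 0}"
  using assms
  by (intro prime_locus_image[of "\<lambda>x. minors_wedge (\<Phi> x)"] polynomial_on_lines_polyfun[OF polyfun_minors_wedge])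
    (auto simp: mat_coords_def)

text \<open>The net of x^2, xz, yz, a sample point for the families that parametrise Y and the
  singular locus.\<close>

lemma minors_wedge_psi_monomial:
  "minors_wedge (psi zW xW yW 0 (- xW)) \<noteq> 0"
proof -
  have "XX < XZ" "XZ < YZ" by (simp_all add: mon_less mon_rank_def)
  then have "minors_wedge (psi zW xW yW 0 (- xW)) $ Abs_mon_triple (XX, XZ, YZ) \<noteq> 0"
    unfolding minors_wedge_def by (simp add: wedge3_nth minor3_def minor_def xW_def yW_def zW_def axis_def)
  then show ?thesis by auto
qed

lemma prime_locus_Yvar: "prime_locus Yvar"
  unfolding Yvar_eq
  by (rule prime_locus_minors_wedge[where \<Phi> = "\<lambda>R. R", OF _ minors_wedge_psi_monomial])
    (rule polynomial_on_lines_linear, simp add: scaleR_conv_of_real[where 'a = complex])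

lemma psi_entry_linear:
  fixes l p q a b :: "'a::real_vector \<Rightarrow> W"
  assumes "\<And>u w s. l (u + s *\<^sub>R w) = l u + s *\<^sub>R l w" "\<And>u w s. p (u + s *\<^sub>R w) = p u + s *\<^sub>R p w"
    "\<And>u w s. q (u + s *\<^sub>R w) = q u + s *\<^sub>R q w" "\<And>u w s. a (u + s *\<^sub>R w) = a u + s *\<^sub>R a w"
    "\<And>u w s. b (u + s *\<^sub>R w) = b u + s *\<^sub>R b w"
  shows "polynomial_on_lines (\<lambda>x. psi (l x) (p x) (q x) (a x) (b x) $ i $ j $ m)"
  using assms exhaust_2[of i] exhaust_3[of j]
  by (intro polynomial_on_lines_linear) (auto simp: scaleR_conv_of_real[where 'a = complex])


lemma prime_locus_psi:
  fixes l p q a b :: "'a::real_vector \<Rightarrow> W"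
  assumes "\<And>u w s. l (u + s *\<^sub>R w) = l u + s *\<^sub>R l w" "\<And>u w s. p (u + s *\<^sub>R w) = p u + s *\<^sub>R p w"
    "\<And>u w s. q (u + s *\<^sub>R w) = q u + s *\<^sub>R q w" "\<And>u w s. a (u + s *\<^sub>R w) = a u + s *\<^sub>R a w"
    "\<And>u w s. b (u + s *\<^sub>R w) = b u + s *\<^sub>R b w"
    and "minors_wedge (psi (l x0) (p x0) (q x0) (a x0) (b x0)) \<noteq> 0"
  shows "prime_locus {line (minors_wedge (psi (l x) (p x) (q x) (a x) (b x))) | x.
    minors_wedge (psi (l x) (p x) (q x) (a x) (b x)) \<noteq> 0}"
  by (rule prime_locus_minors_wedge[where \<Phi> = "\<lambda>x. psi (l x) (p x) (q x) (a x) (b x)"])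
    (rule psi_entry_linear assms)+

definition plane_xy :: "complex \<times> complex \<Rightarrow> W" where
  "plane_xy c = vector [fst c, snd c, 0]"

lemma plane_xy_linear: "plane_xy (c + s *\<^sub>R d) = plane_xy c + s *\<^sub>R plane_xy d"
  unfolding plane_xy_def by (simp add: vec_eq_iff forall_3)

lemma plane_xy_iff: "l $ 3 = 0 \<longleftrightarrow> (\<exists>c. l = plane_xy c)"
proof
  assume "l $ 3 = 0"
  then have "l = plane_xy (l $ 1, l $ 2)" unfolding plane_xy_def by (simp add: vec_eq_iff forall_3)
  then show "\<exists>c. l = plane_xy c" ..
qed (auto simp: plane_xy_def)

lemma prime_locus_Dvar: "prime_locus Dvar"
proof -
  have "Dvar = {line (minors_wedge (psi (plane_xy (fst x)) (fst (snd x)) (fst (snd (snd x))) (fst (snd (snd (snd x)))) (snd (snd (snd (snd x)))))) | x.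
      minors_wedge (psi (plane_xy (fst x)) (fst (snd x)) (fst (snd (snd x))) (fst (snd (snd (snd x)))) (snd (snd (snd (snd x))))) \<noteq> 0}"
    unfolding Dvar_psi plane_xy_iff by (force simp del: psi_nth)
  also have "prime_locus \<dots>"
  proof (rule prime_locus_psi[where ?x0.0 = "((0, 1), xW, zW, 0, - xW)"])
    have "XX < XY" "XY < YZ" by (simp_all add: mon_less mon_rank_def)
    then have "minors_wedge (psi (plane_xy (0, 1)) xW zW 0 (- xW)) $ Abs_mon_triple (XX, XY, YZ) \<noteq> 0"
      unfolding minors_wedge_def by (simp add: wedge3_nth minor3_def minor_def xW_def zW_def axis_def plane_xy_def)
    then show "minors_wedge (psi (plane_xy (fst ((0, 1), xW, zW, 0, - xW))) (fst (snd ((0, 1), xW, zW, 0, - xW)))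
      (fst (snd (snd ((0, 1), xW, zW, 0, - xW)))) (fst (snd (snd (snd ((0, 1), xW, zW, 0, - xW)))))
      (snd (snd (snd (snd ((0, 1), xW, zW, 0, - xW)))))) \<noteq> 0" by auto
  qed (simp_all add: plane_xy_linear)
  finally show ?thesis .
qed

lemma prime_locus_sing_points: "prime_locus sing_points"
proof -
  have "sing_points = {line (minors_wedge (psi (fst x) (plane_xy (fst (snd x))) (plane_xy (fst (snd (snd x)))) (fst (snd (snd (snd x)))) (snd (snd (snd (snd x)))))) | x.
      minors_wedge (psi (fst x) (plane_xy (fst (snd x))) (plane_xy (fst (snd (snd x)))) (fst (snd (snd (snd x)))) (snd (snd (snd (snd x))))) \<noteq> 0}"
    unfolding sing_points_psi plane_xy_iff by (force simp del: psi_nth)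
  also have "prime_locus \<dots>"
  proof (rule prime_locus_psi[where ?x0.0 = "(zW, (1, 0), (0, 1), 0, - xW)"])
    have "plane_xy (1, 0) = xW" "plane_xy (0, 1) = yW"
      unfolding plane_xy_def xW_def yW_def by (simp_all add: vec_eq_iff forall_3 axis_def)
    then show "minors_wedge (psi (fst (zW, (1, 0), (0, 1), 0, - xW)) (plane_xy (fst (snd (zW, (1, 0), (0, 1), 0, - xW))))
      (plane_xy (fst (snd (snd (zW, (1, 0), (0, 1), 0, - xW))))) (fst (snd (snd (snd (zW, (1, 0), (0, 1), 0, - xW)))))
      (snd (snd (snd (snd (zW, (1, 0), (0, 1), 0, - xW)))))) \<noteq> 0"
      using minors_wedge_psi_monomial by simp
  qed (simp_all add: plane_xy_linear)
  finally show ?thesis .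
qed

section \<open>The nets of quadrics through a fixed point\<close>

text \<open>Cramer's rule: where the columns i, j, k are independent, column m is their combination
  with the other three minors as coefficients, up to sign and a common factor.\<close>

lemma minor3_cramer:
  assumes "minor3 a b c i j k \<noteq> 0" "minor3 a b c i j m = 0" "minor3 a b c i k m = 0" "minor3 a b c j k m = 0"
  shows "a $ m = 0" "b $ m = 0" "c $ m = 0"
proof -
  have "u $ m * minor3 a b c i j k = u $ k * minor3 a b c i j m - u $ j * minor3 a b c i k m + u $ i * minor3 a b c j k m"
    if "u = a \<or> u = b \<or> u = c" for u
    using that unfolding minor3_def by (elim disjE) (simp_all add: algebra_simps)
  from this[of a] this[of b] this[of c] show "a $ m = 0" "b $ m = 0" "c $ m = 0"
    using assms by simp_all
qed

lemma kernel_vec_eq_0_iff: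
  "kernel_vec R = 0 \<longleftrightarrow> minor R 1 2 $ ZZ = 0 \<and> minor R 1 3 $ ZZ = 0 \<and> minor R 2 3 $ ZZ = 0"
  unfolding vec_eq_iff[of "kernel_vec R"] forall_3 kernel_vec_nth by auto

lemma kernel_vec_zero_coord:
  assumes "kernel_vec R = 0" "i < j" "j < ZZ"
  shows "minors_wedge R $ Abs_mon_triple (i, j, ZZ) = 0"
  using assms unfolding minors_wedge_def wedge3_nth[OF assms(2,3)] kernel_vec_eq_0_iff minor3_def by simp

text \<open>Some Pluecker coordinate is nonzero, and it cannot involve \<open>ZZ\<close>. Cramer's
  rule then shows that the \<open>ZZ\<close> coefficient of each minor is 0.\<close>

lemma kernel_vec_zeroI:
  assumes "minors_wedge R \<noteq> 0"
    and "\<And>i j. i < j \<Longrightarrow> j < ZZ \<Longrightarrow> minors_wedge R $ Abs_mon_triple (i, j, ZZ) = 0"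
  shows "kernel_vec R = 0"
proof -
  obtain T where T: "minors_wedge R $ T \<noteq> 0" using assms(1) by (auto simp: vec_eq_iff)
  obtain i j k where ijk: "T = Abs_mon_triple (i, j, k)" "i < j" "j < k" by (rule mon_triple_cases)
  have k: "k < ZZ"
  proof (cases "k = ZZ")
    case True then show ?thesis using assms(2)[of i j] T ijk by simp
  next
    case False
    then show ?thesis by (cases k) (simp_all add: mon_less mon_rank_def)
  qed
  have "minor3 (minor R 1 2) (minor R 1 3) (minor R 2 3) i j k \<noteq> 0"
    using T wedge3_nth[OF ijk(2,3)] unfolding ijk(1) minors_wedge_def by simp
  moreover have "minor3 (minor R 1 2) (minor R 1 3) (minor R 2 3) p q ZZ = 0" if "p < q" "q < ZZ" for p q
    using assms(2)[OF that] wedge3_nth[OF that] unfolding minors_wedge_def by simp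
  ultimately show ?thesis
    unfolding kernel_vec_eq_0_iff using minor3_cramer[of _ _ _ i j k ZZ] ijk k
    by (meson less_trans)
qed

text \<open>\<open>T_sing\<close> has weight 9, and it is the only triple without \<open>ZZ\<close>
  that reaches this weight. So the cell condition concerns triples with \<open>ZZ\<close> only; by
  Cramer's rule, the three that share two monomials with \<open>T_sing\<close> already force the
  kernel vector to vanish.\<close>

lemma cell_sing:
  "cell (line (axis T_sing 1)) = {line (minors_wedge R) | R. minors_wedge R \<noteq> 0 \<and> kernel_vec R = 0 \<and> minors_wedge R $ T_sing \<noteq> 0}"
proof -
  have lt: "XZ < YY" "YY < YZ" "YZ < ZZ" by (simp_all add: mon_less mon_rank_def)
  have "(\<forall>T. T \<noteq> T_sing \<and> triple_weight T_sing \<le> triple_weight T \<longrightarrow> minors_wedge R $ T = 0) \<longleftrightarrow> kernel_vec R = 0"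
    if nz: "minors_wedge R $ T_sing \<noteq> 0" for R
  proof
    assume *: "\<forall>T. T \<noteq> T_sing \<and> triple_weight T_sing \<le> triple_weight T \<longrightarrow> minors_wedge R $ T = 0"
    have z: "minor3 (minor R 1 2) (minor R 1 3) (minor R 2 3) p q ZZ = 0"
      if "(p, q) \<in> {(XZ, YY), (XZ, YZ), (YY, YZ)}" for p q
    proof -
      have pq: "p < q" "q < ZZ" using that by (auto simp: mon_less mon_rank_def)
      have "minors_wedge R $ Abs_mon_triple (p, q, ZZ) = 0"
        using that lt
        by (intro *[rule_format]) (auto simp: Abs_mon_triple_eq triple_weight_Abs mon_less mon_rank_def mon_weight_def)
      then show ?thesis using wedge3_nth[OF pq] unfolding minors_wedge_def by simp
    qed
    have "minor3 (minor R 1 2) (minor R 1 3) (minor R 2 3) XZ YY YZ \<noteq> 0"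
      using nz wedge3_nth[OF lt(1,2)] unfolding minors_wedge_def by simp
    from minor3_cramer[OF this, of ZZ] z show "kernel_vec R = 0"
      unfolding kernel_vec_eq_0_iff by simp
  next
    assume k: "kernel_vec R = 0"
    show "\<forall>T. T \<noteq> T_sing \<and> triple_weight T_sing \<le> triple_weight T \<longrightarrow> minors_wedge R $ T = 0"
    proof (intro allI impI)
      fix T assume T: "T \<noteq> T_sing \<and> triple_weight T_sing \<le> triple_weight T"
      obtain i j l where ijk: "T = Abs_mon_triple (i, j, l)" "i < j" "j < l" by (rule mon_triple_cases)
      have "l = ZZ"
        using T ijk lt
        by (cases i; cases j; cases l)
          (simp_all add: Abs_mon_triple_eq triple_weight_Abs mon_less mon_rank_def mon_weight_def)
      then show "minors_wedge R $ T = 0" using kernel_vec_zero_coord[OF k] ijk by simp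
    qed
  qed
  then show ?thesis unfolding cell_line_axis by blast
qed

lemma sing_points_subset_Dvar: "sing_points \<subseteq> Dvar"
proof -
  have "minors_wedge R $ T_top = 0" if "kernel_vec R = 0" for R
    using kernel_vec_zero_coord[OF that, of XZ YZ] by (simp add: mon_less mon_rank_def)
  then show ?thesis unfolding sing_points_def Dvar_eq by blast
qed

lemma Dvar_subset_Yvar: "Dvar \<subseteq> Yvar"
  unfolding Dvar_eq Yvar_eq by blast

text \<open>The vanishing of the kernel vector is expressed by Pluecker coordinates, hence
  independent of the representing matrix.\<close>

lemma sing_pointsD:
  assumes "line (minors_wedge R) \<in> sing_points" "minors_wedge R \<noteq> 0"
  shows "kernel_vec R = 0"
proof -
  obtain R' where R': "line (minors_wedge R) = line (minors_wedge R')" "minors_wedge R' \<noteq> 0" "kernel_vec R' = 0"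
    using assms(1) unfolding sing_points_def by blast
  show ?thesis
  proof (rule kernel_vec_zeroI[OF assms(2)])
    fix i j assume "i < j" "j < ZZ"
    then show "minors_wedge R $ Abs_mon_triple (i, j, ZZ) = 0"
      using kernel_vec_zero_coord[OF R'(3)] homogeneous_poly_line[OF homogeneous_poly_coord R'(1) assms(2) R'(2)] by blast
  qed
qed

lemma vanishes_on_lines:
  assumes "homogeneous_poly d f"
  shows "vanishes_on f {line (F x) | x. F x \<noteq> 0 \<and> P x} \<longleftrightarrow> (\<forall>x. F x \<noteq> 0 \<and> P x \<longrightarrow> f (F x) = 0)"
  using homogeneous_poly_line[OF assms] unfolding vanishes_on_def by blast

text \<open>The cell is the part of \<open>sing_points\<close> where the coordinate
  \<open>T_sing\<close> is nonzero, thus dense by irreducibility; and \<open>sing_points\<close> is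
  closed in Y, being cut out by the coordinates that involve \<open>ZZ\<close>.\<close>

lemma closure_cell_sing:
  "subtopology zariski Yvar closure_of cell (line (wedge3 (yW \<bullet>\<^sub>S yW) (yW \<bullet>\<^sub>S zW) (xW \<bullet>\<^sub>S zW))) = sing_points"
proof -
  let ?C = "{line (minors_wedge R) | R. minors_wedge R \<noteq> 0 \<and> kernel_vec R = 0 \<and> minors_wedge R $ T_sing \<noteq> 0}"
  have CY: "?C \<subseteq> Yvar" unfolding Yvar_eq by blast
  have "zariski_closure_in Yvar ?C = sing_points"
  proof
    show "sing_points \<subseteq> zariski_closure_in Yvar ?C"
    proof -
      have "vanishes_on f sing_points" if f: "homogeneous_poly d f" "vanishes_on f ?C" for d f
      proof -
        have "vanishes_on (\<lambda>v. f v * v $ T_sing) sing_points"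
          using f(2) vanishes_on_lines[OF f(1), of minors_wedge "\<lambda>R. kernel_vec R = 0 \<and> minors_wedge R $ T_sing \<noteq> 0"]
          unfolding sing_points_def vanishes_on_lines[OF homogeneous_poly_mult[OF f(1) homogeneous_poly_coord]]
          by (metis mult_eq_0_iff)
        moreover have "\<not> vanishes_on (\<lambda>v. v $ T_sing) sing_points"
        proof
          assume "vanishes_on (\<lambda>v. v $ T_sing) sing_points"
          moreover have "XZ < YY" "YY < YZ" by (simp_all add: mon_less mon_rank_def)
          \<comment> \<open>This is the fixed point of the cell, the net of y^2, yz, xz.\<close>
          then have nz: "minors_wedge (psi zW xW yW yW 0) $ T_sing \<noteq> 0"
            unfolding minors_wedge_def
            by (simp add: wedge3_nth minor3_def minor_def xW_def yW_def zW_def axis_def)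
          moreover have "kernel_vec (psi zW xW yW yW 0) = 0"
            unfolding kernel_vec_def by (simp add: vec_eq_iff forall_3 xW_def yW_def axis_def)
          ultimately show False
            unfolding sing_points_def vanishes_on_lines[OF homogeneous_poly_coord]
            by (metis zero_index)
        qed
        ultimately show ?thesis
          using prime_locusD[OF prime_locus_sing_points f(1) homogeneous_poly_coord] by blast
      qed
      then show ?thesis
        using sing_points_subset_Dvar Dvar_subset_Yvar unfolding zariski_closure_in_def vanishes_on_def by blast
    qed
    show "zariski_closure_in Yvar ?C \<subseteq> sing_points"
    proof
      fix L assume L: "L \<in> zariski_closure_in Yvar ?C"
      then obtain R where R: "L = line (minors_wedge R)" "minors_wedge R \<noteq> 0"
        unfolding zariski_closure_in_def Yvar_eq by blast
      have "kernel_vec R = 0"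
      proof (rule kernel_vec_zeroI[OF R(2)])
        fix i j assume "i < j" "j < ZZ"
        then have "vanishes_on (\<lambda>v. v $ Abs_mon_triple (i, j, ZZ)) ?C"
          unfolding vanishes_on_lines[OF homogeneous_poly_coord] using kernel_vec_zero_coord by blast
        then have "vanishes_on (\<lambda>v. v $ Abs_mon_triple (i, j, ZZ)) {L}"
          using L homogeneous_poly_coord unfolding zariski_closure_in_def by blast
        then show "minors_wedge R $ Abs_mon_triple (i, j, ZZ) = 0"
          unfolding R(1) vanishes_on_line[OF homogeneous_poly_coord R(2)] .
      qed
      then show "L \<in> sing_points" unfolding sing_points_def using R by blast
    qed
  qed
  then show ?thesis
    unfolding line_sing cell_sing zariski_closure_of[OF Yvar_proj CY] .
qed

section \<open>A dense affine chart of Y and bounds for chains\<close>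

lemma polynomial_on_mult_le:
  "polynomial_on \<iota> d f \<Longrightarrow> polynomial_on \<iota> e g \<Longrightarrow> d + e \<le> n \<Longrightarrow> polynomial_on \<iota> n (\<lambda>s. f s * g s)"
  using polynomial_on_mult polynomial_on_mono by blast

lemma polynomial_on_minors_wedge:
  assumes "\<And>i j m. polynomial_on \<iota> 1 (\<lambda>s. \<Phi> s $ i $ j $ m)"
  shows "polynomial_on \<iota> 6 (\<lambda>s. minors_wedge (\<Phi> s) $ T)"
proof -
  have e: "polynomial_on \<iota> 2 (\<lambda>s. \<Phi> s $ i $ j $ m * \<Phi> s $ i' $ j' $ m')" for i j m i' j' m'
    by (rule polynomial_on_mult_le[OF assms assms]) simp
  have m: "polynomial_on \<iota> 2 (\<lambda>s. minor (\<Phi> s) p q $ m)" for p q m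
    by (cases m) (auto simp: minor_def intro!: polynomial_on_diff polynomial_on_add e)
  have mm: "polynomial_on \<iota> 4 (\<lambda>s. minor (\<Phi> s) p q $ m * minor (\<Phi> s) p' q' $ m')" for p q m p' q' m'
    by (rule polynomial_on_mult_le[OF m m]) simp
  have mmm: "polynomial_on \<iota> 6 (\<lambda>s. minor (\<Phi> s) p'' q'' $ m'' * g s)" if "polynomial_on \<iota> 4 g" for p'' q'' m'' g
    by (rule polynomial_on_mult_le[OF m that]) simp
  show ?thesis
    by (cases T rule: mon_triple_cases)
      (auto simp: minors_wedge_def wedge3_nth minor3_def intro!: polynomial_on_diff polynomial_on_add mmm mm)
qed

interpretation std: frame xW yW zW xW yW zW
  by standard (simp_all add: dotW_def xW_def yW_def zW_def axis_def)

definition std_chart :: "(2 \<times> 3 \<Rightarrow> complex) \<Rightarrow> ext3S2W" where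
  "std_chart u = minors_wedge (std.chart (\<chi> p. case p of None \<Rightarrow> 1 | Some q \<Rightarrow> u q))"

lemma polynomial_on_std_chart: "polynomial_on (\<lambda>s. s) 6 (\<lambda>s. std_chart (u(q := s)) $ T)"
  unfolding std_chart_def
proof (rule polynomial_on_minors_wedge)
  fix i :: 2 and j m :: 3
  have a: "polynomial_on (\<lambda>s. s) 1 (\<lambda>s. a + (u(q := s)) p * b)" for a b p
    using polynomial_on_affine[of 1 "\<lambda>s. s" a b] polynomial_on_const[of "\<lambda>s. s" 1 "a + u p * b"]
    by (cases "p = q") auto
  from a[of 0] have a0: "polynomial_on (\<lambda>s. s) 1 (\<lambda>s. (u(q := s)) p * b)" for b p by simp
  show "polynomial_on (\<lambda>s. s) 1 (\<lambda>s. std.chart (\<chi> p. case p of None \<Rightarrow> 1 | Some p \<Rightarrow> (u(q := s)) p) $ i $ j $ m)"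
    using exhaust_2[of i] exhaust_3[of j] a a0 unfolding std.chart_def
    by (elim disjE) (simp_all del: fun_upd_apply)
qed

text \<open>The chart covers the points of Y with nonzero leading coordinate. A form vanishing on
  the chart vanishes on Y after multiplication by this coordinate, which irreducibility of Y
  cancels.\<close>

lemma std_chart_dense:
  assumes "homogeneous_poly d f" "\<And>u. f (std_chart u) = 0"
  shows "vanishes_on f Yvar"
proof -
  have hom: "homogeneous_poly 1 (std.chart_coord None)"
    unfolding std.chart_coord_def[abs_def] using homogeneous_pluecker by simp
  have "f (minors_wedge R) * std.chart_coord None (minors_wedge R) = 0" for R
  proof (cases "std.chart_coord None (minors_wedge R) = 0")
    case False
    then obtain c t where c: "c $ None = 1" "minors_wedge R = t *s minors_wedge (std.chart c)"
      using std.chart_surjective by blast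
    have "(\<chi> p. case p of None \<Rightarrow> 1 | Some q \<Rightarrow> c $ Some q) = c"
      using c(1) by (auto simp: vec_eq_iff split: option.split)
    then have "f (minors_wedge (std.chart c)) = 0"
      using assms(2)[of "\<lambda>q. c $ Some q"] unfolding std_chart_def by simp
    then show ?thesis unfolding c(2) homogeneous_poly_scale[OF assms(1)] by simp
  qed simp
  then have "vanishes_on (\<lambda>v. f v * std.chart_coord None v) Yvar"
    unfolding Yvar_eq using vanishes_on_lines[OF homogeneous_poly_mult[OF assms(1) hom], of minors_wedge "\<lambda>_. True"]
    by simp
  moreover have "\<not> vanishes_on (std.chart_coord None) Yvar"
  proof
    assume v: "vanishes_on (std.chart_coord None) Yvar"
    define c :: "complex ^ ((2 \<times> 3) option)" where "c = (\<chi> p. 1)"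
    have "std.chart_coord None (minors_wedge (std.chart c)) = 1"
      unfolding std.chart_coord_chart c_def by simp
    moreover from this have "minors_wedge (std.chart c) \<noteq> 0"
      using homogeneous_poly_scale[OF hom, of 0 0] by auto
    ultimately show False
      using v vanishes_on_lines[OF hom, of minors_wedge "\<lambda>_. True"] unfolding Yvar_eq by auto
  qed
  ultimately show ?thesis
    using prime_locusD[OF prime_locus_Yvar assms(1) hom] by blast
qed

lemma Yvar_chain_length:
  assumes "\<And>i. i \<le> n \<Longrightarrow> prime_locus (S i)" "\<And>i. i \<le> n \<Longrightarrow> S i \<subseteq> Yvar" "\<And>i. i < n \<Longrightarrow> S i \<subseteq> S (Suc i)"
    "\<And>i. i < n \<Longrightarrow> separated (S i) (S (Suc i))"
  shows "n \<le> 6"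
  using chain_length_le[of 6 std_chart Yvar n S, OF polynomial_on_std_chart std_chart_dense assms(1-3) Yvar_proj assms(4)]
  by simp

lemma not_vanishes_on_Yvar: "separated Dvar Yvar"
proof (intro exI conjI)
  show "homogeneous_poly 1 (\<lambda>v :: ext3S2W. v $ T_top)" by (rule homogeneous_poly_coord)
  show "vanishes_on (\<lambda>v. v $ T_top) Dvar"
    unfolding Dvar_eq vanishes_on_lines[OF homogeneous_poly_coord] by blast
  show "\<not> vanishes_on (\<lambda>v. v $ T_top) Yvar"
  proof
    assume "vanishes_on (\<lambda>v. v $ T_top) Yvar"
    moreover have "XZ < YZ" "YZ < ZZ" by (simp_all add: mon_less mon_rank_def)
    \<comment> \<open>The net of z^2, zy, zx, the fixed point of the open cell.\<close>
    then have "minors_wedge (psi zW zW xW 0 (- yW)) $ T_top \<noteq> 0"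
      unfolding minors_wedge_def by (simp add: wedge3_nth minor3_def minor_def xW_def yW_def zW_def axis_def)
    moreover from this have "minors_wedge (psi zW zW xW 0 (- yW)) \<noteq> 0" by auto
    ultimately show False unfolding Yvar_eq vanishes_on_def by blast
  qed
qed

lemma not_vanishes_on_Dvar:
  "separated sing_points Dvar"
proof (intro exI conjI)
  let ?T = "Abs_mon_triple (XY, XZ, ZZ)"
  have lt: "XY < XZ" "XZ < ZZ" by (simp_all add: mon_less mon_rank_def)
  show "homogeneous_poly 1 (\<lambda>v :: ext3S2W. v $ ?T)" by (rule homogeneous_poly_coord)
  show "vanishes_on (\<lambda>v. v $ ?T) sing_points"
    unfolding sing_points_def vanishes_on_lines[OF homogeneous_poly_coord]
    using kernel_vec_zero_coord lt by blast
  show "\<not> vanishes_on (\<lambda>v. v $ ?T) Dvar"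
  proof
    assume "vanishes_on (\<lambda>v. v $ ?T) Dvar"
    moreover have "minors_wedge (psi xW zW yW 0 (- zW)) $ ?T \<noteq> 0"
      unfolding minors_wedge_def using lt
      by (simp add: wedge3_nth minor3_def minor_def xW_def yW_def zW_def axis_def)
    moreover from this have "minors_wedge (psi xW zW yW 0 (- zW)) \<noteq> 0" by auto
    moreover have "xW $ 3 = 0" by (simp add: xW_def axis_def)
    ultimately show False unfolding Dvar_psi vanishes_on_def by blast
  qed
qed

lemma Dvar_proj: "Dvar \<subseteq> proj_space"
  using Dvar_subset_Yvar Yvar_proj by blast

lemma sing_points_proj: "sing_points \<subseteq> proj_space"
  using sing_points_subset_Dvar Dvar_proj by blast

lemma strict_form_subset:
  assumes "separated A B" "Z \<subseteq> A"
  shows "separated Z B"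
  using assms vanishes_on_subset by blast

text \<open>A chain in the divisor can be prolonged by Y, so the bound 6 for Y drops by one.\<close>

lemma Dvar_chain_length:
  assumes "irreducible_closed_chain (subtopology zariski Dvar) n Z"
  shows "n \<le> 5"
proof -
  note ch = irreducible_closed_chainD[OF assms Dvar_proj]
  have ZY: "i \<le> n \<Longrightarrow> Z i \<subseteq> Yvar" for i using ch(2) Dvar_subset_Yvar by blast
  have "Suc n \<le> 6"
  proof (rule Yvar_chain_length[of _ "\<lambda>i. if i \<le> n then Z i else Yvar"])
    fix i assume "i < Suc n"
    then consider "i < n" | "i = n" by linarith
    then show "separated (if i \<le> n then Z i else Yvar) (if Suc i \<le> n then Z (Suc i) else Yvar)"
      by cases (use ch(4) strict_form_subset[OF not_vanishes_on_Yvar ch(2)] in auto)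
  qed (use ch(1,3) ZY prime_locus_Yvar in \<open>simp_all add: not_le less_Suc_eq\<close>)
  then show ?thesis by simp
qed

text \<open>Here the chain is prolonged twice, by the divisor and by Y.\<close>

lemma sing_points_chain_length:
  assumes "irreducible_closed_chain (subtopology zariski sing_points) n Z"
  shows "n \<le> 4"
proof -
  note ch = irreducible_closed_chainD[OF assms sing_points_proj]
  have ZD: "i \<le> n \<Longrightarrow> Z i \<subseteq> Dvar" and ZY: "i \<le> n \<Longrightarrow> Z i \<subseteq> Yvar" for i
    using ch(2) sing_points_subset_Dvar Dvar_subset_Yvar by blast+
  have "Suc (Suc n) \<le> 6"
  proof (rule Yvar_chain_length[of _ "\<lambda>i. if i \<le> n then Z i else if i = Suc n then Dvar else Yvar"])
    fix i assume "i < Suc (Suc n)"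
    then consider "i < n" | "i = n" | "i = Suc n" by linarith
    then show "separated (if i \<le> n then Z i else if i = Suc n then Dvar else Yvar) (if Suc i \<le> n then Z (Suc i) else if Suc i = Suc n then Dvar else Yvar)"
      by cases (use ch(4) strict_form_subset[OF not_vanishes_on_Dvar ch(2)] not_vanishes_on_Yvar in auto)
  qed (use ch(1,3) ZD ZY Dvar_subset_Yvar prime_locus_Yvar prime_locus_Dvar in
      \<open>auto simp: not_le less_Suc_eq\<close>)
  then show ?thesis by simp
qed

lemma Dvar_krull_dim_at_le: "krull_dim_at (subtopology zariski Dvar) L \<le> 5"
  unfolding krull_dim_at_def
proof (rule Sup_least)
  fix x assume "x \<in> {enat n | n. \<exists>Z. irreducible_closed_chain (subtopology zariski Dvar) n Z \<and> L \<in> Z 0}"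
  then obtain n where n: "x = enat n" "n \<le> 5" using Dvar_chain_length by blast
  then have "x \<le> enat 5" by simp
  then show "x \<le> 5" by (simp add: numeral_eq_enat)
qed

lemma sing_points_krull_dim_le: "krull_dim (subtopology zariski sing_points) \<le> 4"
  unfolding krull_dim_def
proof (rule Sup_least)
  fix x assume "x \<in> {enat n | n. \<exists>Z. irreducible_closed_chain (subtopology zariski sing_points) n Z}"
  then obtain n where n: "x = enat n" "n \<le> 4" using sing_points_chain_length by blast
  then have "x \<le> enat 4" by simp
  then show "x \<le> 4" by (simp add: numeral_eq_enat)
qed

section \<open>Tangent spaces and differentials\<close>

definition vec_coords :: "(complex ^ 'n::finite \<Rightarrow> complex) set" where
  "vec_coords = range (\<lambda>k v. v $ k)"

lemma homogeneous_has_differential: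
  assumes "homogeneous_poly d f"
  obtains D where "has_differential vec_coords f D"
    and "\<And>v a b w1 w2. D v (a *s w1 + b *s w2) = a * D v w1 + b * D v w2"
proof -
  have "polyfun vec_coords (\<lambda>v. f v)"
    by (rule polyfun_homogeneous[OF assms]) (rule polyfun_coord, simp add: vec_coords_def)
  from polyfun_differential[OF this] obtain D where D: "has_differential vec_coords f D"
    "\<forall>v a b w1 w2 w3. (\<forall>c\<in>vec_coords. c w3 = a * c w1 + b * c w2) \<longrightarrow> D v w3 = a * D v w1 + b * D v w2"
    by blast
  have "D v (a *s w1 + b *s w2) = a * D v w1 + b * D v w2" for v a b w1 w2
    by (rule D(2)[rule_format]) (auto simp: vec_coords_def)
  then show ?thesis using that D(1) by blast
qed

lemma has_differential_curve:
  assumes "has_differential vec_coords f D" "\<And>k. ((\<lambda>s. \<gamma> s $ k) has_field_derivative w $ k) (at 0)" "\<gamma> 0 = v"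
  shows "((\<lambda>s. f (\<gamma> s)) has_field_derivative D v w) (at 0)"
proof -
  have "\<forall>c\<in>vec_coords. ((\<lambda>s. c (\<gamma> s)) has_field_derivative c w) (at 0)"
    using assms(2) unfolding vec_coords_def by simp
  then show ?thesis
    using assms(1,3) unfolding has_differential_def by metis
qed

lemma has_differential_line:
  assumes "has_differential vec_coords f D"
  shows "((\<lambda>s. f (v + s *s w)) has_field_derivative D v w) (at 0)"
  by (rule has_differential_curve[OF assms]) (auto intro!: derivative_eq_intros)

lemma has_differential_unique:
  assumes "has_differential vec_coords f D" "has_differential vec_coords f E"
  shows "D v w = E v w"
  by (rule DERIV_unique[OF has_differential_line[OF assms(1)] has_differential_line[OF assms(2)]])

text \<open>Homogeneity carries the condition from one vector of the line to all others: f (c v + s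
  w) = c^d f (v + (s / c) w).\<close>

lemma mem_cone_tangent_space_iff:
  assumes "v \<noteq> 0"
  shows "w \<in> cone_tangent_space S (line v) \<longleftrightarrow>
    (\<forall>d f D. homogeneous_poly d f \<and> vanishes_on f S \<and> has_differential vec_coords f D \<longrightarrow> D v w = 0)"
    (is "_ \<longleftrightarrow> ?rhs")
proof
  assume w: "w \<in> cone_tangent_space S (line v)"
  show ?rhs
  proof (intro allI impI)
    fix d f D
    assume f: "homogeneous_poly d f \<and> vanishes_on f S \<and> has_differential vec_coords f D"
    have "v \<in> line v - {0}" using assms unfolding line_def by (simp add: vec.span_base)
    then have "((\<lambda>s. f (v + s *s w)) has_field_derivative 0) (at 0)"
      using w[unfolded cone_tangent_space_def mem_Collect_eq, rule_format, of d f v]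
        f[unfolded vanishes_on_def] by simp
    with has_differential_line[OF conjunct2[OF conjunct2[OF f]]] show "D v w = 0"
      by (rule DERIV_unique)
  qed
next
  assume rhs: ?rhs
  show "w \<in> cone_tangent_space S (line v)"
    unfolding cone_tangent_space_def mem_Collect_eq
  proof (intro allI impI ballI)
    fix d f u
    assume "homogeneous_poly d f \<and> (\<forall>u. u \<noteq> 0 \<and> line u \<in> S \<longrightarrow> f u = 0)" and u: "u \<in> line v - {0}"
    then have f: "homogeneous_poly d f" "vanishes_on f S" unfolding vanishes_on_def by simp_all
    obtain D where D: "has_differential vec_coords f D" by (rule homogeneous_has_differential[OF f(1)])
    then have "D v w = 0" using rhs f by blast
    obtain c where c: "u = c *s v" "c \<noteq> 0" using u by (auto simp: mem_line_iff)
    have "((\<lambda>s. f (v + s *s w)) has_field_derivative 0) (at (inverse c * 0))"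
      using has_differential_line[OF D, of v w] \<open>D v w = 0\<close> by simp
    then have "((\<lambda>s. f (v + (inverse c * s) *s w)) has_field_derivative 0 * inverse c) (at 0)"
      by (rule DERIV_chain2) (rule DERIV_cmult_Id)
    then have "((\<lambda>s. c ^ d * f (v + (inverse c * s) *s w)) has_field_derivative c ^ d * (0 * inverse c)) (at 0)"
      by (rule DERIV_cmult)
    moreover have "c ^ d * f (v + (inverse c * s) *s w) = f (u + s *s w)" for s
    proof -
      have "u + s *s w = c *s (v + (inverse c * s) *s w)"
        using c by (simp add: vec_eq_iff field_simps)
      then show ?thesis by (simp only: homogeneous_poly_scale[OF f(1)])
    qed
    ultimately show "((\<lambda>s. f (u + s *s w)) has_field_derivative 0) (at 0)" by simp
  qed
qed

lemma subspace_cone_tangent_space: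
  assumes "v \<noteq> 0"
  shows "vec.subspace (cone_tangent_space S (line v))"
proof -
  have lin: "a *s w1 + b *s w2 \<in> cone_tangent_space S (line v)"
    if w: "w1 \<in> cone_tangent_space S (line v)" "w2 \<in> cone_tangent_space S (line v)" for a b w1 w2
    unfolding mem_cone_tangent_space_iff[OF assms]
  proof (intro allI impI)
    fix d f D
    assume f: "homogeneous_poly d f \<and> vanishes_on f S \<and> has_differential vec_coords f D"
    then have 0: "D v w1 = 0" "D v w2 = 0" using w unfolding mem_cone_tangent_space_iff[OF assms] by blast+
    obtain E where E: "has_differential vec_coords f E"
      "\<And>v a b w1 w2. E v (a *s w1 + b *s w2) = a * E v w1 + b * E v w2"
      using homogeneous_has_differential f by blast
    have "D v w = E v w" for w
      using has_differential_unique f E(1) by blast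
    then show "D v (a *s w1 + b *s w2) = 0" using 0 E(2) by simp
  qed
  have "0 \<in> cone_tangent_space S (line v)"
    unfolding cone_tangent_space_def by simp
  then show ?thesis
    unfolding vec.subspace_def using lin[of _ _ 1 1] lin[of _ 0 _ 0] by simp
qed

lemma cone_tangent_space_mono: "S \<subseteq> T \<Longrightarrow> cone_tangent_space S L \<subseteq> cone_tangent_space T L"
  unfolding cone_tangent_space_def by blast

section \<open>Differentials on the space of matrices\<close>

definition mat_lincomb :: "complex \<Rightarrow> mat23 \<Rightarrow> complex \<Rightarrow> mat23 \<Rightarrow> mat23" where
  "mat_lincomb a R b R' = (\<chi> i j. a *s R $ i $ j + b *s R' $ i $ j)"

lemma mat_lincomb_nth [simp]: "mat_lincomb a R b R' $ i $ j = a *s R $ i $ j + b *s R' $ i $ j"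
  unfolding mat_lincomb_def by simp

lemma mat_eqI: "(\<And>i j m. R $ i $ j $ m = R' $ i $ j $ m) \<Longrightarrow> R = (R' :: mat23)"
  by (simp add: vec_eq_iff)

lemma mat_polyfun_has_differential:
  assumes "polyfun mat_coords F"
  obtains D where "has_differential mat_coords F D"
    and "\<And>R a b R1 R2. D R (mat_lincomb a R1 b R2) = a * D R R1 + b * D R R2"
    and "\<And>R'. polyfun mat_coords (\<lambda>R. D R R')"
proof -
  from polyfun_differential[OF assms] obtain D where D: "has_differential mat_coords F D"
    "\<forall>v a b w1 w2 w3. (\<forall>c\<in>mat_coords. c w3 = a * c w1 + b * c w2) \<longrightarrow> D v w3 = a * D v w1 + b * D v w2"
    "\<And>R'. polyfun mat_coords (\<lambda>R. D R R')"
    by blast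
  have "D R (mat_lincomb a R1 b R2) = a * D R R1 + b * D R R2" for R a b R1 R2
    by (rule D(2)[rule_format]) (auto simp: mat_coords_def)
  then show ?thesis using that D by blast
qed

lemma mat_has_differential_curve:
  assumes "has_differential mat_coords F D"
    "\<And>i j m. ((\<lambda>s. \<rho> s $ i $ j $ m) has_field_derivative R' $ i $ j $ m) (at 0)" "\<rho> 0 = R"
  shows "((\<lambda>s. F (\<rho> s)) has_field_derivative D R R') (at 0)"
proof -
  have "\<forall>c\<in>mat_coords. ((\<lambda>s. c (\<rho> s)) has_field_derivative c R') (at 0)"
    using assms(2) unfolding mat_coords_def by auto
  then show ?thesis
    using assms(1,3) unfolding has_differential_def by metis
qed

lemma mat_has_differential_line:
  assumes "has_differential mat_coords F D"
  shows "((\<lambda>s. F (mat_lincomb 1 R s R')) has_field_derivative D R R') (at 0)"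
  by (rule mat_has_differential_curve[OF assms])
    (auto intro!: derivative_eq_intros simp: mat_lincomb_def vec_eq_iff)

lemma mat_has_differential_unique:
  assumes "has_differential mat_coords F D" "has_differential mat_coords F E"
  shows "D R R' = E R R'"
  by (rule DERIV_unique[OF mat_has_differential_line[OF assms(1)] mat_has_differential_line[OF assms(2)]])

definition dminors :: "mat23 \<Rightarrow> mat23 \<Rightarrow> ext3S2W" where
  "dminors R R' = (\<chi> T. deriv (\<lambda>s. minors_wedge (mat_lincomb 1 R s R') $ T) 0)"

lemma has_differential_minors: "has_differential mat_coords (\<lambda>R. minors_wedge R $ T) (\<lambda>R R'. dminors R R' $ T)"
proof -
  obtain D where D: "has_differential mat_coords (\<lambda>R. minors_wedge R $ T) D"
    by (rule mat_polyfun_has_differential[OF polyfun_minors_wedge])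
  have "dminors R R' $ T = D R R'" for R R'
    unfolding dminors_def vec_lambda_beta by (rule DERIV_imp_deriv[OF mat_has_differential_line[OF D]])
  then show ?thesis using D unfolding has_differential_def by (simp only:)
qed

lemma dminors_linear: "dminors R (mat_lincomb a R1 b R2) = a *s dminors R R1 + b *s dminors R R2"
proof (rule vec_eq_iff[THEN iffD2], rule allI)
  fix T
  obtain D where D: "has_differential mat_coords (\<lambda>R. minors_wedge R $ T) D"
    "\<And>R a b R1 R2. D R (mat_lincomb a R1 b R2) = a * D R R1 + b * D R R2"
    by (rule mat_polyfun_has_differential[OF polyfun_minors_wedge]) blast
  have "dminors R R' $ T = D R R'" for R R'
    by (rule mat_has_differential_unique[OF has_differential_minors D(1)])
  then show "dminors R (mat_lincomb a R1 b R2) $ T = (a *s dminors R R1 + b *s dminors R R2) $ T"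
    using D(2) by simp
qed

text \<open>By the chain rule, tangency can be tested on the matrix side, where the pulled back form
  is a polynomial in the entries.\<close>

lemma dminors_tangentI:
  assumes nz: "minors_wedge R \<noteq> 0"
    and zero: "\<And>d f D. homogeneous_poly d f \<Longrightarrow> vanishes_on f S \<Longrightarrow>
      has_differential mat_coords (\<lambda>R. f (minors_wedge R)) D \<Longrightarrow> D R R' = 0"
  shows "dminors R R' \<in> cone_tangent_space S (line (minors_wedge R))"
  unfolding mem_cone_tangent_space_iff[OF nz]
proof (intro allI impI)
  fix d f D
  assume f: "homogeneous_poly d f \<and> vanishes_on f S \<and> has_differential vec_coords f D"
  have "polyfun mat_coords (\<lambda>R. f (minors_wedge R))"
    by (rule polyfun_homogeneous[OF conjunct1[OF f] polyfun_minors_wedge])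
  then obtain E where E: "has_differential mat_coords (\<lambda>R. f (minors_wedge R)) E"
    by (rule mat_polyfun_has_differential)
  have "((\<lambda>s. f (minors_wedge (mat_lincomb 1 R s R'))) has_field_derivative D (minors_wedge R) (dminors R R')) (at 0)"
  proof (rule has_differential_curve)
    show "has_differential vec_coords f D" using f by blast
    show "((\<lambda>s. minors_wedge (mat_lincomb 1 R s R') $ T) has_field_derivative dminors R R' $ T) (at 0)" for T
      by (rule mat_has_differential_line[OF has_differential_minors])
    show "minors_wedge (mat_lincomb 1 R 0 R') = minors_wedge R"
      by (rule arg_cong[of _ _ minors_wedge]) (simp add: mat_lincomb_def vec_eq_iff)
  qed
  then have "D (minors_wedge R) (dminors R R') = E R R'"
    by (rule DERIV_unique[OF _ mat_has_differential_line[OF E]])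
  then show "D (minors_wedge R) (dminors R R') = 0"
    using zero[OF conjunct1[OF f] conjunct1[OF conjunct2[OF f]] E] by simp
qed

lemma Dvar_form_zero:
  assumes "homogeneous_poly d f" "vanishes_on f Dvar" "minors_wedge R $ T_top = 0"
  shows "f (minors_wedge R) = 0"
proof (cases "minors_wedge R = 0")
  \<comment> \<open>The zero vector gives no point of the divisor, but homogeneity carries the
    vanishing of f from a vector over the divisor to 0, also in degree 0.\<close>
  case True
  obtain L where "L \<in> Dvar" using prime_locus_Dvar unfolding prime_locus_def by blast
  then obtain v where v: "v \<noteq> 0" "line v \<in> Dvar" using Dvar_proj unfolding proj_space_def by blast
  then have "f v = 0" using assms(2) unfolding vanishes_on_def by blast
  moreover have "f (0 *s v) = 0 ^ d * f v" by (rule homogeneous_poly_scale[OF assms(1)])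
  ultimately show ?thesis using True by simp
next
  case False
  then show ?thesis using assms(2,3) unfolding vanishes_on_def Dvar_eq by blast
qed

section \<open>Tangent vectors at regular points\<close>

text \<open>If the equation of \<open>Dvar\<close> is affine in some direction \<open>E\<close> with non-vanishing slope, every tangent
  direction of the equation integrates to a curve in \<open>Dvar\<close>: move along the line and correct along \<open>E\<close>.\<close>

lemma dminors_tangent_Dvar_affine:
  assumes nz: "minors_wedge R \<noteq> 0" and top: "minors_wedge R $ T_top = 0" and dtop: "dminors R R' $ T_top = 0"
    and C: "polyfun mat_coords C" "C R \<noteq> 0"
    and affine: "\<And>R \<tau>. minors_wedge (mat_lincomb 1 R \<tau> E) $ T_top = minors_wedge R $ T_top + \<tau> * C R"
  shows "dminors R R' \<in> cone_tangent_space Dvar (line (minors_wedge R))"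
proof (rule dminors_tangentI[OF nz])
  fix d f D
  assume f: "homogeneous_poly d f" "vanishes_on f Dvar"
    and D: "has_differential mat_coords (\<lambda>R. f (minors_wedge R)) D"
  define l where "l = (\<lambda>s. mat_lincomb 1 R s R')"
  \<comment> \<open>\<open>\<tau>\<close> solves the affine equation along E, so the corrected curve
    \<open>\<rho>\<close> satisfies the equation of the divisor near s = 0. Its derivative at 0 is
    0, as the equation vanishes to first order at R along R'; hence \<open>\<rho>\<close> still has
    velocity R'.\<close>
  define \<tau> where "\<tau> = (\<lambda>s. - minors_wedge (l s) $ T_top / C (l s))"
  define \<rho> where "\<rho> = (\<lambda>s. mat_lincomb 1 (l s) (\<tau> s) E)"
  have l0: "l 0 = R" unfolding l_def by (simp add: mat_lincomb_def vec_eq_iff)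
  obtain DC where "has_differential mat_coords C DC"
    by (rule mat_polyfun_has_differential[OF C(1)])
  from mat_has_differential_line[OF this] have dC: "((\<lambda>s. C (l s)) has_field_derivative DC R R') (at 0)"
    unfolding l_def .
  have "((\<lambda>s. minors_wedge (l s) $ T_top) has_field_derivative 0) (at 0)"
    using mat_has_differential_line[OF has_differential_minors[of T_top], of R R'] unfolding l_def dtop .
  then have "(\<tau> has_field_derivative (- 0 * C (l 0) - - minors_wedge (l 0) $ T_top * DC R R') / (C (l 0) * C (l 0))) (at 0)"
    unfolding \<tau>_def using C(2) l0 dC by (intro DERIV_divide DERIV_minus) auto
  then have d\<tau>: "(\<tau> has_field_derivative 0) (at 0)" using top l0 by simp
  have \<tau>0: "\<tau> 0 = 0" unfolding \<tau>_def l0 top by simp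
  have "((\<lambda>s. f (minors_wedge (\<rho> s))) has_field_derivative D R R') (at 0)"
  proof (rule mat_has_differential_curve[OF D])
    show "\<rho> 0 = R" unfolding \<rho>_def \<tau>0 l0 by (simp add: mat_lincomb_def vec_eq_iff)
    show "((\<lambda>s. \<rho> s $ i $ j $ m) has_field_derivative R' $ i $ j $ m) (at 0)" for i j m
      unfolding \<rho>_def l_def using d\<tau> by (auto intro!: derivative_eq_intros)
  qed
  moreover have "((\<lambda>s. f (minors_wedge (\<rho> s))) has_field_derivative 0) (at 0)"
  proof (rule DERIV_cong_ev[THEN iffD2, OF refl _ refl])
    have "((\<lambda>s. C (l s)) \<longlongrightarrow> C R) (nhds 0)"
      using DERIV_isCont[OF dC] l0 by (simp add: continuous_at_imp_continuous_at_within isCont_def tendsto_nhds_iff)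
    then have "\<forall>\<^sub>F s in nhds 0. C (l s) \<noteq> 0"
      using C(2) by (rule tendsto_imp_eventually_ne)
    then show "\<forall>\<^sub>F s in nhds 0. f (minors_wedge (\<rho> s)) = 0"
    proof eventually_elim
      case (elim s)
      then have "minors_wedge (\<rho> s) $ T_top = 0" unfolding \<rho>_def affine \<tau>_def by simp
      then show ?case by (rule Dvar_form_zero[OF f])
    qed
  qed simp
  ultimately show "D R R' = 0" by (rule DERIV_unique)
qed

text \<open>If R n were 0, a column operation would produce a zero column, and two of the three
  minors would vanish.\<close>

lemma mat_apply_kernel_nonzero:
  assumes "minors_wedge R \<noteq> 0" "n \<noteq> 0"
  shows "mat_apply R n \<noteq> 0"
proof
  assume z: "mat_apply R n = 0"
  obtain B :: "complex ^ 3 ^ 3" where B: "det B \<noteq> 0" "\<And>i. B $ i $ 3 = n $ i"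
    using exists_third_column[OF assms(2)] by blast
  define R' where "R' = row_col_op (mat 1) B R"
  have "R' $ i $ 3 = mat_apply R n $ i" for i
    using exhaust_2[of i] unfolding R'_def row_col_op_def mat_apply_def
    by (auto simp: sum_2 sum_3 B mat_def vec_eq_iff)
  then have "minor R' p 3 = 0" for p using z unfolding minor_def by (simp add: sym_mult_linear)
  then have "minors_wedge R' = 0"
    unfolding minors_wedge_def vec_eq_iff
    by (auto intro: mon_triple_cases simp: wedge3_def det_3)
  then show False
    using minors_wedge_row_col_op[of "mat 1" B R] B assms(1) unfolding R'_def by simp
qed

definition unit_mat :: "2 \<Rightarrow> 3 \<Rightarrow> 3 \<Rightarrow> mat23" where
  "unit_mat i0 j0 m0 = (\<chi> i j. if i = i0 \<and> j = j0 then axis m0 1 else 0)"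

lemma unit_mat_nth: "unit_mat i0 j0 m0 $ i $ j $ m = (if i = i0 \<and> j = j0 \<and> m = m0 then 1 else 0)"
  unfolding unit_mat_def by (auto simp: axis_def)

text \<open>The kernel vector involves only z-coefficients. Changing an x- or y-coefficient in a
  column where it is nonzero therefore changes one entry of the 2 by 2 determinant and no other; the
  slope is a multiple of the cofactor, and stability keeps some entry nonzero.\<close>

lemma minors_wedge_top_affine:
  fixes j0 :: 3
  assumes "minors_wedge R \<noteq> 0" "kernel_vec R \<noteq> 0"
  shows "\<exists>E C. polyfun mat_coords C \<and> C R \<noteq> 0 \<and>
    (\<forall>R \<tau>. minors_wedge (mat_lincomb 1 R \<tau> E) $ T_top = minors_wedge R $ T_top + \<tau> * C R)"
proof -
  obtain j0 where j0: "kernel_vec R $ j0 \<noteq> 0" using assms(2) by (auto simp: vec_eq_iff)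
  define c where "c = (\<lambda>R i m. mat_apply R (kernel_vec R) $ i $ m)"
  have k: "kernel_vec (mat_lincomb 1 R \<tau> (unit_mat i0 j0 m0)) = kernel_vec R" if "m0 \<noteq> 3" for R \<tau> i0 m0
    using that unfolding kernel_vec_def by (simp add: unit_mat_nth vec_eq_iff forall_3)
  have c: "c (mat_lincomb 1 R \<tau> (unit_mat i0 j0 m0)) i m = c R i m + (if i = i0 \<and> m = m0 then \<tau> * kernel_vec R $ j0 else 0)"
    if "m0 \<noteq> 3" for R \<tau> i0 m0 i m
    unfolding c_def k[OF that] mat_apply_nth mat_lincomb_nth using exhaust_3[of j0]
    by (auto simp: unit_mat_nth algebra_simps)
  have H: "minors_wedge R $ T_top = c R 1 1 * c R 2 2 - c R 2 1 * c R 1 2" for R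
    unfolding minors_wedge_top det_xy_def c_def ..
  have pk: "polyfun mat_coords (\<lambda>R. kernel_vec R $ j)" for j
    using exhaust_3[of j] unfolding kernel_vec_def
    by (elim disjE) (simp_all add: polyfun_diff polyfun_mult polyfun_mat_coord)
  have pc: "polyfun mat_coords (\<lambda>R. c R i m)" for i m
    unfolding c_def mat_apply_nth by (intro polyfun_add polyfun_mult pk polyfun_mat_coord)
  have "c R i 3 = 0" for i
    using exhaust_2[of i] unfolding c_def mat_apply_nth kernel_vec_def by (auto simp: algebra_simps)
  moreover have "mat_apply R (kernel_vec R) \<noteq> 0" by (rule mat_apply_kernel_nonzero[OF assms])
  ultimately consider "c R 2 2 \<noteq> 0" | "c R 1 2 \<noteq> 0" | "c R 1 1 \<noteq> 0" | "c R 2 1 \<noteq> 0"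
    unfolding c_def vec_eq_iff forall_2 forall_3 by auto
  then show ?thesis
  proof cases
    case 1
    show ?thesis
      by (rule exI[of _ "unit_mat 1 j0 1"], rule exI[of _ "\<lambda>R. kernel_vec R $ j0 * c R 2 2"])
        (use 1 j0 in \<open>auto simp: H c algebra_simps intro!: polyfun_mult pk pc\<close>)
  next
    case 2
    show ?thesis
      by (rule exI[of _ "unit_mat 2 j0 1"], rule exI[of _ "\<lambda>R. -1 * (kernel_vec R $ j0 * c R 1 2)"])
        (use 2 j0 in \<open>auto simp: H c algebra_simps intro!: polyfun_mult[OF polyfun_const[of _ "-1"], simplified] polyfun_mult pk pc\<close>)
  next
    case 3
    show ?thesis
      by (rule exI[of _ "unit_mat 2 j0 2"], rule exI[of _ "\<lambda>R. kernel_vec R $ j0 * c R 1 1"])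
        (use 3 j0 in \<open>auto simp: H c algebra_simps intro!: polyfun_mult pk pc\<close>)
  next
    case 4
    show ?thesis
      by (rule exI[of _ "unit_mat 1 j0 2"], rule exI[of _ "\<lambda>R. -1 * (kernel_vec R $ j0 * c R 2 1)"])
        (use 4 j0 in \<open>auto simp: H c algebra_simps intro!: polyfun_mult[OF polyfun_const[of _ "-1"], simplified] polyfun_mult pk pc\<close>)
  qed
qed

lemma dminors_tangent_Dvar_regular:
  assumes "minors_wedge R \<noteq> 0" "kernel_vec R \<noteq> 0" "minors_wedge R $ T_top = 0" "dminors R R' $ T_top = 0"
  shows "dminors R R' \<in> cone_tangent_space Dvar (line (minors_wedge R))"
proof -
  obtain E C where "polyfun mat_coords C" "C R \<noteq> 0"
    "\<And>R \<tau>. minors_wedge (mat_lincomb 1 R \<tau> E) $ T_top = minors_wedge R $ T_top + \<tau> * C R"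
    using minors_wedge_top_affine[OF assms(1,2)] by auto
  then show ?thesis by (rule dminors_tangent_Dvar_affine[OF assms(1,3,4)])
qed

lemma dminors_top_nonzero:
  assumes "minors_wedge R \<noteq> 0" "kernel_vec R \<noteq> 0"
  shows "\<exists>E. dminors R E $ T_top \<noteq> 0"
proof -
  obtain E C where C: "C R \<noteq> 0"
    "\<And>R \<tau>. minors_wedge (mat_lincomb 1 R \<tau> E) $ T_top = minors_wedge R $ T_top + \<tau> * C R"
    using minors_wedge_top_affine[OF assms(1,2)] by auto
  have "((\<lambda>\<tau>. minors_wedge R $ T_top + \<tau> * C R) has_field_derivative C R) (at 0)"
    by (auto intro!: derivative_eq_intros)
  then have "((\<lambda>\<tau>. minors_wedge (mat_lincomb 1 R \<tau> E) $ T_top) has_field_derivative C R) (at 0)"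
    unfolding C(2) .
  with mat_has_differential_line[OF has_differential_minors] have "dminors R E $ T_top = C R"
    by (rule DERIV_unique)
  then show ?thesis using C(1) by metis
qed

section \<open>Tangent vectors at singular points\<close>

text \<open>Rank at most 1 is not a linear condition on Z, so the locus is parametrised by a vector
  space on which polynomial identities can be used.\<close>

definition with_rank_one :: "mat23 \<times> (complex ^ 2) \<times> (complex ^ 3) \<Rightarrow> mat23" where
  "with_rank_one \<theta> = (case \<theta> of (R, a, b) \<Rightarrow>
     (\<chi> i j. \<chi> m. if m = 3 then a $ i * b $ j else R $ i $ j $ m))"

lemma with_rank_one_nth:
  "with_rank_one (R, a, b) $ i $ j $ m = (if m = 3 then a $ i * b $ j else R $ i $ j $ m)"
  unfolding with_rank_one_def by simp

lemma rank_one_kernel_vec: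
  assumes "\<And>i j. R $ i $ j $ 3 = a $ i * b $ j"
  shows "kernel_vec R = 0"
  unfolding kernel_vec_def assms by (simp add: vec_eq_iff forall_3)

lemma kernel_vec_rank_one:
  assumes "kernel_vec R = 0"
  shows "\<exists>a b. R = with_rank_one (R, a, b)"
proof -
  obtain \<alpha> \<beta> where ab: "\<alpha> \<noteq> 0 \<or> \<beta> \<noteq> 0" "\<And>j. \<alpha> * R $ 1 $ j $ 3 + \<beta> * R $ 2 $ j $ 3 = 0"
    using kernel_vec_zero_rows(2)[OF assms] by blast
  show ?thesis
  proof (cases "\<beta> = 0")
    case True
    then have "R $ 1 $ j $ 3 = 0" for j using ab by simp
    then have "R $ i $ j $ m = with_rank_one (R, vector [0, 1], \<chi> j. R $ 2 $ j $ 3) $ i $ j $ m" for i j m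
      using exhaust_2[of i] by (auto simp: with_rank_one_nth)
    then show ?thesis using mat_eqI by blast
  next
    case False
    have "\<beta> * R $ 2 $ j $ 3 = - \<alpha> * R $ 1 $ j $ 3" for j using ab(2)[of j] by (simp add: add_eq_0_iff)
    then have 2: "R $ 2 $ j $ 3 = - \<alpha> / \<beta> * R $ 1 $ j $ 3" for j
      using False by (simp add: field_simps)
    have "R $ i $ j $ m = with_rank_one (R, vector [1, - \<alpha> / \<beta>], \<chi> j. R $ 1 $ j $ 3) $ i $ j $ m" for i j m
      using exhaust_2[of i] 2[of j] by (auto simp: with_rank_one_nth)
    then show ?thesis using mat_eqI by blast
  qed
qed

text \<open>A nonzero discriminant gives two zeros that are not proportional, and a linear form in
  two variables vanishing at both is 0.\<close>

lemma binary_form_vanishing: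
  fixes p q r D E :: complex
  assumes disc: "q\<^sup>2 - 4 * p * r \<noteq> 0"
    and zero: "\<And>s t. p * s\<^sup>2 + q * s * t + r * t\<^sup>2 = 0 \<Longrightarrow> s * D + t * E = 0"
  shows "D = 0 \<and> E = 0"
proof (cases "p = 0")
  case True
  then have "D = 0" using zero[of 1 0] by simp
  moreover have "q \<noteq> 0" using True disc by simp
  moreover have "- r * D + q * E = 0"
    by (rule zero) (simp add: True power2_eq_square algebra_simps)
  ultimately show ?thesis by simp
next
  case False
  define d where "d = csqrt (q\<^sup>2 - 4 * p * r)"
  have d2: "d\<^sup>2 = q\<^sup>2 - 4 * p * r" unfolding d_def by simp
  have d0: "d \<noteq> 0" using disc d2 by auto
  have "(d - q) * D + 2 * p * E = 0" by (rule zero) (use d2 in algebra)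
  moreover have "(- d - q) * D + 2 * p * E = 0" by (rule zero) (use d2 in algebra)
  ultimately have "2 * d * D = 0" by algebra
  then have "D = 0" using d0 by simp
  then show ?thesis using \<open>(d - q) * D + 2 * p * E = 0\<close> False by simp
qed

text \<open>For \<open>Z = a b\<^sup>T\<close> and a shear of its second row by \<open>s (0, p, q)\<close>, the kernel vector becomes a multiple of
  \<open>b \<times> (0, p, q) = p (shear1 b) + q (shear2 b)\<close>. So the equation of \<open>Dvar\<close> is a binary quadratic form in
  \<open>(p, q)\<close>, and \<open>shear_disc\<close> is its discriminant.\<close>

definition mixed_det_xy :: "W ^ 2 \<Rightarrow> W ^ 2 \<Rightarrow> complex" where
  "mixed_det_xy M N = M$1$1 * N$2$2 + N$1$1 * M$2$2 - M$2$1 * N$1$2 - N$2$1 * M$1$2"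

definition shear_disc :: "W ^ 2 \<Rightarrow> W ^ 2 \<Rightarrow> complex" where
  "shear_disc M N = mixed_det_xy M N * mixed_det_xy M N - 4 * det_xy M * det_xy N"

definition shear1 :: "complex ^ 3 \<Rightarrow> complex ^ 3" where "shear1 b = vector [- b $ 3, 0, b $ 1]"
definition shear2 :: "complex ^ 3 \<Rightarrow> complex ^ 3" where "shear2 b = vector [b $ 2, - b $ 1, 0]"

text \<open>At a generic matrix with \<open>Z\<close> of rank one, \<open>Dvar\<close> has two branches, whose tangent spaces span.\<close>

lemma differential_zero_generic:
  assumes D: "has_differential mat_coords F D"
    and lin: "\<And>R a b R1 R2. D R (mat_lincomb a R1 b R2) = a * D R R1 + b * D R R2"
    and F: "\<And>R. minors_wedge R $ T_top = 0 \<Longrightarrow> F R = 0"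
    and R: "R = with_rank_one (R0, a, b)" and a1: "a $ 1 \<noteq> 0" and b1: "b $ 1 \<noteq> 0"
    and disc: "shear_disc (mat_apply R0 (shear1 b)) (mat_apply R0 (shear2 b)) \<noteq> 0"
  shows "D R R' = 0"
proof -
  have line0: "D R E = 0" if "\<And>s. minors_wedge (mat_lincomb 1 R s E) $ T_top = 0" for E
  proof -
    have "((\<lambda>s. F (mat_lincomb 1 R s E)) has_field_derivative D R E) (at 0)"
      by (rule mat_has_differential_line[OF D])
    moreover have "(\<lambda>s. F (mat_lincomb 1 R s E)) = (\<lambda>s. 0)" using F that by auto
    ultimately have "((\<lambda>s. 0 :: complex) has_field_derivative D R E) (at 0)" by (simp only:)
    then show ?thesis by (rule DERIV_unique) simp
  qed
  have rank1: "D R E = 0" if E: "\<And>s i j. (mat_lincomb 1 R s E) $ i $ j $ 3 = p s $ i * q s $ j" for E p q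
  proof (rule line0)
    fix s
    have "kernel_vec (mat_lincomb 1 R s E) = 0" using rank_one_kernel_vec E by blast
    then show "minors_wedge (mat_lincomb 1 R s E) $ T_top = 0"
      unfolding minors_wedge_top det_xy_def mat_apply_nth by simp
  qed
  \<comment> \<open>The z-part of R' is split into the product of the column a with the row \<beta>,
    the multiple \<gamma> b in the second row, and a rest in the entries (2, 2) and (2, 3), with
    \<open>a $ 1\<close> and \<open>b $ 1\<close> as pivots. The first two summands move within the
    matrices with Z of rank at most 1, the first one together with the x- and y-parts of R'.\<close>
  define \<beta> where "\<beta> = (\<lambda>j. R' $ 1 $ j $ 3 / a $ 1)"
  define \<rho> where "\<rho> = (\<lambda>j. R' $ 2 $ j $ 3 - a $ 2 * \<beta> j)"
  define \<gamma> where "\<gamma> = \<rho> 1 / b $ 1"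
  define c2 where "c2 = \<rho> 2 - \<gamma> * b $ 2"
  define c3 where "c3 = \<rho> 3 - \<gamma> * b $ 3"
  define Ea :: mat23 where "Ea = (\<chi> i j. \<chi> m. if m = 3 then a $ i * \<beta> j else R' $ i $ j $ m)"
  define Eb :: mat23 where "Eb = (\<chi> i j. \<chi> m. if m = 3 \<and> i = 2 then \<gamma> * b $ j else 0)"
  define Ec where "Ec = mat_lincomb c2 (unit_mat 2 2 3) c3 (unit_mat 2 3 3)"
  have eq: "R' = mat_lincomb 1 (mat_lincomb 1 Ea 1 Eb) 1 Ec"
  proof (rule mat_eqI)
    fix i j m
    have a: "a $ 1 * \<beta> j = R' $ 1 $ j $ 3" for j using a1 by (simp add: \<beta>_def)
    have b: "\<gamma> * b $ 1 = \<rho> 1" using b1 by (simp add: \<gamma>_def)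
    show "R' $ i $ j $ m = mat_lincomb 1 (mat_lincomb 1 Ea 1 Eb) 1 Ec $ i $ j $ m"
    proof (cases "m = 3")
      case True
      then show ?thesis
        using exhaust_2[of i] exhaust_3[of j]
        by (elim disjE) (simp_all add: Ea_def Eb_def Ec_def unit_mat_nth a b c2_def c3_def \<rho>_def)
    qed (simp add: Ea_def Eb_def Ec_def unit_mat_nth)
  qed
  have "D R Ea = 0"
    by (rule rank1[where p = "\<lambda>s. a" and q = "\<lambda>s. \<chi> j. b $ j + s * \<beta> j"])
      (simp add: Ea_def R with_rank_one_nth algebra_simps)
  moreover have "D R Eb = 0"
  proof (rule rank1[where p = "\<lambda>s. vector [a $ 1, a $ 2 + s * \<gamma>]" and q = "\<lambda>s. b"])
    show "mat_lincomb 1 R s Eb $ i $ j $ 3 = vector [a $ 1, a $ 2 + s * \<gamma>] $ i * b $ j" for s i j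
      using exhaust_2[of i] by (elim disjE) (simp_all add: Eb_def R with_rank_one_nth algebra_simps)
  qed
  moreover have "D R Ec = 0"
  proof -
    define M where "M = mat_apply R0 (shear1 b)"
    define N where "N = mat_apply R0 (shear2 b)"
    define p where "p = det_xy M"
    define q where "q = mixed_det_xy M N"
    define r where "r = det_xy N"
    note pqr = p_def q_def r_def det_xy_def mixed_det_xy_def M_def N_def shear1_def shear2_def
    have "D R (unit_mat 2 2 3) = 0 \<and> D R (unit_mat 2 3 3) = 0"
    proof (rule binary_form_vanishing)
      show "q\<^sup>2 - 4 * p * r \<noteq> 0" 
        using disc unfolding shear_disc_def p_def q_def r_def M_def N_def by (simp add: power2_eq_square)
      fix s t assume st: "p * s\<^sup>2 + q * s * t + r * t\<^sup>2 = 0"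
      \<comment> \<open>At a zero (s, t) of the binary form the equation of the divisor holds along
        the whole line; the two zeros are directions in the two branches.\<close>
      have "D R (mat_lincomb s (unit_mat 2 2 3) t (unit_mat 2 3 3)) = 0"
      proof (rule line0)
        fix \<sigma>
        let ?R = "mat_lincomb 1 R \<sigma> (mat_lincomb s (unit_mat 2 2 3) t (unit_mat 2 3 3))"
        have k: "kernel_vec ?R = vector [a $ 1 * \<sigma> * (b $ 2 * t - b $ 3 * s), - a $ 1 * \<sigma> * b $ 1 * t, a $ 1 * \<sigma> * b $ 1 * s]"
          unfolding kernel_vec_def by (simp add: vec_eq_iff forall_3 R with_rank_one_nth unit_mat_nth algebra_simps)
        have nth: "?R $ i $ j $ 1 = R0 $ i $ j $ 1" "?R $ i $ j $ 2 = R0 $ i $ j $ 2" for i j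
          by (simp_all add: R with_rank_one_nth unit_mat_nth)
        have "minors_wedge ?R $ T_top = (a $ 1 * \<sigma>)\<^sup>2 * (p * s\<^sup>2 + q * s * t + r * t\<^sup>2)"
          unfolding minors_wedge_top mat_apply_nth k nth pqr
          by (simp add: mat_apply_nth) algebra
        then show "minors_wedge ?R $ T_top = 0" using st by simp
      qed
      then show "s * D R (unit_mat 2 2 3) + t * D R (unit_mat 2 3 3) = 0" unfolding lin .
    qed
    then show ?thesis unfolding Ec_def lin by simp
  qed
  ultimately show ?thesis unfolding eq lin by simp
qed

lemma polynomial_with_rank_one: "polynomial_on_lines (\<lambda>\<theta>. with_rank_one \<theta> $ i $ j $ m)"
proof -
  have l: "polynomial_on_lines (\<lambda>\<theta> :: mat23 \<times> (complex ^ 2) \<times> (complex ^ 3). fst \<theta> $ i $ j $ m)"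
    "polynomial_on_lines (\<lambda>\<theta> :: mat23 \<times> (complex ^ 2) \<times> (complex ^ 3). fst (snd \<theta>) $ i)"
    "polynomial_on_lines (\<lambda>\<theta> :: mat23 \<times> (complex ^ 2) \<times> (complex ^ 3). snd (snd \<theta>) $ j)"
    by (rule polynomial_on_lines_linear, simp add: scaleR_conv_of_real[where 'a = complex])+
  have "with_rank_one \<theta> $ i $ j $ m = (if m = 3 then fst (snd \<theta>) $ i * snd (snd \<theta>) $ j else fst \<theta> $ i $ j $ m)" for \<theta>
    by (cases \<theta>) (simp add: with_rank_one_nth)
  then show ?thesis using l(1) polynomial_on_lines_mult[OF l(2,3)] by (cases "m = 3") simp_all
qed

lemma polynomial_shear_disc:
  "polynomial_on_lines (\<lambda>\<theta> :: mat23 \<times> (complex ^ 2) \<times> (complex ^ 3).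
     shear_disc (mat_apply (fst \<theta>) (shear1 (snd (snd \<theta>)))) (mat_apply (fst \<theta>) (shear2 (snd (snd \<theta>)))))"
proof -
  have l: "polynomial_on_lines (\<lambda>\<theta> :: mat23 \<times> (complex ^ 2) \<times> (complex ^ 3). fst \<theta> $ i $ j $ m)"
    "polynomial_on_lines (\<lambda>\<theta> :: mat23 \<times> (complex ^ 2) \<times> (complex ^ 3). shear1 (snd (snd \<theta>)) $ j)"
    "polynomial_on_lines (\<lambda>\<theta> :: mat23 \<times> (complex ^ 2) \<times> (complex ^ 3). shear2 (snd (snd \<theta>)) $ j)"
    for i j m
    by (rule polynomial_on_lines_linear, use exhaust_3[of j] in
        \<open>auto simp: shear1_def shear2_def scaleR_conv_of_real[where 'a = complex]\<close>)+
  have M: "polynomial_on_lines (\<lambda>\<theta> :: mat23 \<times> (complex ^ 2) \<times> (complex ^ 3).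
      mat_apply (fst \<theta>) (shear1 (snd (snd \<theta>))) $ i $ m)" for i m
    unfolding mat_apply_nth by (rule polynomial_on_lines_add polynomial_on_lines_mult l)+
  have N: "polynomial_on_lines (\<lambda>\<theta> :: mat23 \<times> (complex ^ 2) \<times> (complex ^ 3).
      mat_apply (fst \<theta>) (shear2 (snd (snd \<theta>))) $ i $ m)" for i m
    unfolding mat_apply_nth by (rule polynomial_on_lines_add polynomial_on_lines_mult l)+
  show ?thesis
    unfolding shear_disc_def mixed_det_xy_def det_xy_def
    by (rule M N polynomial_on_lines_diff polynomial_on_lines_add polynomial_on_lines_mult
        polynomial_on_lines_const)+
qed

text \<open>The differential times the polynomial expressing genericity vanishes on the whole
  parameter space of rank-one matrices; a single generic parameter then suffices to cancel that
  polynomial.\<close>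

lemma differential_zero_sing:
  assumes D: "has_differential mat_coords F D"
    and lin: "\<And>R a b R1 R2. D R (mat_lincomb a R1 b R2) = a * D R R1 + b * D R R2"
    and poly: "polyfun mat_coords (\<lambda>R. D R R')"
    and F: "\<And>R. minors_wedge R $ T_top = 0 \<Longrightarrow> F R = 0"
    and k: "kernel_vec R = 0"
  shows "D R R' = 0"
proof -
  let ?d = "\<lambda>\<theta> :: mat23 \<times> (complex ^ 2) \<times> (complex ^ 3).
    shear_disc (mat_apply (fst \<theta>) (shear1 (snd (snd \<theta>)))) (mat_apply (fst \<theta>) (shear2 (snd (snd \<theta>))))"
  have p1: "polynomial_on_lines (\<lambda>\<theta>. D (with_rank_one \<theta>) R')"
    by (rule polynomial_on_lines_polyfun[OF poly]) (auto simp: mat_coords_def polynomial_with_rank_one)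
  have l: "polynomial_on_lines (\<lambda>\<theta> :: mat23 \<times> (complex ^ 2) \<times> (complex ^ 3). fst (snd \<theta>) $ 1)"
    "polynomial_on_lines (\<lambda>\<theta> :: mat23 \<times> (complex ^ 2) \<times> (complex ^ 3). snd (snd \<theta>) $ 1)"
    by (rule polynomial_on_lines_linear, simp add: scaleR_conv_of_real[where 'a = complex])+
  have p2: "polynomial_on_lines (\<lambda>\<theta>. fst (snd \<theta>) $ 1 * (snd (snd \<theta>) $ 1 * ?d \<theta>))"
    by (intro polynomial_on_lines_mult l polynomial_shear_disc)
  have "D (with_rank_one \<theta>) R' * (fst (snd \<theta>) $ 1 * (snd (snd \<theta>) $ 1 * ?d \<theta>)) = 0" for \<theta>
  proof (cases \<theta>)
    case (fields R0 a b)
    then show ?thesis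
      using differential_zero_generic[OF D lin F, of "with_rank_one \<theta>" R0 a b R'] by auto
  qed
  with polynomial_on_lines_mult_eq_0[OF p1 p2]
  have "(\<forall>\<theta>. D (with_rank_one \<theta>) R' = 0) \<or> (\<forall>\<theta>. fst (snd \<theta>) $ 1 * (snd (snd \<theta>) $ 1 * ?d \<theta>) = 0)"
    by blast
  moreover have "\<exists>\<theta>. fst (snd \<theta>) $ 1 * (snd (snd \<theta>) $ 1 * ?d \<theta>) \<noteq> 0"
  proof -
    \<comment> \<open>For b = (1, 0, 0) this gives M = (x, 0) and N = (0, - y), so the binary form
      is - s t.\<close>
    define R0 where "R0 = mat_lincomb 1 (unit_mat 1 3 1) 1 (unit_mat 2 2 2)"
    have "shear_disc (mat_apply R0 (shear1 (vector [1, 0, 0]))) (mat_apply R0 (shear2 (vector [1, 0, 0]))) = 1"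
      unfolding shear_disc_def mixed_det_xy_def det_xy_def R0_def
      by (simp add: mat_apply_nth unit_mat_nth shear1_def shear2_def)
    then show ?thesis by (intro exI[of _ "(R0, vector [1, 0], vector [1, 0, 0])"]) simp
  qed
  moreover obtain a b where "R = with_rank_one (R, a, b)" using kernel_vec_rank_one[OF k] by blast
  ultimately show ?thesis by metis
qed

lemma dminors_tangent_Dvar_sing:
  assumes nz: "minors_wedge R \<noteq> 0" and k: "kernel_vec R = 0"
  shows "dminors R R' \<in> cone_tangent_space Dvar (line (minors_wedge R))"
proof (rule dminors_tangentI[OF nz])
  fix d f E
  assume f: "homogeneous_poly d f" "vanishes_on f Dvar"
    and E: "has_differential mat_coords (\<lambda>R. f (minors_wedge R)) E"
  obtain D where D: "has_differential mat_coords (\<lambda>R. f (minors_wedge R)) D"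
    "\<And>R a b R1 R2. D R (mat_lincomb a R1 b R2) = a * D R R1 + b * D R R2"
    "\<And>R'. polyfun mat_coords (\<lambda>R. D R R')"
    by (rule mat_polyfun_has_differential[OF polyfun_homogeneous[OF f(1) polyfun_minors_wedge]]) blast
  have "D R R' = 0"
    by (rule differential_zero_sing[OF D Dvar_form_zero[OF f] k])
  then show "E R R' = 0" using mat_has_differential_unique[OF D(1) E] by simp
qed

section \<open>Tangent spaces in charts\<close>

lemma homogeneous_minors_wedge:
  fixes \<Phi> :: "complex ^ 'n::finite \<Rightarrow> mat23"
  assumes "\<And>i j m. homogeneous_poly 1 (\<lambda>x. \<Phi> x $ i $ j $ m)"
  shows "homogeneous_poly 6 (\<lambda>x. minors_wedge (\<Phi> x) $ T)"
proof -
  have e: "homogeneous_poly 2 (\<lambda>x. \<Phi> x $ i $ j $ m * \<Phi> x $ i' $ j' $ m')" for i j m i' j' m'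
    using homogeneous_poly_mult[OF assms assms] by (simp add: numeral_2_eq_2)
  have m: "homogeneous_poly 2 (\<lambda>x. minor (\<Phi> x) p q $ m)" for p q m
    by (cases m) (auto simp: minor_def intro!: homogeneous_poly_diff homogeneous_poly_add e)
  have mm: "homogeneous_poly 4 (\<lambda>x. minor (\<Phi> x) p q $ m * minor (\<Phi> x) p' q' $ m')" for p q m p' q' m'
    using homogeneous_poly_mult[OF m m] by simp
  have mmm: "homogeneous_poly 6 (\<lambda>x. minor (\<Phi> x) p q $ m * g x)" if "homogeneous_poly 4 g" for p q m g
    using homogeneous_poly_mult[OF m that] by simp
  show ?thesis
    by (cases T rule: mon_triple_cases)
      (auto simp: minors_wedge_def wedge3_nth minor3_def intro!: homogeneous_poly_diff homogeneous_poly_add mmm mm)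
qed

lemma pluecker_linear: "pluecker \<alpha> \<beta> \<gamma> (v + s *s w) = pluecker \<alpha> \<beta> \<gamma> v + s * pluecker \<alpha> \<beta> \<gamma> w"
  unfolding pluecker_def by (simp add: algebra_simps sum.distrib sum_distrib_left)

text \<open>Differentiation of the identity \<open>coord\<close> along the chart. Chart and
  coordinates are kept abstract in order to cover both charts.\<close>

lemma chart_family_differential:
  fixes ch :: "complex ^ 'p::finite \<Rightarrow> mat23" and L :: "'p \<Rightarrow> ext3S2W \<Rightarrow> complex"
  assumes ch: "\<And>c s c'. ch (c + s *s c') = mat_lincomb 1 (ch c) s (ch c')"
    and hom: "\<And>p. homogeneous_poly 1 (L p)"
    and lin: "\<And>p v s w. L p (v + s *s w) = L p v + s * L p w"
    and coord: "\<And>p c. L p (minors_wedge (ch c)) = c $ o' ^ 5 * c $ p"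
    and c0: "c0 $ o' = 1"
  shows "L p (dminors (ch c0) (ch c)) = 5 * c $ o' * c0 $ p + c $ p"
proof -
  obtain D where D: "has_differential vec_coords (L p) D"
    by (rule homogeneous_has_differential[OF hom])
  have "((\<lambda>s. L p (v + s *s w)) has_field_derivative L p w) (at 0)" for v w
    unfolding lin by (auto intro!: derivative_eq_intros)
  then have DL: "D v w = L p w" for v w
    using DERIV_unique has_differential_line[OF D] by blast
  have "((\<lambda>s. L p (minors_wedge (mat_lincomb 1 (ch c0) s (ch c)))) has_field_derivative
      D (minors_wedge (ch c0)) (dminors (ch c0) (ch c))) (at 0)"
  proof (rule has_differential_curve[OF D])
    show "((\<lambda>s. minors_wedge (mat_lincomb 1 (ch c0) s (ch c)) $ T) has_field_derivative dminors (ch c0) (ch c) $ T) (at 0)" for T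
      by (rule mat_has_differential_line[OF has_differential_minors])
    show "minors_wedge (mat_lincomb 1 (ch c0) 0 (ch c)) = minors_wedge (ch c0)"
      by (rule arg_cong[of _ _ minors_wedge]) (simp add: mat_lincomb_def vec_eq_iff)
  qed
  then have "((\<lambda>s. (c0 + s *s c) $ o' ^ 5 * (c0 + s *s c) $ p) has_field_derivative L p (dminors (ch c0) (ch c))) (at 0)"
    unfolding ch[symmetric] coord DL .
  moreover have "((\<lambda>s. (c0 + s *s c) $ o' ^ 5 * (c0 + s *s c) $ p) has_field_derivative 5 * c $ o' * c0 $ p + c $ p) (at 0)"
    by (auto intro!: derivative_eq_intros simp: c0)
  ultimately show ?thesis by (rule DERIV_unique)
qed

lemma chart_family_dim:
  fixes ch :: "complex ^ 'p::finite \<Rightarrow> mat23" and L :: "'p \<Rightarrow> ext3S2W \<Rightarrow> complex"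
  assumes ch: "\<And>c s c'. ch (c + s *s c') = mat_lincomb 1 (ch c) s (ch c')"
    and hom: "\<And>p. homogeneous_poly 1 (L p)"
    and lin: "\<And>p v s w. L p (v + s *s w) = L p v + s * L p w"
    and coord: "\<And>p c. L p (minors_wedge (ch c)) = c $ o' ^ 5 * c $ p"
    and c0: "c0 $ o' = 1"
  shows "vec.dim (range (\<lambda>c. dminors (ch c0) (ch c))) = CARD('p)"
    and "vec.subspace (range (\<lambda>c. dminors (ch c0) (ch c)))"
proof -
  let ?\<Phi> = "\<lambda>c. dminors (ch c0) (ch c)"
  have comb: "?\<Phi> (c + s *s c') = ?\<Phi> c + s *s ?\<Phi> c'" for c s c'
    unfolding ch dminors_linear by simp
  have zero: "?\<Phi> 0 = 0"
    using comb[of 0 1 0] by simp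
  have linear: "Vector_Spaces.linear (*s) (*s) ?\<Phi>"
    using comb[of _ 1] comb[of 0] zero
    by (intro Vector_Spaces.linear_iff[THEN iffD2] conjI allI vec.vector_space_axioms) simp_all
  have L0: "L p 0 = 0" for p using lin[of p 0 "-1" 0] by simp
  have "inj ?\<Phi>"
  proof (rule vec.linear_inj_iff_eq_0[OF linear, THEN iffD2], intro allI impI)
    fix c assume "?\<Phi> c = 0"
    then have *: "5 * c $ o' * c0 $ p + c $ p = 0" for p
      using chart_family_differential[OF assms, of p c] L0 by simp
    \<comment> \<open>At p = o' the equation reads 6 c $ o' = 0, since c0 is normalised
      there.\<close>
    from *[of o'] have "c $ o' = 0" using c0 by simp
    then show "c = 0" using * by (simp add: vec_eq_iff)
  qed
  then have "vec.dim (?\<Phi> ` UNIV) = vec.dim (UNIV :: (complex ^ 'p) set)"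
    by (intro vec.dim_image_eq[OF linear]) (auto intro: inj_on_subset)
  then show "vec.dim (range ?\<Phi>) = CARD('p)" by (simp only: vec_dim_card)
  show "vec.subspace (range ?\<Phi>)"
    by (rule vec.linear_subspace_image[OF linear vec.subspace_UNIV])
qed

lemma dminors_tangent_Yvar:
  assumes nz: "minors_wedge R \<noteq> 0"
  shows "dminors R R' \<in> cone_tangent_space Yvar (line (minors_wedge R))"
proof (rule dminors_tangentI[OF nz])
  fix d f D
  assume f: "homogeneous_poly d f" "vanishes_on f Yvar"
    and D: "has_differential mat_coords (\<lambda>R. f (minors_wedge R)) D"
  have "f 0 = 0"
  proof -
    have "f (minors_wedge R) = 0" using f(2) nz unfolding vanishes_on_def Yvar_eq by blast
    then show ?thesis using homogeneous_poly_scale[OF f(1), of 0 "minors_wedge R"] by simp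
  qed
  then have "f (minors_wedge R) = 0" for R
    using f(2) unfolding vanishes_on_def Yvar_eq by (cases "minors_wedge R = 0") auto
  then have "((\<lambda>s. 0 :: complex) has_field_derivative D R R') (at 0)"
    using mat_has_differential_line[OF D, of R R'] by simp
  then show "D R R' = 0" by (rule DERIV_unique) simp
qed

context frame
begin

lemma homogeneous_chart_coord: "homogeneous_poly 1 (chart_coord p)"
proof -
  have "\<forall>p. homogeneous_poly 1 (chart_coord p)"
    unfolding all_option23 chart_coord_def[abs_def]
    using homogeneous_poly_cmult[OF homogeneous_pluecker, of "-1"]
    by (auto simp del: One_nat_def intro!: homogeneous_poly_diff homogeneous_pluecker)
  then show ?thesis by blast
qed

lemma chart_coord_linear: "chart_coord p (v + s *s w) = chart_coord p v + s * chart_coord p w"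
proof -
  have "\<forall>p. chart_coord p (v + s *s w) = chart_coord p v + s * chart_coord p w"
    unfolding all_option23 chart_coord_def pluecker_linear by (simp add: algebra_simps)
  then show ?thesis by blast
qed

lemma chart_affine: "chart (c + s *s c') = mat_lincomb 1 (chart c) s (chart c')"
  unfolding chart_def by (simp add: vec_eq_iff forall_2 forall_3 algebra_simps)

text \<open>On Y each Pluecker coordinate is, up to powers of the leading one, a polynomial in the
  chart coordinates. Differentiating this relation along w, which moves no chart coordinate, leaves
  only the term with \<open>w $ T\<close>.\<close>

lemma tangent_Yvar_chart_zero:
  assumes v: "v \<noteq> 0" "chart_coord None v \<noteq> 0"
    and w: "w \<in> cone_tangent_space Yvar (line v)" "\<And>p. chart_coord p w = 0"
  shows "w = 0"
  unfolding vec_eq_iff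
proof
  fix T
  define co where "co = (\<lambda>u. \<chi> p. chart_coord p u)"
  \<comment> \<open>The outer factor makes f vanish also at the points of Y outside the
    chart.\<close>
  define f where "f = (\<lambda>u :: ext3S2W. chart_coord None u * (chart_coord None u ^ 5 * u $ T - minors_wedge (chart (co u)) $ T))"
  have "homogeneous_poly 1 (\<lambda>u. chart (co u) $ i $ j $ m)" for i j m
  proof -
    have h: "homogeneous_poly 1 (\<lambda>u. chart_coord p u * x)" for p x
      using homogeneous_poly_cmult[OF homogeneous_chart_coord, of x p] by (simp add: mult.commute)
    show ?thesis
      using exhaust_2[of i] exhaust_3[of j] unfolding chart_def co_def
      by (elim disjE) (simp_all add: h homogeneous_poly_add del: One_nat_def)
  qed
  then have "homogeneous_poly 6 (\<lambda>u. minors_wedge (chart (co u)) $ T)"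
    by (rule homogeneous_minors_wedge)
  moreover have "homogeneous_poly 6 (\<lambda>u. chart_coord None u ^ 5 * u $ T)"
    using homogeneous_poly_mult[OF homogeneous_poly_power[OF homogeneous_chart_coord, of 5 None] homogeneous_poly_coord, of T]
    by simp
  ultimately have homf: "homogeneous_poly (1 + 6) f"
    unfolding f_def by (intro homogeneous_poly_mult homogeneous_chart_coord homogeneous_poly_diff)
  have "f (minors_wedge R) = 0" for R
  proof (cases "chart_coord None (minors_wedge R) = 0")
    case False
    then obtain c t where c: "c $ None = 1" "t \<noteq> 0" "minors_wedge R = t *s minors_wedge (chart c)"
      using chart_surjective by blast
    have "chart_coord p (minors_wedge R) = t * c $ p" for p
      unfolding c(3) homogeneous_poly_scale[OF homogeneous_chart_coord] chart_coord_chart c(1) by simp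
    then have co: "co (minors_wedge R) = t *s c" "chart_coord None (minors_wedge R) = t"
      unfolding co_def using c(1) by (simp_all add: vec_eq_iff)
    show ?thesis
      unfolding f_def co chart_scale minors_wedge_scale unfolding c(3) by (simp add: eval_nat_numeral)
  qed (simp add: f_def)
  then have "vanishes_on f Yvar"
    unfolding Yvar_eq using vanishes_on_lines[OF homf, of minors_wedge "\<lambda>_. True"] by simp
  moreover have "v \<in> line v - {0}" using v(1) unfolding line_def by (simp add: vec.span_base)
  ultimately have d0: "((\<lambda>s. f (v + s *s w)) has_field_derivative 0) (at 0)"
    using w(1)[unfolded cone_tangent_space_def mem_Collect_eq, rule_format, of "1 + 6" f v] homf
    unfolding vanishes_on_def by blast
  have co: "co (v + s *s w) = co v" "chart_coord None (v + s *s w) = chart_coord None v" for s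
    unfolding co_def by (simp_all add: chart_coord_linear w(2))
  have "((\<lambda>s. f (v + s *s w)) has_field_derivative chart_coord None v * (chart_coord None v ^ 5 * w $ T)) (at 0)"
    unfolding f_def co by (auto intro!: derivative_eq_intros)
  then have "chart_coord None v * (chart_coord None v ^ 5 * w $ T) = 0"
    using d0 DERIV_unique by blast
  then show "w $ T = 0 $ T" using v(2) by simp
qed

lemma tangent_Yvar_chart:
  assumes c0: "c0 $ None = 1"
  shows "cone_tangent_space Yvar (line (minors_wedge (chart c0))) = range (\<lambda>c. dminors (chart c0) (chart c))"
proof
  have co: "chart_coord None (minors_wedge (chart c0)) = 1" unfolding chart_coord_chart c0 by simp
  have nz: "minors_wedge (chart c0) \<noteq> 0"
    using co homogeneous_poly_scale[OF homogeneous_chart_coord, of None 0 0] by auto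
  show "range (\<lambda>c. dminors (chart c0) (chart c)) \<subseteq> cone_tangent_space Yvar (line (minors_wedge (chart c0)))"
    using dminors_tangent_Yvar[OF nz] by blast
  show "cone_tangent_space Yvar (line (minors_wedge (chart c0))) \<subseteq> range (\<lambda>c. dminors (chart c0) (chart c))"
  proof
    fix w assume w: "w \<in> cone_tangent_space Yvar (line (minors_wedge (chart c0)))"
    \<comment> \<open>This solves the linear system of \<open>chart_family_differential\<close>: its
      equation at \<open>None\<close> is 6 times the unknown, the others follow by
      subtraction.\<close>
    define c where "c = (\<chi> p. if p = None then chart_coord None w / 6
      else chart_coord p w - 5 * (chart_coord None w / 6) * c0 $ p)"
    define w' where "w' = dminors (chart c0) (chart c)"
    have "chart_coord p w' = chart_coord p w" for p
      unfolding w'_def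
        chart_family_differential[of chart chart_coord None, OF chart_affine homogeneous_chart_coord chart_coord_linear chart_coord_chart c0]
      by (simp add: c_def c0)
    then have "chart_coord p (w + (-1) *s w') = 0" for p
      unfolding chart_coord_linear by simp
    moreover have "w + (-1) *s w' \<in> cone_tangent_space Yvar (line (minors_wedge (chart c0)))"
      using subspace_cone_tangent_space[OF nz, of Yvar] w dminors_tangent_Yvar[OF nz, of "chart c"]
      unfolding w'_def vec.subspace_def by blast
    ultimately have "w + (-1) *s w' = 0"
      by (intro tangent_Yvar_chart_zero[OF nz]) (simp_all add: co)
    then have "w = w'" by (simp add: vec_eq_iff add_eq_0_iff)
    then show "w \<in> range (\<lambda>c. dminors (chart c0) (chart c))" unfolding w'_def by blast
  qed
qed

text \<open>A neighbourhood of the net \<open>e\<^sub>3 W\<close>; such nets lie in no translate of the first chart.\<close>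

definition chart2 :: "complex ^ ((2 \<times> 3) option) \<Rightarrow> mat23" where
  "chart2 c = vector [
     vector [c $ None *s e3 + c $ Some (1, 1) *s e1, c $ Some (1, 2) *s e1 + c $ Some (1, 3) *s e2, c $ None *s e2],
     vector [c $ Some (2, 1) *s e1 + c $ Some (2, 2) *s e2, c $ None *s e3 + c $ Some (2, 3) *s e2, c $ None *s e1]]"

definition chart2_coord :: "(2 \<times> 3) option \<Rightarrow> ext3S2W \<Rightarrow> complex" where
  "chart2_coord p \<omega> = (case p of
     None \<Rightarrow> - pluecker (square_eval f3) (polar f1 f3) (polar f2 f3) \<omega>
   | Some (i, j) \<Rightarrow>
      if i = 1 then
        (if j = 1 then - pluecker (square_eval f3) (square_eval f1) (polar f2 f3) \<omega>
         else if j = 2 then pluecker (square_eval f3) (polar f1 f3) (square_eval f1) \<omega>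
         else pluecker (square_eval f3) (polar f1 f3) (polar f1 f2) \<omega>)
      else
        (if j = 1 then pluecker (square_eval f3) (polar f1 f2) (polar f2 f3) \<omega>
         else if j = 2 then pluecker (square_eval f3) (square_eval f2) (polar f2 f3) \<omega>
         else - pluecker (square_eval f3) (polar f1 f3) (square_eval f2) \<omega>))"

lemma chart2_coord_chart2: "chart2_coord p (minors_wedge (chart2 c)) = c $ None ^ 5 * c $ p"
proof -
  have "\<forall>p. chart2_coord p (minors_wedge (chart2 c)) = c $ None ^ 5 * c $ p"
    unfolding all_option23 chart2_coord_def minors_wedge_def chart2_def
    by (simp add: pluecker_wedge3; intro conjI; algebra)
  then show ?thesis by blast
qed

lemma homogeneous_chart2_coord: "homogeneous_poly 1 (chart2_coord p)"
proof -
  have "\<forall>p. homogeneous_poly 1 (chart2_coord p)"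
    unfolding all_option23 chart2_coord_def[abs_def]
    using homogeneous_poly_cmult[OF homogeneous_pluecker, of "-1"]
    by (auto simp del: One_nat_def intro!: homogeneous_pluecker)
  then show ?thesis by blast
qed

lemma chart2_coord_linear: "chart2_coord p (v + s *s w) = chart2_coord p v + s * chart2_coord p w"
proof -
  have "\<forall>p. chart2_coord p (v + s *s w) = chart2_coord p v + s * chart2_coord p w"
    unfolding all_option23 chart2_coord_def pluecker_linear by (simp add: algebra_simps)
  then show ?thesis by blast
qed

lemma chart2_affine: "chart2 (c + s *s c') = mat_lincomb 1 (chart2 c) s (chart2 c')"
  unfolding chart2_def by (simp add: vec_eq_iff forall_2 forall_3 algebra_simps)

lemmas chart_dim = chart_family_dim[of chart chart_coord None, OF chart_affine homogeneous_chart_coord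
    chart_coord_linear chart_coord_chart]
lemmas chart2_dim = chart_family_dim[of chart2 chart2_coord None, OF chart2_affine homogeneous_chart2_coord
    chart2_coord_linear chart2_coord_chart2]

end

section \<open>Choosing a chart at a point of the divisor\<close>

lemma functional_nonzero_on_two:
  fixes l w :: W
  assumes "l \<noteq> 0" "w \<noteq> 0"
  shows "\<exists>f. dotW f l \<noteq> 0 \<and> dotW f w \<noteq> 0"
proof -
  have one: "\<exists>f. dotW f u \<noteq> 0" if u: "u \<noteq> 0" for u
  proof -
    obtain i where "u $ i \<noteq> 0" using u by (auto simp: vec_eq_iff)
    then have "dotW (axis i 1) u \<noteq> 0"
      using exhaust_3[of i] unfolding dotW_def by (auto simp: axis_def)
    then show ?thesis by blast
  qed
  have add: "dotW (f + g) u = dotW f u + dotW g u" for f g u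
    unfolding dotW_def by (simp add: algebra_simps)
  obtain f g where fg: "dotW f l \<noteq> 0" "dotW g w \<noteq> 0" using one assms by blast
  show ?thesis
  proof (cases "dotW f w = 0")
    case True
    show ?thesis
    proof (cases "dotW g l = 0")
      case True
      then show ?thesis using fg \<open>dotW f w = 0\<close> by (intro exI[of _ "f + g"]) (simp add: add)
    qed (use fg in blast)
  qed (use fg in blast)
qed

text \<open>The functionals f1 and f2 are independent, since f2 is nonzero and only f1 is nonzero at
  l; so one of the unit vectors completes them.\<close>

lemma functional_completion:
  assumes "dotW f2 l = 0" "dotW f1 l \<noteq> 0" "f2 \<noteq> 0"
  shows "\<exists>f3. det (vector [f1, f2, f3] :: complex ^ 3 ^ 3) \<noteq> 0"
proof (rule ccontr)
  assume "\<not> ?thesis"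
  then have "det (vector [f1, f2, axis i 1] :: complex ^ 3 ^ 3) = 0" for i by blast
  from this[of 1] this[of 2] this[of 3]
  have c: "f1$1 * f2$2 = f1$2 * f2$1" "f1$1 * f2$3 = f1$3 * f2$1" "f1$2 * f2$3 = f1$3 * f2$2"
    unfolding det_3 by (simp_all add: axis_def)
  have "dotW f1 l * f2 $ 1 = dotW f2 l * f1 $ 1" "dotW f1 l * f2 $ 2 = dotW f2 l * f1 $ 2"
    "dotW f1 l * f2 $ 3 = dotW f2 l * f1 $ 3"
    using c unfolding dotW_def by algebra+
  then show False using assms by (simp add: vec_eq_iff forall_3)
qed

lemma frame_with_third:
  assumes "l \<noteq> 0"
  shows "\<exists>e1 e2 f1 f2 f3. frame e1 e2 l f1 f2 f3"
proof -
  obtain B :: "complex ^ 3 ^ 3" where B: "det B \<noteq> 0" "\<And>i. B $ i $ 3 = l $ i"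
    using exists_third_column[OF assms] by blast
  have "transpose B = vector [column 1 B, column 2 B, l]"
    unfolding transpose_def column_def by (simp add: vec_eq_iff forall_3 B)
  then have "det (vector [column 1 B, column 2 B, l] :: complex ^ 3 ^ 3) \<noteq> 0"
    using B(1) det_transpose[of B] by simp
  from frame_exists[OF this] show ?thesis by blast
qed

lemma psi_minors:
  "minor (psi l u v a b) 1 2 = a \<bullet>\<^sub>S v - b \<bullet>\<^sub>S u"
  "minor (psi l u v a b) 1 3 = - (l \<bullet>\<^sub>S u)"
  "minor (psi l u v a b) 2 3 = - (l \<bullet>\<^sub>S v)"
  unfolding minor_def by (simp_all add: sym_mult_linear)

lemma psi_independent:
  assumes "minors_wedge (psi l u v a b) \<noteq> 0" "s \<noteq> 0 \<or> t \<noteq> 0"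
  shows "s *s u + t *s v \<noteq> 0"
proof
  assume "s *s u + t *s v = 0"
  then have "l \<bullet>\<^sub>S (s *s u + t *s v) = 0" by (simp add: sym_mult_linear)
  then have "0 *s minor (psi l u v a b) 1 2 + s *s minor (psi l u v a b) 1 3 + t *s minor (psi l u v a b) 2 3 = 0"
    unfolding psi_minors sym_mult_linear by (simp add: vec_eq_iff add_eq_0_iff)
  then show False
    using assms unfolding stable_iff[symmetric] stable_def by blast
qed

lemma psi_nonzero:
  assumes "minors_wedge (psi l u v a b) \<noteq> 0"
  shows "l \<noteq> 0"
proof
  assume "l = 0"
  then have "0 *s minor (psi l u v a b) 1 2 + 1 *s minor (psi l u v a b) 1 3 + 0 *s minor (psi l u v a b) 2 3 = 0"
    unfolding psi_minors by (simp add: sym_mult_linear)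
  then show False
    using assms unfolding stable_iff[symmetric] stable_def by (metis zero_neq_one)
qed

text \<open>The point \<theta> lies on the line l = 0 but not on the conic a v - b u. Let w be the
  combination of u, v that vanishes at \<theta>. If l and w are nonzero at f, the net restricts
  isomorphically to the line through f and \<theta>: up to sign, the determinant is the conic at
  \<theta> times l(f)^2 w(f).\<close>

lemma psi_chart:
  assumes nz: "minors_wedge (psi l u v a b) \<noteq> 0"
    and th: "dotW \<theta> l = 0" "dotW \<theta> a * dotW \<theta> v - dotW \<theta> b * dotW \<theta> u \<noteq> 0"
  shows "\<exists>e1 e2 e3 f1 f2 f3 c0. frame e1 e2 e3 f1 f2 f3 \<and> c0 $ None = 1 \<and>
    line (minors_wedge (psi l u v a b)) = line (minors_wedge (frame.chart e1 e2 e3 c0))"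
proof -
  define w where "w = (- dotW \<theta> v) *s u + dotW \<theta> u *s v"
  have "dotW \<theta> u \<noteq> 0 \<or> dotW \<theta> v \<noteq> 0" using th(2) by auto
  then have "w \<noteq> 0" unfolding w_def by (intro psi_independent[OF nz]) auto
  then obtain f where f: "dotW f l \<noteq> 0" "dotW f w \<noteq> 0"
    using functional_nonzero_on_two[OF psi_nonzero[OF nz]] by blast
  have "\<theta> \<noteq> 0" using th(2) unfolding dotW_def by auto
  then obtain f3 where "det (vector [f, \<theta>, f3] :: complex ^ 3 ^ 3) \<noteq> 0"
    using functional_completion[OF th(1) f(1)] by blast
  then obtain e1 e2 e3 where fr: "frame e1 e2 e3 f \<theta> f3" using dual_frame_exists by blast
  interpret frame e1 e2 e3 f \<theta> f3 by (rule fr)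
  have "chart_coord None (minors_wedge (psi l u v a b)) =
      - (dotW \<theta> a * dotW \<theta> v - dotW \<theta> b * dotW \<theta> u) * (dotW f l)\<^sup>2 * dotW f w"
    unfolding chart_coord_def minors_wedge_def pluecker_wedge3 option.case w_def
    by (simp add: th(1)) algebra
  then have "chart_coord None (minors_wedge (psi l u v a b)) \<noteq> 0" using th(2) f by simp
  then obtain c t where c: "c $ None = 1" "t \<noteq> 0" "minors_wedge (psi l u v a b) = t *s minors_wedge (chart c)"
    using chart_surjective by blast
  then have "line (minors_wedge (psi l u v a b)) = line (minors_wedge (chart c))"
    using line_scale[OF c(2)] by simp
  then show ?thesis using fr c(1) by blast
qed

text \<open>If the conic a v - b u contains the line l = 0, it is l times a linear form w. The net
  then is l W, the origin of the second chart in a frame with l as third vector.\<close>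

lemma psi_chart2:
  assumes nz: "minors_wedge (psi l u v a b) \<noteq> 0"
    and th: "\<And>\<theta>. dotW \<theta> l = 0 \<Longrightarrow> dotW \<theta> a * dotW \<theta> v - dotW \<theta> b * dotW \<theta> u = 0"
  shows "\<exists>e1 e2 e3 f1 f2 f3 c0. frame e1 e2 e3 f1 f2 f3 \<and> c0 $ None = 1 \<and>
    line (minors_wedge (psi l u v a b)) = line (minors_wedge (frame.chart2 e1 e2 e3 c0))"
proof -
  obtain e1 e2 f1 f2 f3 where fr: "frame e1 e2 l f1 f2 f3"
    using frame_with_third[OF psi_nonzero[OF nz]] by blast
  interpret frame e1 e2 l f1 f2 f3 by (rule fr)
  have add: "dotW (f1 + f2) x = dotW f1 x + dotW f2 x" for x
    unfolding dotW_def by (simp add: algebra_simps)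
  \<comment> \<open>Evaluation at f1, f2 and f1 + f2 polarises: the three coefficients of the conic
    on the line l = 0 vanish.\<close>
  have q1: "dotW f1 a * dotW f1 v - dotW f1 b * dotW f1 u = 0" by (rule th) simp
  have q2: "dotW f2 a * dotW f2 v - dotW f2 b * dotW f2 u = 0" by (rule th) simp
  have "dotW (f1 + f2) a * dotW (f1 + f2) v - dotW (f1 + f2) b * dotW (f1 + f2) u = 0"
    by (rule th) (simp add: add)
  then have q12: "dotW f1 a * dotW f2 v + dotW f2 a * dotW f1 v - dotW f1 b * dotW f2 u - dotW f2 b * dotW f1 u = 0"
    unfolding add using q1 q2 by algebra
  define w where "w = (dotW f1 a * dotW f3 v + dotW f3 a * dotW f1 v - dotW f1 b * dotW f3 u - dotW f3 b * dotW f1 u) *s e1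
    + (dotW f2 a * dotW f3 v + dotW f3 a * dotW f2 v - dotW f2 b * dotW f3 u - dotW f3 b * dotW f2 u) *s e2
    + (dotW f3 a * dotW f3 v - dotW f3 b * dotW f3 u) *s l"
  have prod: "x \<bullet>\<^sub>S y = (dotW f1 x * dotW f1 y) *s (e1 \<bullet>\<^sub>S e1) + (dotW f1 x * dotW f2 y + dotW f2 x * dotW f1 y) *s (e1 \<bullet>\<^sub>S e2)
      + (dotW f2 x * dotW f2 y) *s (e2 \<bullet>\<^sub>S e2) + (dotW f1 x * dotW f3 y + dotW f3 x * dotW f1 y) *s (l \<bullet>\<^sub>S e1)
      + (dotW f2 x * dotW f3 y + dotW f3 x * dotW f2 y) *s (l \<bullet>\<^sub>S e2) + (dotW f3 x * dotW f3 y) *s (l \<bullet>\<^sub>S l)" for x y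
  proof -
    define x1 x2 x3 y1 y2 y3 where "x1 = dotW f1 x" "x2 = dotW f2 x" "x3 = dotW f3 x"
      "y1 = dotW f1 y" "y2 = dotW f2 y" "y3 = dotW f3 y"
    have "x = x1 *s e1 + x2 *s e2 + x3 *s l" "y = y1 *s e1 + y2 *s e2 + y3 *s l"
      unfolding x1_x2_x3_y1_y2_y3_def using expand by blast+
    then have "x \<bullet>\<^sub>S y = (x1 *s e1 + x2 *s e2 + x3 *s l) \<bullet>\<^sub>S (y1 *s e1 + y2 *s e2 + y3 *s l)" by simp
    also have "\<dots> = (x1 * y1) *s (e1 \<bullet>\<^sub>S e1) + (x1 * y2 + x2 * y1) *s (e1 \<bullet>\<^sub>S e2)
      + (x2 * y2) *s (e2 \<bullet>\<^sub>S e2) + (x1 * y3 + x3 * y1) *s (l \<bullet>\<^sub>S e1)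
      + (x2 * y3 + x3 * y2) *s (l \<bullet>\<^sub>S e2) + (x3 * y3) *s (l \<bullet>\<^sub>S l)"
      unfolding sym_mult_linear sym_mult_commute[of l e1] sym_mult_commute[of l e2] sym_mult_commute[of e2 e1]
      by (simp add: vec_eq_iff algebra_simps)
    finally show ?thesis unfolding x1_x2_x3_y1_y2_y3_def .
  qed
  have m12: "minor (psi l u v a b) 1 2 = l \<bullet>\<^sub>S w"
  proof -
    have "minor (psi l u v a b) 1 2 = (dotW f1 a * dotW f1 v - dotW f1 b * dotW f1 u) *s (e1 \<bullet>\<^sub>S e1)
      + (dotW f1 a * dotW f2 v + dotW f2 a * dotW f1 v - dotW f1 b * dotW f2 u - dotW f2 b * dotW f1 u) *s (e1 \<bullet>\<^sub>S e2)
      + (dotW f2 a * dotW f2 v - dotW f2 b * dotW f2 u) *s (e2 \<bullet>\<^sub>S e2) + l \<bullet>\<^sub>S w"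
      unfolding psi_minors prod[of a v] prod[of b u] w_def sym_mult_linear
      by (simp add: vec_eq_iff algebra_simps)
    then show ?thesis unfolding q1 q2 q12 by simp
  qed
  have lm: "l \<bullet>\<^sub>S x = dotW f1 x *s (l \<bullet>\<^sub>S e1) + dotW f2 x *s (l \<bullet>\<^sub>S e2) + dotW f3 x *s (l \<bullet>\<^sub>S l)" for x
    by (subst expand[of x]) (simp only: sym_mult_linear)
  have neg: "- (l \<bullet>\<^sub>S x) = (- dotW f1 x) *s (l \<bullet>\<^sub>S e1) + (- dotW f2 x) *s (l \<bullet>\<^sub>S e2) + (- dotW f3 x) *s (l \<bullet>\<^sub>S l)" for x
    unfolding lm[of x] by (simp add: vec_eq_iff)
  obtain \<kappa> where \<kappa>: "minors_wedge (psi l u v a b) = \<kappa> *s wedge3 (l \<bullet>\<^sub>S e1) (l \<bullet>\<^sub>S e2) (l \<bullet>\<^sub>S l)"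
    unfolding minors_wedge_def m12 psi_minors(2,3) neg lm[of w] wedge3_combination by blast
  define c0 :: "complex ^ ((2 \<times> 3) option)" where "c0 = axis None 1"
  have c2: "minors_wedge (chart2 c0) = wedge3 (0 *s (l \<bullet>\<^sub>S e1) + 0 *s (l \<bullet>\<^sub>S e2) + 1 *s (l \<bullet>\<^sub>S l))
      (1 *s (l \<bullet>\<^sub>S e1) + 0 *s (l \<bullet>\<^sub>S e2) + 0 *s (l \<bullet>\<^sub>S l)) (0 *s (l \<bullet>\<^sub>S e1) + (-1) *s (l \<bullet>\<^sub>S e2) + 0 *s (l \<bullet>\<^sub>S l))"
    unfolding minors_wedge_def minor_def chart2_def c0_def
    by (simp add: axis_def sym_mult_linear sym_mult_commute[of e2 l])
  have "minors_wedge (chart2 c0) = (-1) *s wedge3 (l \<bullet>\<^sub>S e1) (l \<bullet>\<^sub>S e2) (l \<bullet>\<^sub>S l)"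
    unfolding c2 wedge3_combination by simp
  then have "minors_wedge (psi l u v a b) = (- \<kappa>) *s minors_wedge (chart2 c0)" unfolding \<kappa> by simp
  moreover from this have "\<kappa> \<noteq> 0" using nz by auto
  ultimately have "line (minors_wedge (psi l u v a b)) = line (minors_wedge (chart2 c0))"
    using line_scale[of "- \<kappa>"] by simp
  moreover have "c0 $ None = 1" unfolding c0_def by (simp add: axis_def)
  ultimately show ?thesis using fr by blast
qed

section \<open>Dimensions of the tangent spaces of the divisor\<close>

lemma dim_kernel_of_form:
  fixes V :: "(complex ^ 'n::finite) set" and h :: "complex ^ 'n \<Rightarrow> complex"
  assumes V: "vec.subspace V" "vec.dim V = Suc d" and h: "\<And>v s w. h (v + s *s w) = h v + s * h w"
    and e: "e \<in> V" "h e \<noteq> 0"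
  shows "vec.dim {v \<in> V. h v = 0} = d"
proof -
  let ?K = "{v \<in> V. h v = 0}"
  have h0: "h 0 = 0" using h[of 0 "-1" 0] by simp
  have hs: "h (s *s w) = s * h w" for s w using h[of 0 s w] h0 by simp
  have sub: "vec.subspace ?K"
    using V(1) h[of _ 1] unfolding vec.subspace_def by (auto simp: h0 hs)
  have "V \<subseteq> vec.span (insert e ?K)"
  proof
    fix v assume v: "v \<in> V"
    define k where "k = v + (- (h v / h e)) *s e"
    have "h k = 0" unfolding k_def h using e by simp
    moreover have "k \<in> V"
      unfolding k_def using v e V(1) unfolding vec.subspace_def by blast
    ultimately have k: "k \<in> ?K" by blast
    have "v = k + (h v / h e) *s e" unfolding k_def by (simp add: vec_eq_iff)
    moreover have "k + (h v / h e) *s e \<in> vec.span (insert e ?K)"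
      using k by (intro vec.span_add vec.span_scale vec.span_base) auto
    ultimately show "v \<in> vec.span (insert e ?K)" by simp
  qed
  then have "vec.dim V \<le> vec.dim (insert e ?K)"
    using vec.dim_subset[of V "vec.span (insert e ?K)"] by simp
  also have "\<dots> \<le> Suc (vec.dim ?K)"
    by (simp add: vec.dim_insert)
  finally have "d \<le> vec.dim ?K" using V(2) by simp
  moreover have "vec.dim ?K < vec.dim V"
    using e by (intro vec.dim_psubset) (auto simp: vec.span_eq_iff[THEN iffD2, OF sub] vec.span_eq_iff[THEN iffD2, OF V(1)])
  ultimately show ?thesis using V(2) by simp
qed

text \<open>Every image of the differential of a chart is tangent to the divisor here, and the 7
  homogeneous parameters of the chart have independent images. One of the two charts contains the
  point.\<close>

lemma tangent_Dvar_dim_sing: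
  assumes "minors_wedge R \<noteq> 0" "kernel_vec R = 0"
  shows "7 \<le> vec.dim (cone_tangent_space Dvar (line (minors_wedge R)))"
proof -
  have sing: "line (minors_wedge R) \<in> sing_points" using assms unfolding sing_points_def by blast
  have main: "7 \<le> vec.dim (cone_tangent_space Dvar (line (minors_wedge R)))"
    if eq: "line (minors_wedge R) = line (minors_wedge (ch c0))"
      and dim: "vec.dim (range (\<lambda>c. dminors (ch c0) (ch c))) = CARD((2 \<times> 3) option)"
      and nz: "minors_wedge (ch c0) \<noteq> 0" for ch :: "complex ^ ((2 \<times> 3) option) \<Rightarrow> mat23" and c0
  proof -
    have k: "kernel_vec (ch c0) = 0" by (rule sing_pointsD[OF _ nz]) (use sing eq in simp)
    have "range (\<lambda>c. dminors (ch c0) (ch c)) \<subseteq> cone_tangent_space Dvar (line (minors_wedge R))"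
      unfolding eq using dminors_tangent_Dvar_sing[OF nz k] by blast
    from vec.dim_subset[OF this] show ?thesis unfolding dim by simp
  qed
  have "line (minors_wedge R) \<in> Dvar" using sing sing_points_subset_Dvar by blast
  then obtain l u v a b where psi: "line (minors_wedge R) = line (minors_wedge (psi l u v a b))"
    "minors_wedge (psi l u v a b) \<noteq> 0"
    unfolding Dvar_psi by blast
  show ?thesis
  proof (cases "\<exists>\<theta>. dotW \<theta> l = 0 \<and> dotW \<theta> a * dotW \<theta> v - dotW \<theta> b * dotW \<theta> u \<noteq> 0")
    case True
    then obtain e1 e2 e3 f1 f2 f3 c0 where fr: "frame e1 e2 e3 f1 f2 f3" "c0 $ None = 1"
      "line (minors_wedge (psi l u v a b)) = line (minors_wedge (frame.chart e1 e2 e3 c0))"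
      using psi_chart[OF psi(2)] by blast
    interpret frame e1 e2 e3 f1 f2 f3 by (rule fr)
    have "chart_coord None (minors_wedge (chart c0)) = 1" unfolding chart_coord_chart fr(2) by simp
    then have "minors_wedge (chart c0) \<noteq> 0"
      using homogeneous_poly_scale[OF homogeneous_chart_coord, of None 0 0] by auto
    then show ?thesis using main[of chart c0] chart_dim(1)[OF fr(2)] psi(1) fr(3) by simp
  next
    case False
    then obtain e1 e2 e3 f1 f2 f3 c0 where fr: "frame e1 e2 e3 f1 f2 f3" "c0 $ None = 1"
      "line (minors_wedge (psi l u v a b)) = line (minors_wedge (frame.chart2 e1 e2 e3 c0))"
      using psi_chart2[OF psi(2)] by blast
    interpret frame e1 e2 e3 f1 f2 f3 by (rule fr)
    have "chart2_coord None (minors_wedge (chart2 c0)) = 1" unfolding chart2_coord_chart2 fr(2) by simp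
    then have "minors_wedge (chart2 c0) \<noteq> 0"
      using homogeneous_poly_scale[OF homogeneous_chart2_coord, of None 0 0] by auto
    then show ?thesis using main[of chart2 c0] chart2_dim(1)[OF fr(2)] psi(1) fr(3) by simp
  qed
qed

text \<open>The coordinate \<open>T_top\<close> bounds the tangent space from above, the corrected
  curves bound it from below. As this coordinate is nonzero somewhere on the tangent space of Y, the
  dimension drops from 7 to 6.\<close>

lemma tangent_Dvar_dim_regular:
  assumes nz: "minors_wedge R \<noteq> 0" and top: "minors_wedge R $ T_top = 0" and k: "kernel_vec R \<noteq> 0"
  shows "vec.dim (cone_tangent_space Dvar (line (minors_wedge R))) = 6"
proof -
  have L: "line (minors_wedge R) \<in> Dvar" "line (minors_wedge R) \<notin> sing_points"
    using nz top k sing_pointsD unfolding Dvar_eq by blast+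
  obtain l u v a b where psi: "line (minors_wedge R) = line (minors_wedge (psi l u v a b))"
    "minors_wedge (psi l u v a b) \<noteq> 0" "l $ 3 = 0"
    using L(1) unfolding Dvar_psi by blast
  have "kernel_vec (psi l u v a b) \<noteq> 0" using L(2) psi unfolding sing_points_def by blast
  \<comment> \<open>The vector \<open>axis 3 1\<close> is the point x = y = 0. It lies on l = 0 and
    off the conic a v - b u, which puts the net into the first chart.\<close>
  then have "dotW (axis 3 1) a * dotW (axis 3 1) v - dotW (axis 3 1) b * dotW (axis 3 1) u \<noteq> 0"
    unfolding kernel_vec_def dotW_def using psi(3) by (auto simp: vec_eq_iff forall_3 axis_def)
  moreover have "dotW (axis 3 1) l = 0" using psi(3) unfolding dotW_def by (simp add: axis_def)
  ultimately obtain e1 e2 e3 f1 f2 f3 c0 where fr: "frame e1 e2 e3 f1 f2 f3" "c0 $ None = 1"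
    "line (minors_wedge (psi l u v a b)) = line (minors_wedge (frame.chart e1 e2 e3 c0))"
    using psi_chart[OF psi(2)] by blast
  interpret frame e1 e2 e3 f1 f2 f3 by (rule fr)
  let ?R = "chart c0"
  have eq: "line (minors_wedge R) = line (minors_wedge ?R)" using psi(1) fr(3) by simp
  have "chart_coord None (minors_wedge ?R) = 1" unfolding chart_coord_chart fr(2) by simp
  then have nz': "minors_wedge ?R \<noteq> 0"
    using homogeneous_poly_scale[OF homogeneous_chart_coord, of None 0 0] by auto
  have top': "minors_wedge ?R $ T_top = 0"
    using homogeneous_poly_line[OF homogeneous_poly_coord eq nz nz'] top by simp
  have k': "kernel_vec ?R \<noteq> 0" using L(2) nz' unfolding eq sing_points_def by blast
  let ?V = "cone_tangent_space Yvar (line (minors_wedge ?R))"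
  have V: "?V = range (\<lambda>c. dminors ?R (chart c))" by (rule tangent_Yvar_chart[OF fr(2)])
  have "cone_tangent_space Dvar (line (minors_wedge ?R)) = {w \<in> ?V. w $ T_top = 0}"
  proof
    have "w $ T_top = 0" if w: "w \<in> cone_tangent_space Dvar (line (minors_wedge ?R))" for w
    proof -
      have D: "has_differential vec_coords (\<lambda>v :: ext3S2W. v $ T_top) (\<lambda>v w. w $ T_top)"
        unfolding has_differential_def vec_coords_def by simp
      have "vanishes_on (\<lambda>v. v $ T_top) Dvar"
        unfolding Dvar_eq vanishes_on_lines[OF homogeneous_poly_coord] by blast
      then show ?thesis
        using w[unfolded mem_cone_tangent_space_iff[OF nz'], rule_format, of 1 "\<lambda>v. v $ T_top" "\<lambda>v w. w $ T_top"]
          D homogeneous_poly_coord by blast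
    qed
    then show "cone_tangent_space Dvar (line (minors_wedge ?R)) \<subseteq> {w \<in> ?V. w $ T_top = 0}"
      using cone_tangent_space_mono[OF Dvar_subset_Yvar] by blast
    show "{w \<in> ?V. w $ T_top = 0} \<subseteq> cone_tangent_space Dvar (line (minors_wedge ?R))"
      unfolding V using dminors_tangent_Dvar_regular[OF nz' k' top'] by blast
  qed
  moreover have "vec.dim {w \<in> ?V. w $ T_top = 0} = 6"
  proof -
    obtain E where E: "dminors ?R E $ T_top \<noteq> 0" using dminors_top_nonzero[OF nz' k'] by blast
    show ?thesis
    proof (rule dim_kernel_of_form[of ?V 6 "\<lambda>w. w $ T_top" "dminors ?R E"])
      show "vec.subspace ?V" by (rule subspace_cone_tangent_space[OF nz'])
      show "vec.dim ?V = Suc 6" unfolding V chart_dim(1)[OF fr(2)] by simp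
      show "dminors ?R E \<in> ?V" by (rule dminors_tangent_Yvar[OF nz'])
    qed (use E in simp_all)
  qed
  ultimately show ?thesis unfolding eq by simp
qed

section \<open>Chains of irreducible closed subsets through a point\<close>

definition psi_family :: "('a \<Rightarrow> W \<times> W \<times> W \<times> W \<times> W) \<Rightarrow> ext3S2W set set" where
  "psi_family \<Phi> = {line (minors_wedge (case \<Phi> x of (l, u, v, a, b) \<Rightarrow> psi l u v a b)) | x.
     minors_wedge (case \<Phi> x of (l, u, v, a, b) \<Rightarrow> psi l u v a b) \<noteq> 0}"

lemma prime_locus_psi_family:
  fixes l u v a b :: "'a::real_vector \<Rightarrow> W"
  assumes "\<And>m. polynomial_on_lines (\<lambda>x. l x $ m)" "\<And>m. polynomial_on_lines (\<lambda>x. u x $ m)"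
    "\<And>m. polynomial_on_lines (\<lambda>x. v x $ m)" "\<And>m. polynomial_on_lines (\<lambda>x. a x $ m)"
    "\<And>m. polynomial_on_lines (\<lambda>x. b x $ m)"
    and "psi_family (\<lambda>x. (l x, u x, v x, a x, b x)) \<noteq> {}"
  shows "prime_locus (psi_family (\<lambda>x. (l x, u x, v x, a x, b x)))"
proof -
  obtain x0 where "minors_wedge (psi (l x0) (u x0) (v x0) (a x0) (b x0)) \<noteq> 0"
    using assms(6) unfolding psi_family_def by auto
  moreover have "polynomial_on_lines (\<lambda>x. psi (l x) (u x) (v x) (a x) (b x) $ i $ j $ m)" for i j m
    using exhaust_2[of i] exhaust_3[of j] assms(1-5) polynomial_on_lines_const[of 0] by (elim disjE) simp_all
  ultimately show ?thesis
    unfolding psi_family_def prod.case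
    by (intro prime_locus_minors_wedge[where \<Phi> = "\<lambda>x. psi (l x) (u x) (v x) (a x) (b x)"])
qed

lemma psi_family_memI:
  assumes "minors_wedge (psi l u v a b) \<noteq> 0" "\<Phi> x = (l, u, v, a, b)"
  shows "line (minors_wedge (psi l u v a b)) \<in> psi_family \<Phi>"
  unfolding psi_family_def mem_Collect_eq using assms by (intro exI[of _ x]) simp

lemma psi_family_subset:
  assumes "\<And>x. \<exists>y. \<Phi> x = \<Psi> y"
  shows "psi_family \<Phi> \<subseteq> psi_family \<Psi>"
proof
  fix L assume "L \<in> psi_family \<Phi>"
  then obtain x where x: "L = line (minors_wedge (case \<Phi> x of (l, u, v, a, b) \<Rightarrow> psi l u v a b))"
    "minors_wedge (case \<Phi> x of (l, u, v, a, b) \<Rightarrow> psi l u v a b) \<noteq> 0"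
    unfolding psi_family_def by blast
  obtain y where "\<Phi> x = \<Psi> y" using assms by blast
  then show "L \<in> psi_family \<Psi>"
    unfolding psi_family_def mem_Collect_eq using x by (intro exI[of _ y]) simp
qed

lemma vanishes_on_psi_family:
  assumes "homogeneous_poly d f"
  shows "vanishes_on f (psi_family \<Phi>) \<longleftrightarrow>
    (\<forall>x l u v a b. \<Phi> x = (l, u, v, a, b) \<and> minors_wedge (psi l u v a b) \<noteq> 0 \<longrightarrow> f (minors_wedge (psi l u v a b)) = 0)"
proof -
  let ?M = "\<lambda>x. minors_wedge (case \<Phi> x of (l, u, v, a, b) \<Rightarrow> psi l u v a b)"
  have "vanishes_on f (psi_family \<Phi>) \<longleftrightarrow> (\<forall>x. ?M x \<noteq> 0 \<longrightarrow> f (?M x) = 0)"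
    unfolding psi_family_def using vanishes_on_lines[OF assms, of ?M "\<lambda>_. True"] by simp
  also have "\<dots> \<longleftrightarrow> (\<forall>x l u v a b. \<Phi> x = (l, u, v, a, b) \<and> minors_wedge (psi l u v a b) \<noteq> 0 \<longrightarrow> f (minors_wedge (psi l u v a b)) = 0)"
    by (auto split: prod.splits)
  finally show ?thesis .
qed

lemma homogeneous_zero: "homogeneous_poly 1 f \<Longrightarrow> f 0 = 0"
  using homogeneous_poly_scale[of 1 f 0 0] by simp

lemma separating_form:
  assumes f: "homogeneous_poly 1 f"
    and zero: "\<And>x l u v a b. \<Phi> x = (l, u, v, a, b) \<Longrightarrow> f (minors_wedge (psi l u v a b)) = 0"
    and S: "f (minors_wedge (psi l u v a b)) \<noteq> 0"
      "minors_wedge (psi l u v a b) \<noteq> 0 \<Longrightarrow> line (minors_wedge (psi l u v a b)) \<in> S"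
  shows "separated (psi_family \<Phi>) S"
proof (intro exI conjI)
  show "homogeneous_poly 1 f" by (rule f)
  show "vanishes_on f (psi_family \<Phi>)" unfolding vanishes_on_psi_family[OF f] using zero by blast
  have "minors_wedge (psi l u v a b) \<noteq> 0" using S(1) homogeneous_zero[OF f] by auto
  then show "\<not> vanishes_on f S" using S unfolding vanishes_on_def by blast
qed

text \<open>Later, g1 separates the point c from the line through c and d, and g2 separates this
  line from the plane.\<close>

lemma flag_in_3space:
  fixes c :: "complex ^ 3"
  assumes "c \<noteq> 0"
  shows "\<exists>d e g1 g2. dotW g1 c = 0 \<and> dotW g2 c = 0 \<and> dotW g2 d = 0 \<and> dotW g1 d \<noteq> 0 \<and> dotW g2 e \<noteq> 0"
proof -
  consider "c $ 1 \<noteq> 0" | "c $ 2 \<noteq> 0" | "c $ 3 \<noteq> 0"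
    using assms by (auto simp: vec_eq_iff forall_3)
  then show ?thesis
  proof cases
    case 1
    then show ?thesis
      by (intro exI[of _ "vector [0, 1, 0]"] exI[of _ "vector [0, 0, 1]"]
          exI[of _ "vector [- c$2, c$1, 0]"] exI[of _ "vector [- c$3, 0, c$1]"]) (simp add: dotW_def)
  next
    case 2
    then show ?thesis
      by (intro exI[of _ "vector [1, 0, 0]"] exI[of _ "vector [0, 0, 1]"]
          exI[of _ "vector [c$2, - c$1, 0]"] exI[of _ "vector [0, - c$3, c$2]"]) (simp add: dotW_def)
  next
    case 3
    then show ?thesis
      by (intro exI[of _ "vector [1, 0, 0]"] exI[of _ "vector [0, 1, 0]"]
          exI[of _ "vector [c$3, 0, - c$1]"] exI[of _ "vector [0, c$3, - c$2]"]) (simp add: dotW_def)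
  qed
qed

definition flag_between :: "ext3S2W set \<Rightarrow> ext3S2W set set \<Rightarrow> bool" where
  "flag_between p S \<longleftrightarrow> (\<exists>I. prime_locus {p} \<and> prime_locus I \<and> p \<in> I \<and> I \<subseteq> S \<and> separated {p} I \<and> separated I S)"

text \<open>For fixed \<open>l, u, v\<close> the points \<open>psi l u v a b\<close> form a plane; this supplies the bottom
  of the chains: a point, a line and the plane.\<close>

lemma psi_plane_flag:
  fixes p1 p2 p3 :: "ext3S2W \<Rightarrow> complex" and P :: "W \<Rightarrow> W \<Rightarrow> complex ^ 3"
  assumes hom: "homogeneous_poly 1 p1" "homogeneous_poly 1 p2" "homogeneous_poly 1 p3"
    and P: "\<And>a b. vector [p1 (minors_wedge (psi l u v a b)), p2 (minors_wedge (psi l u v a b)),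
        p3 (minors_wedge (psi l u v a b))] = P a b"
    and lin: "\<And>s t a b a' b'. P (s *s a + t *s a') (s *s b + t *s b') = s *s P a b + t *s P a' b'"
    and surj: "\<And>c. \<exists>a b. P a b = c"
    and nz: "minors_wedge (psi l u v a0 b0) \<noteq> 0" "P a0 b0 \<noteq> 0"
  shows "flag_between (line (minors_wedge (psi l u v a0 b0))) (psi_family (\<lambda>(a, b). (l, u, v, a, b)))"
proof -
  obtain d e g1 g2 where g: "dotW g1 (P a0 b0) = 0" "dotW g2 (P a0 b0) = 0" "dotW g2 d = 0" "dotW g1 d \<noteq> 0" "dotW g2 e \<noteq> 0"
    using flag_in_3space[OF nz(2)] by blast
  obtain a1 b1 where d: "P a1 b1 = d" using surj by blast
  obtain a2 b2 where e: "P a2 b2 = e" using surj by blast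
  define \<Phi> where "\<Phi> = (\<lambda>x :: complex \<times> complex. (l, u, v, fst x *s a0 + snd x *s a1, fst x *s b0 + snd x *s b1))"
  define G where "G = (\<lambda>(g :: complex ^ 3) \<omega>. g$1 * p1 \<omega> + g$2 * p2 \<omega> + g$3 * p3 \<omega>)"
  have homG: "homogeneous_poly 1 (G g)" for g :: "complex ^ 3"
    unfolding G_def by (intro homogeneous_poly_add homogeneous_poly_cmult hom)
  have GP: "G g (minors_wedge (psi l u v a b)) = dotW g (P a b)" for g a b
    unfolding G_def dotW_def P[symmetric] by simp
  have mem: "line (minors_wedge (psi l u v a0 b0)) \<in> psi_family \<Phi>"
    by (rule psi_family_memI[OF nz(1), of _ "(1, 0)"]) (simp add: \<Phi>_def)
  have mem1: "line (minors_wedge (psi l u v a1 b1)) \<in> psi_family \<Phi>"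
    if "minors_wedge (psi l u v a1 b1) \<noteq> 0"
    by (rule psi_family_memI[OF that, of _ "(0, 1)"]) (simp add: \<Phi>_def)
  have mem2: "line (minors_wedge (psi l u v a2 b2)) \<in> psi_family (\<lambda>(a, b). (l, u, v, a, b))"
    if "minors_wedge (psi l u v a2 b2) \<noteq> 0"
    by (rule psi_family_memI[OF that, of _ "(a2, b2)"]) simp
  show ?thesis
    unfolding flag_between_def
  proof (intro exI[of _ "psi_family \<Phi>"] conjI)
    have "psi_family (\<lambda>x :: complex. (l, u, v, a0, b0)) = {line (minors_wedge (psi l u v a0 b0))}"
      unfolding psi_family_def using nz(1) by auto
    then show "prime_locus {line (minors_wedge (psi l u v a0 b0))}"
      using prime_locus_psi_family[of "\<lambda>x :: complex. l" "\<lambda>x. u" "\<lambda>x. v" "\<lambda>x. a0" "\<lambda>x. b0"] polynomial_on_lines_const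
      by fastforce
    show "prime_locus (psi_family \<Phi>)"
      unfolding \<Phi>_def
    proof (rule prime_locus_psi_family)
      show "psi_family (\<lambda>x. (l, u, v, fst x *s a0 + snd x *s a1, fst x *s b0 + snd x *s b1)) \<noteq> {}"
        using mem unfolding \<Phi>_def by blast
    qed (rule polynomial_on_lines_const, (rule polynomial_on_lines_const)+,
        (rule polynomial_on_lines_linear, simp add: scaleR_conv_of_real[where 'a = complex] algebra_simps)+)
    show "line (minors_wedge (psi l u v a0 b0)) \<in> psi_family \<Phi>" by (rule mem)
    show "psi_family \<Phi> \<subseteq> psi_family (\<lambda>(a, b). (l, u, v, a, b))"
      by (rule psi_family_subset) (auto simp: \<Phi>_def)
    show "separated {line (minors_wedge (psi l u v a0 b0))} (psi_family \<Phi>)"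
    proof (intro exI conjI)
      show "homogeneous_poly 1 (G g1)" by (rule homG)
      show "vanishes_on (G g1) {line (minors_wedge (psi l u v a0 b0))}"
        unfolding vanishes_on_line[OF homG nz(1)] GP by (rule g)
      have "G g1 (minors_wedge (psi l u v a1 b1)) \<noteq> 0" unfolding GP d by (rule g)
      moreover from this have "minors_wedge (psi l u v a1 b1) \<noteq> 0" using homogeneous_zero[OF homG] by metis
      ultimately show "\<not> vanishes_on (G g1) (psi_family \<Phi>)"
        using mem1 unfolding vanishes_on_def by blast
    qed
    show "separated (psi_family \<Phi>) (psi_family (\<lambda>(a, b). (l, u, v, a, b)))"
    proof (rule separating_form[OF homG[of g2]])
      show "G g2 (minors_wedge (psi l u v a2 b2)) \<noteq> 0" unfolding GP e by (rule g)
      show "G g2 (minors_wedge (psi l' u' v' a' b')) = 0" if "\<Phi> x = (l', u', v', a', b')" for x l' u' v' a' b'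
      proof -
        have "l' = l" "u' = u" "v' = v" "a' = fst x *s a0 + snd x *s a1" "b' = fst x *s b0 + snd x *s b1"
          using that unfolding \<Phi>_def by auto
        then show ?thesis by (simp only: GP lin d dotW_linear g) simp
      qed
    qed (rule mem2)
  qed
qed

lemma pluecker_psi:
  "pluecker \<alpha> \<beta> \<gamma> (minors_wedge (psi l u v a b)) =
     pairing \<alpha> (a \<bullet>\<^sub>S v - b \<bullet>\<^sub>S u) * (pairing \<beta> (l \<bullet>\<^sub>S u) * pairing \<gamma> (l \<bullet>\<^sub>S v) - pairing \<beta> (l \<bullet>\<^sub>S v) * pairing \<gamma> (l \<bullet>\<^sub>S u))
   - pairing \<alpha> (l \<bullet>\<^sub>S u) * (pairing \<beta> (a \<bullet>\<^sub>S v - b \<bullet>\<^sub>S u) * pairing \<gamma> (l \<bullet>\<^sub>S v) - pairing \<beta> (l \<bullet>\<^sub>S v) * pairing \<gamma> (a \<bullet>\<^sub>S v - b \<bullet>\<^sub>S u))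
   + pairing \<alpha> (l \<bullet>\<^sub>S v) * (pairing \<beta> (a \<bullet>\<^sub>S v - b \<bullet>\<^sub>S u) * pairing \<gamma> (l \<bullet>\<^sub>S u) - pairing \<beta> (l \<bullet>\<^sub>S u) * pairing \<gamma> (a \<bullet>\<^sub>S v - b \<bullet>\<^sub>S u))"
  unfolding minors_wedge_def pluecker_wedge3 psi_minors pairing_linear by (simp add: algebra_simps)

lemmas pluecker_psi_eval = pluecker_psi pairing_linear pairing_polar pairing_square_eval

lemma psi_dependent:
  assumes "minor (psi l u v a b) 1 2 = s *s minor (psi l u v a b) 1 3 + t *s minor (psi l u v a b) 2 3"
  shows "minors_wedge (psi l u v a b) = 0"
proof -
  have "1 *s minor (psi l u v a b) 1 2 + (- s) *s minor (psi l u v a b) 1 3 + (- t) *s minor (psi l u v a b) 2 3 = 0"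
    unfolding assms by (simp add: vec_eq_iff)
  then show ?thesis
    using stable_iff unfolding stable_def by (metis zero_neq_one)
qed

lemma psi_family_subset_Dvar:
  assumes "l $ 3 = 0" "\<And>x. fst (\<Phi> x) = l"
  shows "psi_family \<Phi> \<subseteq> Dvar"
proof
  fix L assume "L \<in> psi_family \<Phi>"
  then obtain x where "L = line (minors_wedge (case \<Phi> x of (l, u, v, a, b) \<Rightarrow> psi l u v a b))"
    "minors_wedge (case \<Phi> x of (l, u, v, a, b) \<Rightarrow> psi l u v a b) \<noteq> 0"
    unfolding psi_family_def by blast
  moreover obtain u v a b where "\<Phi> x = (l, u, v, a, b)"
    using assms(2)[of x] by (cases "\<Phi> x") auto
  ultimately have "L = line (minors_wedge (psi l u v a b))" "minors_wedge (psi l u v a b) \<noteq> 0" by simp_all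
  then show "L \<in> Dvar" unfolding Dvar_psi using assms(1) by blast
qed

lemma poly_lines_complex_linear:
  fixes p :: "'a::real_vector \<Rightarrow> W"
  assumes "\<And>u w s. p (u + s *\<^sub>R w) = p u + s *\<^sub>R p w"
  shows "polynomial_on_lines (\<lambda>x. p x $ m)"
  by (rule polynomial_on_lines_linear) (simp add: assms scaleR_conv_of_real[where 'a = complex])

lemma prime_plane:
  assumes "minors_wedge (psi l u v a0 b0) \<noteq> 0"
  shows "prime_locus (psi_family (\<lambda>(a, b). (l, u, v, a, b)))"
proof -
  have "prime_locus (psi_family (\<lambda>x. (l, u, v, fst x, snd x)))"
  proof (rule prime_locus_psi_family)
    show "psi_family (\<lambda>x. (l, u, v, fst x, snd x)) \<noteq> {}"
      using psi_family_memI[OF assms, of "\<lambda>x. (l, u, v, fst x, snd x)" "(a0, b0)"] by auto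
  qed (rule polynomial_on_lines_const, (rule polynomial_on_lines_const)+, (rule poly_lines_complex_linear, simp)+)
  then show ?thesis by (simp add: case_prod_unfold)
qed

lemma prime_fixed_l_u:
  assumes "minors_wedge (psi l u v0 a0 b0) \<noteq> 0"
  shows "prime_locus (psi_family (\<lambda>(v, a, b). (l, u, v, a, b)))"
proof -
  have "prime_locus (psi_family (\<lambda>x. (l, u, fst x, fst (snd x), snd (snd x))))"
  proof (rule prime_locus_psi_family)
    show "psi_family (\<lambda>x. (l, u, fst x, fst (snd x), snd (snd x))) \<noteq> {}"
      using psi_family_memI[OF assms, of "\<lambda>x. (l, u, fst x, fst (snd x), snd (snd x))" "(v0, a0, b0)"] by auto
  qed (rule polynomial_on_lines_const, rule polynomial_on_lines_const, (rule poly_lines_complex_linear, simp)+)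
  then show ?thesis by (simp add: case_prod_unfold)
qed

lemma prime_fixed_l:
  assumes "minors_wedge (psi l u0 v0 a0 b0) \<noteq> 0"
  shows "prime_locus (psi_family (\<lambda>(u, v, a, b). (l, u, v, a, b)))"
proof -
  have "prime_locus (psi_family (\<lambda>x. (l, fst x, fst (snd x), fst (snd (snd x)), snd (snd (snd x)))))"
  proof (rule prime_locus_psi_family)
    show "psi_family (\<lambda>x. (l, fst x, fst (snd x), fst (snd (snd x)), snd (snd (snd x)))) \<noteq> {}"
      using psi_family_memI[OF assms, of "\<lambda>x. (l, fst x, fst (snd x), fst (snd (snd x)), snd (snd (snd x)))" "(u0, v0, a0, b0)"]
      by auto
  qed (rule polynomial_on_lines_const, (rule poly_lines_complex_linear, simp)+)
  then show ?thesis by (simp add: case_prod_unfold)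
qed

text \<open>After point, line and plane, the data v, u and finally l are released: six sets, five
  steps.\<close>

lemma krull_chain_psi:
  assumes l: "l $ 3 = 0" and nz: "minors_wedge (psi l u v a0 b0) \<noteq> 0"
    and fl: "flag_between (line (minors_wedge (psi l u v a0 b0))) (psi_family (\<lambda>(a, b). (l, u, v, a, b)))"
    and s: "separated (psi_family (\<lambda>(a, b). (l, u, v, a, b))) (psi_family (\<lambda>(v, a, b). (l, u, v, a, b)))"
      "separated (psi_family (\<lambda>(v, a, b). (l, u, v, a, b))) (psi_family (\<lambda>(u, v, a, b). (l, u, v, a, b)))"
      "separated (psi_family (\<lambda>(u, v, a, b). (l, u, v, a, b))) Dvar"
  shows "5 \<le> krull_dim_at (subtopology zariski Dvar) (line (minors_wedge (psi l u v a0 b0)))"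
proof -
  let ?p = "line (minors_wedge (psi l u v a0 b0))"
  let ?I2 = "psi_family (\<lambda>(a, b). (l, u, v, a, b))" and ?I3 = "psi_family (\<lambda>(v, a, b). (l, u, v, a, b))"
    and ?I4 = "psi_family (\<lambda>(u, v, a, b). (l, u, v, a, b))"
  obtain I where I: "prime_locus {?p}" "prime_locus I" "?p \<in> I" "I \<subseteq> ?I2" "separated {?p} I" "separated I ?I2"
    using fl unfolding flag_between_def by blast
  have sub: "?I2 \<subseteq> ?I3" "?I3 \<subseteq> ?I4" by (rule psi_family_subset; auto)+
  have "?I4 \<subseteq> Dvar" by (rule psi_family_subset_Dvar[OF l]) auto
  then have D: "?I4 \<subseteq> Dvar" "?I3 \<subseteq> Dvar" "?I2 \<subseteq> Dvar" "I \<subseteq> Dvar" "?p \<in> Dvar"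
    using sub I(3,4) by blast+
  have lt: "i < 5 \<Longrightarrow> i = 0 \<or> i = 1 \<or> i = 2 \<or> i = 3 \<or> i = 4" for i :: nat by linarith
  have "enat 5 \<le> krull_dim_at (subtopology zariski Dvar) ?p"
  proof (rule krull_dim_at_ge_list[of _ "[{?p}, I, ?I2, ?I3, ?I4, Dvar]"])
    show "\<forall>i<5. [{?p}, I, ?I2, ?I3, ?I4, Dvar] ! i \<subseteq> [{?p}, I, ?I2, ?I3, ?I4, Dvar] ! Suc i \<and>
        separated ([{?p}, I, ?I2, ?I3, ?I4, Dvar] ! i) ([{?p}, I, ?I2, ?I3, ?I4, Dvar] ! Suc i)"
    proof (intro allI impI)
      fix i :: nat assume "i < 5"
      from lt[OF this] show "[{?p}, I, ?I2, ?I3, ?I4, Dvar] ! i \<subseteq> [{?p}, I, ?I2, ?I3, ?I4, Dvar] ! Suc i \<and>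
          separated ([{?p}, I, ?I2, ?I3, ?I4, Dvar] ! i) ([{?p}, I, ?I2, ?I3, ?I4, Dvar] ! Suc i)"
        by (elim disjE) (use I(3-6) sub D(1) s in simp_all)
    qed
  qed (use I(1,2) D Dvar_proj prime_plane[OF nz] prime_fixed_l_u[OF nz] prime_fixed_l[OF nz] prime_locus_Dvar in simp_all)
  then show ?thesis by (simp add: numeral_eq_enat)
qed

context frame
begin

text \<open>In each of the two Pluecker forms, two functionals involve only the points f2, f3 of e1
  = 0 and so kill e1 u and e1 v; hence the determinant is 0. The linear form m lies in the span of x
  and y but is not proportional to e1, and one of the two Pluecker forms detects this.\<close>

lemma separating_form_Dvar:
  assumes e1: "e1 $ 3 = 0"
  shows "separated (psi_family (\<lambda>(u, v, a, b). (e1, u, v, a, b))) Dvar"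
proof -
  define m :: W where "m = (if e1 $ 2 = 0 then yW else xW)"
  have m3: "m $ 3 = 0" unfolding m_def xW_def yW_def by (simp add: axis_def)
  have "dotW f2 m \<noteq> 0 \<or> dotW f3 m \<noteq> 0"
  proof (rule ccontr)
    assume "\<not> ?thesis"
    then have m: "m = dotW f1 m *s e1" using expand[of m] by simp
    have m12: "m $ 1 = dotW f1 m * e1 $ 1" "m $ 2 = dotW f1 m * e1 $ 2"
      using arg_cong[OF m, of "\<lambda>u. u $ 1"] arg_cong[OF m, of "\<lambda>u. u $ 2"] by simp_all
    show False
    proof (cases "e1 $ 2 = 0")
      case True
      then have "m $ 2 = 1" unfolding m_def yW_def by (simp add: axis_def)
      then show False using m12(2) True by simp
    next
      case False
      then have "m $ 1 = 1" "m $ 2 = 0" unfolding m_def xW_def by (simp_all add: axis_def)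
      then show False using m12 False by simp
    qed
  qed
  then show ?thesis
  proof
    assume m: "dotW f2 m \<noteq> 0"
    show ?thesis
    proof (rule separating_form[OF homogeneous_pluecker])
      show "pluecker (polar f1 f2) (square_eval f2) (polar f2 f3) (minors_wedge (psi m e2 e3 0 (- e1))) \<noteq> 0"
        using m by (simp add: pluecker_psi_eval algebra_simps)
      show "line (minors_wedge (psi m e2 e3 0 (- e1))) \<in> Dvar" if "minors_wedge (psi m e2 e3 0 (- e1)) \<noteq> 0"
        using that m3 unfolding Dvar_psi by blast
    qed (auto simp: pluecker_psi_eval)
  next
    assume m: "dotW f3 m \<noteq> 0"
    show ?thesis
    proof (rule separating_form[OF homogeneous_pluecker])
      show "pluecker (polar f1 f3) (square_eval f3) (polar f2 f3) (minors_wedge (psi m e2 e3 e1 0)) \<noteq> 0"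
        using m by (simp add: pluecker_psi_eval algebra_simps)
      show "line (minors_wedge (psi m e2 e3 e1 0)) \<in> Dvar" if "minors_wedge (psi m e2 e3 e1 0) \<noteq> 0"
        using that m3 unfolding Dvar_psi by blast
    qed (auto simp: pluecker_psi_eval)
  qed
qed

text \<open>The conic a e3 - b e2 has no e1^2 term and matters only modulo e1 e2 and e1 e3. What
  remains are its coefficients at e2^2, e2 e3, e3^2, the coordinates P of the plane.\<close>

lemma psi_plane_general:
  assumes nz: "minors_wedge (psi e1 e2 e3 a0 b0) \<noteq> 0"
  shows "flag_between (line (minors_wedge (psi e1 e2 e3 a0 b0))) (psi_family (\<lambda>(a, b). (e1, e2, e3, a, b)))"
proof -
  define P :: "W \<Rightarrow> W \<Rightarrow> complex ^ 3" where "P = (\<lambda>a b. vector [- dotW f2 b, dotW f2 a - dotW f3 b, dotW f3 a])"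
  have Pnz: "P a0 b0 \<noteq> 0"
  proof
    assume "P a0 b0 = 0"
    then have z: "dotW f2 b0 = 0" "dotW f3 b0 = dotW f2 a0" "dotW f3 a0 = 0"
      unfolding P_def by (simp_all add: vec_eq_iff forall_3)
    have a: "a0 = dotW f1 a0 *s e1 + dotW f2 a0 *s e2" and b: "b0 = dotW f1 b0 *s e1 + dotW f2 a0 *s e3"
      using expand[of a0] expand[of b0] z by simp_all
    have "a0 \<bullet>\<^sub>S e3 - b0 \<bullet>\<^sub>S e2 = dotW f1 a0 *s (e1 \<bullet>\<^sub>S e3) - dotW f1 b0 *s (e1 \<bullet>\<^sub>S e2)"
      by (subst a, subst b, simp only: sym_mult_linear sym_mult_commute[of e3 e2]) (simp add: vec_eq_iff)
    then have "minor (psi e1 e2 e3 a0 b0) 1 2 = dotW f1 b0 *s minor (psi e1 e2 e3 a0 b0) 1 3 + (- dotW f1 a0) *s minor (psi e1 e2 e3 a0 b0) 2 3"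
      unfolding psi_minors by (simp add: vec_eq_iff)
    then show False using psi_dependent nz by blast
  qed
  have surj: "\<exists>a b. P a b = c" for c
    by (rule exI[of _ "c$2 *s e2 + c$3 *s e3"], rule exI[of _ "(- c$1) *s e2"])
      (simp add: P_def vec_eq_iff forall_3)
  show ?thesis
    by (rule psi_plane_flag[OF homogeneous_pluecker[of "polar f1 f2" "polar f1 f3" "square_eval f2"]
          homogeneous_pluecker[of "polar f1 f2" "polar f1 f3" "polar f2 f3"]
          homogeneous_pluecker[of "polar f1 f2" "polar f1 f3" "square_eval f3"] _ _ surj nz Pnz])
      (simp add: P_def pluecker_psi_eval, simp add: P_def vec_eq_iff forall_3 algebra_simps)
qed

text \<open>The net contains e1^2 and e1 e2, and a e2 - b e1 has no e3^2 term. Its coefficients at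
  e1 e3, e2^2, e2 e3 are the coordinates P.\<close>

lemma psi_plane_special:
  assumes nz: "minors_wedge (psi e1 e1 e2 a0 b0) \<noteq> 0"
  shows "flag_between (line (minors_wedge (psi e1 e1 e2 a0 b0))) (psi_family (\<lambda>(a, b). (e1, e1, e2, a, b)))"
proof -
  define P :: "W \<Rightarrow> W \<Rightarrow> complex ^ 3" where "P = (\<lambda>a b. vector [- dotW f3 b, dotW f2 a, dotW f3 a])"
  have Pnz: "P a0 b0 \<noteq> 0"
  proof
    assume "P a0 b0 = 0"
    then have z: "dotW f3 b0 = 0" "dotW f2 a0 = 0" "dotW f3 a0 = 0"
      unfolding P_def by (simp_all add: vec_eq_iff forall_3)
    have a: "a0 = dotW f1 a0 *s e1" and b: "b0 = dotW f1 b0 *s e1 + dotW f2 b0 *s e2"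
      using expand[of a0] expand[of b0] z by simp_all
    have "a0 \<bullet>\<^sub>S e2 - b0 \<bullet>\<^sub>S e1 = (dotW f1 a0 - dotW f2 b0) *s (e1 \<bullet>\<^sub>S e2) - dotW f1 b0 *s (e1 \<bullet>\<^sub>S e1)"
      by (subst a, subst b, simp only: sym_mult_linear sym_mult_commute[of e2 e1]) (simp add: vec_eq_iff algebra_simps)
    then have "minor (psi e1 e1 e2 a0 b0) 1 2 = dotW f1 b0 *s minor (psi e1 e1 e2 a0 b0) 1 3 + (dotW f2 b0 - dotW f1 a0) *s minor (psi e1 e1 e2 a0 b0) 2 3"
      unfolding psi_minors by (simp add: vec_eq_iff algebra_simps)
    then show False using psi_dependent nz by blast
  qed
  have surj: "\<exists>a b. P a b = c" for c
    by (rule exI[of _ "c$2 *s e2 + c$3 *s e3"], rule exI[of _ "(- c$1) *s e3"])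
      (simp add: P_def vec_eq_iff forall_3)
  show ?thesis
    by (rule psi_plane_flag[OF homogeneous_pluecker[of "square_eval f1" "polar f1 f2" "polar f1 f3"]
          homogeneous_pluecker[of "square_eval f1" "polar f1 f2" "square_eval f2"]
          homogeneous_pluecker[of "square_eval f1" "polar f1 f2" "polar f2 f3"] _ _ surj nz Pnz])
      (simp add: P_def pluecker_psi_eval, simp add: P_def vec_eq_iff forall_3 algebra_simps)
qed

lemma krull_dim_at_general:
  assumes e1: "e1 $ 3 = 0" and nz: "minors_wedge (psi e1 e2 e3 a0 b0) \<noteq> 0"
  shows "5 \<le> krull_dim_at (subtopology zariski Dvar) (line (minors_wedge (psi e1 e2 e3 a0 b0)))"
proof -
  \<comment> \<open>Evaluation at f1 kills e1 e2, e1 e3 and a e3 - b e2.\<close>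
  have s2: "separated (psi_family (\<lambda>(a, b). (e1, e2, e3, a, b))) (psi_family (\<lambda>(v, a, b). (e1, e2, v, a, b)))"
  proof (rule separating_form[OF homogeneous_pluecker])
    show "pluecker (square_eval f1) (polar f1 f2) (square_eval f2) (minors_wedge (psi e1 e2 e1 0 (- e2))) \<noteq> 0"
      by (simp add: pluecker_psi_eval)
    show "line (minors_wedge (psi e1 e2 e1 0 (- e2))) \<in> psi_family (\<lambda>(v, a, b). (e1, e2, v, a, b))"
      if "minors_wedge (psi e1 e2 e1 0 (- e2)) \<noteq> 0"
      by (rule psi_family_memI[OF that, of _ "(e1, 0, - e2)"]) simp
  qed (auto simp: pluecker_psi_eval)
  \<comment> \<open>All three functionals kill the generator e1 e2.\<close>
  have s3: "separated (psi_family (\<lambda>(v, a, b). (e1, e2, v, a, b))) (psi_family (\<lambda>(u, v, a, b). (e1, u, v, a, b)))"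
  proof (rule separating_form[OF homogeneous_pluecker])
    show "pluecker (square_eval f1) (polar f1 f3) (square_eval f3) (minors_wedge (psi e1 e1 e3 e3 0)) \<noteq> 0"
      by (simp add: pluecker_psi_eval)
    show "line (minors_wedge (psi e1 e1 e3 e3 0)) \<in> psi_family (\<lambda>(u, v, a, b). (e1, u, v, a, b))"
      if "minors_wedge (psi e1 e1 e3 e3 0) \<noteq> 0"
      by (rule psi_family_memI[OF that, of _ "(e1, e3, e3, 0)"]) simp
  qed (auto simp: pluecker_psi_eval)
  show ?thesis
    by (rule krull_chain_psi[OF e1 nz psi_plane_general[OF nz] s2 s3 separating_form_Dvar[OF e1]])
qed

text \<open>Each separating form vanishes on the smaller family because its three functionals kill a
  common generator: e1 e2 in the first case, e1^2 in the second.\<close>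

lemma krull_dim_at_special:
  assumes e1: "e1 $ 3 = 0" and nz: "minors_wedge (psi e1 e1 e2 a0 b0) \<noteq> 0"
  shows "5 \<le> krull_dim_at (subtopology zariski Dvar) (line (minors_wedge (psi e1 e1 e2 a0 b0)))"
proof -
  have s2: "separated (psi_family (\<lambda>(a, b). (e1, e1, e2, a, b))) (psi_family (\<lambda>(v, a, b). (e1, e1, v, a, b)))"
  proof (rule separating_form[OF homogeneous_pluecker])
    show "pluecker (square_eval f1) (polar f1 f3) (square_eval f3) (minors_wedge (psi e1 e1 e3 e3 0)) \<noteq> 0"
      by (simp add: pluecker_psi_eval)
    show "line (minors_wedge (psi e1 e1 e3 e3 0)) \<in> psi_family (\<lambda>(v, a, b). (e1, e1, v, a, b))"
      if "minors_wedge (psi e1 e1 e3 e3 0) \<noteq> 0"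
      by (rule psi_family_memI[OF that, of _ "(e3, e3, 0)"]) simp
  qed (auto simp: pluecker_psi_eval)
  have s3: "separated (psi_family (\<lambda>(v, a, b). (e1, e1, v, a, b))) (psi_family (\<lambda>(u, v, a, b). (e1, u, v, a, b)))"
  proof (rule separating_form[OF homogeneous_pluecker])
    show "pluecker (polar f1 f2) (polar f1 f3) (square_eval f2) (minors_wedge (psi e1 e2 e3 0 (- e2))) \<noteq> 0"
      by (simp add: pluecker_psi_eval)
    show "line (minors_wedge (psi e1 e2 e3 0 (- e2))) \<in> psi_family (\<lambda>(u, v, a, b). (e1, u, v, a, b))"
      if "minors_wedge (psi e1 e2 e3 0 (- e2)) \<noteq> 0"
      by (rule psi_family_memI[OF that, of _ "(e2, e3, 0, - e2)"]) simp
  qed (auto simp: pluecker_psi_eval)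
  show ?thesis
    by (rule krull_chain_psi[OF e1 nz psi_plane_special[OF nz] s2 s3 separating_form_Dvar[OF e1]])
qed

end

lemma frame_with_two:
  assumes "\<And>s t. s \<noteq> 0 \<or> t \<noteq> 0 \<Longrightarrow> s *s u + t *s v \<noteq> 0"
  shows "\<exists>w. det (vector [u, v, w] :: complex ^ 3 ^ 3) \<noteq> 0"
proof (rule ccontr)
  assume "\<not> ?thesis"
  then have "det (vector [u, v, axis i 1] :: complex ^ 3 ^ 3) = 0" for i by blast
  from this[of 1] this[of 2] this[of 3]
  have c: "u$1 * v$2 = u$2 * v$1" "u$1 * v$3 = u$3 * v$1" "u$2 * v$3 = u$3 * v$2"
    unfolding det_3 by (simp_all add: axis_def)
  have "1 *s u + 0 *s v \<noteq> 0" by (rule assms) simp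
  then obtain i where "u $ i \<noteq> 0" by (auto simp: vec_eq_iff)
  then have "(- v $ i) *s u + u $ i *s v \<noteq> 0" by (intro assms) simp
  moreover have "(- v $ i) *s u + u $ i *s v = 0"
    using exhaust_3[of i] c by (elim disjE) (simp_all add: vec_eq_iff forall_3 algebra_simps)
  ultimately show False by blast
qed

text \<open>The cases are whether the point P with u = v = 0 lies off or on the line l = 0. In the
  second case l is a combination of u and v, and a column operation makes it the first of
  them.\<close>

lemma Dvar_krull_dim_at_ge:
  assumes "L \<in> Dvar"
  shows "5 \<le> krull_dim_at (subtopology zariski Dvar) L"
proof -
  obtain l u v a b where L: "L = line (minors_wedge (psi l u v a b))" and l3: "l $ 3 = 0"
    and nz: "minors_wedge (psi l u v a b) \<noteq> 0"
    using assms unfolding Dvar_psi by blast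
  note indep = psi_independent[OF nz]
  show ?thesis
  proof (cases "det (vector [l, u, v] :: complex ^ 3 ^ 3) = 0")
    case False
    then obtain f1 f2 f3 where "frame l u v f1 f2 f3" using frame_exists by blast
    then show ?thesis unfolding L by (rule frame.krull_dim_at_general[OF _ l3 nz])
  next
    case det: True
    obtain w where "det (vector [u, v, w] :: complex ^ 3 ^ 3) \<noteq> 0" using frame_with_two[OF indep] by blast
    then obtain f1 f2 f3 where fr: "frame u v w f1 f2 f3" and dw: "det (vector [u, v, w] :: complex ^ 3 ^ 3) \<noteq> 0"
      using frame_exists by blast
    interpret frame u v w f1 f2 f3 by (rule fr)
    define \<alpha> \<beta> \<gamma> where abg: "\<alpha> = dotW f1 l" "\<beta> = dotW f2 l" "\<gamma> = dotW f3 l"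
    have "l = \<alpha> *s u + \<beta> *s v + \<gamma> *s w" unfolding abg by (rule expand)
    moreover have "det (vector [\<alpha> *s u + \<beta> *s v + \<gamma> *s w, u, v] :: complex ^ 3 ^ 3) = \<gamma> * det (vector [u, v, w] :: complex ^ 3 ^ 3)"
      unfolding det_3 by simp algebra
    ultimately have "\<gamma> = 0" and l: "l = \<alpha> *s u + \<beta> *s v" using det dw by auto
    have ab: "\<alpha> \<noteq> 0 \<or> \<beta> \<noteq> 0" using psi_nonzero[OF nz] l by auto
    obtain v' a' b' where v': "minors_wedge (psi l l v' a' b') \<noteq> 0"
      "L = line (minors_wedge (psi l l v' a' b'))"
    proof -
      have main: thesis if B: "det B \<noteq> 0" "row_col_op (mat 1) B (psi l u v a b) = psi l l v' a' b'" for B v' a' b'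
      proof -
        have eq: "minors_wedge (psi l l v' a' b') = det B ^ 2 *s minors_wedge (psi l u v a b)"
          using minors_wedge_row_col_op[of "mat 1" B "psi l u v a b"] unfolding B(2) by simp
        show thesis
        proof (rule \<open>\<And>v' a' b'. minors_wedge (psi l l v' a' b') \<noteq> 0 \<Longrightarrow> L = line (minors_wedge (psi l l v' a' b')) \<Longrightarrow> thesis\<close>)
          show "minors_wedge (psi l l v' a' b') \<noteq> 0" unfolding eq using nz B(1) by simp
          show "L = line (minors_wedge (psi l l v' a' b'))" unfolding eq L using B(1) by (simp add: line_scale)
        qed
      qed
      show thesis
      proof (cases "\<alpha> = 0")
        case False
        show ?thesis
        proof (rule main)
          show "det (vector [vector [\<alpha>, 0, 0], vector [\<beta>, 1, 0], vector [0, 0, 1]] :: complex ^ 3 ^ 3) \<noteq> 0"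
            using False by (simp add: det_3)
          show "row_col_op (mat 1) (vector [vector [\<alpha>, 0, 0], vector [\<beta>, 1, 0], vector [0, 0, 1]]) (psi l u v a b) =
              psi l l v (\<alpha> *s a + \<beta> *s b) b"
            unfolding row_col_op_def vec_eq_iff[of _ "psi l l v (\<alpha> *s a + \<beta> *s b) b"] vec_eq_iff[of _ "psi l l v (\<alpha> *s a + \<beta> *s b) b $ _"] forall_2 forall_3
            by (simp add: sum_2 sum_3 mat_def l)
        qed
      next
        case True
        show ?thesis
        proof (rule main)
          show "det (vector [vector [\<alpha>, 1, 0], vector [\<beta>, 0, 0], vector [0, 0, 1]] :: complex ^ 3 ^ 3) \<noteq> 0"
            using True ab by (simp add: det_3)
          show "row_col_op (mat 1) (vector [vector [\<alpha>, 1, 0], vector [\<beta>, 0, 0], vector [0, 0, 1]]) (psi l u v a b) =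
              psi l l u (\<alpha> *s a + \<beta> *s b) a"
            unfolding row_col_op_def vec_eq_iff[of _ "psi l l u (\<alpha> *s a + \<beta> *s b) a"] vec_eq_iff[of _ "psi l l u (\<alpha> *s a + \<beta> *s b) a $ _"] forall_2 forall_3
            by (simp add: sum_2 sum_3 mat_def l)
        qed
      qed
    qed
    obtain w' where "det (vector [l, v', w'] :: complex ^ 3 ^ 3) \<noteq> 0"
      using frame_with_two[OF psi_independent[OF v'(1)]] by blast
    then obtain g1 g2 g3 where "frame l v' w' g1 g2 g3" using frame_exists by blast
    then show ?thesis unfolding v'(2) by (rule frame.krull_dim_at_special[OF _ l3 v'(1)])
  qed
qed

lemma Dvar_krull_dim_at: "L \<in> Dvar \<Longrightarrow> krull_dim_at (subtopology zariski Dvar) L = 5"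
  by (rule antisym[OF Dvar_krull_dim_at_le Dvar_krull_dim_at_ge])

interpretation rot: frame zW xW yW zW xW yW
  by standard (simp_all add: dotW_def xW_def yW_def zW_def axis_def)

text \<open>The frame z, x, y supplies point, line and plane for l = z, u = x, v = y. Then l is
  released, first within the span of z and x: the conic accounts for two dimensions, l for the other
  two.\<close>

lemma sing_points_krull_dim_ge: "4 \<le> krull_dim (subtopology zariski sing_points)"
proof -
  note nz = minors_wedge_psi_monomial
  let ?L = "line (minors_wedge (psi zW xW yW 0 (- xW)))"
  let ?I2 = "psi_family (\<lambda>(a, b). (zW, xW, yW, a, b))"
  obtain I where I: "prime_locus {?L}" "prime_locus I" "?L \<in> I" "I \<subseteq> ?I2" "separated {?L} I" "separated I ?I2"
    using rot.psi_plane_general[OF nz] unfolding flag_between_def by blast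
  define I3 where "I3 = psi_family (\<lambda>x :: complex \<times> complex \<times> W \<times> W. (fst x *s zW + fst (snd x) *s xW, xW, yW, fst (snd (snd x)), snd (snd (snd x))))"
  have ne: "?L \<in> I3" unfolding I3_def by (rule psi_family_memI[OF nz, of _ "(1, 0, 0, - xW)"]) simp
  have p3: "prime_locus I3"
    unfolding I3_def
  proof (rule prime_locus_psi_family)
    show "psi_family (\<lambda>x :: complex \<times> complex \<times> W \<times> W. (fst x *s zW + fst (snd x) *s xW, xW, yW, fst (snd (snd x)), snd (snd (snd x)))) \<noteq> {}"
      using ne unfolding I3_def by blast
  qed (rule polynomial_on_lines_linear, simp add: scaleR_conv_of_real[where 'a = complex] algebra_simps,
      rule polynomial_on_lines_const, rule polynomial_on_lines_const, (rule poly_lines_complex_linear, simp)+)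
  have xy: "xW $ 3 = 0" "yW $ 3 = 0" by (simp_all add: xW_def yW_def axis_def)
  have memS: "line (minors_wedge (psi l xW yW a b)) \<in> sing_points" if "minors_wedge (psi l xW yW a b) \<noteq> 0" for l a b
    using that xy unfolding sing_points_psi by blast
  have s2: "separated (psi_family (\<lambda>(a, b). (zW, xW, yW, a, b))) I3"
  proof (rule separating_form[OF homogeneous_pluecker])
    show "pluecker (square_eval xW) (polar xW yW) (square_eval yW) (minors_wedge (psi xW xW yW yW 0)) \<noteq> 0"
      by (simp add: pluecker_psi_eval)
    show "line (minors_wedge (psi xW xW yW yW 0)) \<in> I3" if "minors_wedge (psi xW xW yW yW 0) \<noteq> 0"
      unfolding I3_def by (rule psi_family_memI[OF that, of _ "(0, 1, yW, 0)"]) simp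
  qed (auto simp: pluecker_psi_eval)
  \<comment> \<open>In \<open>I3\<close> the form l has no y-coefficient, so all three functionals
    kill l x.\<close>
  have s3: "separated I3 sing_points"
    unfolding I3_def
  proof (rule separating_form[OF homogeneous_pluecker])
    show "pluecker (polar xW yW) (square_eval yW) (polar yW zW) (minors_wedge (psi yW xW yW zW 0)) \<noteq> 0"
      by (simp add: pluecker_psi_eval)
  qed (auto simp: pluecker_psi_eval intro: memS)
  have sub: "?I2 \<subseteq> I3"
    unfolding I3_def
  proof (rule psi_family_subset)
    show "\<exists>y :: complex \<times> complex \<times> W \<times> W. (case x of (a, b) \<Rightarrow> (zW, xW, yW, a, b)) =
        (fst y *s zW + fst (snd y) *s xW, xW, yW, fst (snd (snd y)), snd (snd (snd y)))" for x
      by (rule exI[of _ "(1, 0, fst x, snd x)"]) (simp add: case_prod_unfold)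
  qed
  have "I3 \<subseteq> sing_points"
    unfolding I3_def psi_family_def using memS by auto
  then have S: "I3 \<subseteq> sing_points" "?I2 \<subseteq> sing_points" "I \<subseteq> sing_points" "?L \<in> sing_points"
    using sub I(3,4) by blast+
  have lt: "i < 4 \<Longrightarrow> i = 0 \<or> i = 1 \<or> i = 2 \<or> i = 3" for i :: nat by linarith
  have "enat 4 \<le> krull_dim_at (subtopology zariski sing_points) ?L"
  proof (rule krull_dim_at_ge_list[of _ "[{?L}, I, ?I2, I3, sing_points]"])
    show "\<forall>i<4. [{?L}, I, ?I2, I3, sing_points] ! i \<subseteq> [{?L}, I, ?I2, I3, sing_points] ! Suc i \<and>
        separated ([{?L}, I, ?I2, I3, sing_points] ! i) ([{?L}, I, ?I2, I3, sing_points] ! Suc i)"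
    proof (intro allI impI)
      fix i :: nat assume "i < 4"
      from lt[OF this] show "[{?L}, I, ?I2, I3, sing_points] ! i \<subseteq> [{?L}, I, ?I2, I3, sing_points] ! Suc i \<and>
          separated ([{?L}, I, ?I2, I3, sing_points] ! i) ([{?L}, I, ?I2, I3, sing_points] ! Suc i)"
        by (elim disjE) (use I(3-6) sub S(1) s2 s3 in simp_all)
    qed
  qed (use I(1,2) S sing_points_proj prime_plane[OF nz] p3 prime_locus_sing_points in simp_all)
  then have "4 \<le> krull_dim_at (subtopology zariski sing_points) ?L" by (simp add: numeral_eq_enat)
  also have "\<dots> \<le> krull_dim (subtopology zariski sing_points)"
    unfolding krull_dim_at_def krull_dim_def by (rule Sup_subset_mono) blast
  finally show ?thesis .
qed

text \<open>The local dimension is 5 at every point. The cone tangent dimension minus 1 is 5 where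
  the kernel vector is nonzero and at least 6 where it is zero.\<close>

lemma singular_locus_Dvar: "singular_locus Dvar = sing_points"
proof
  show "singular_locus Dvar \<subseteq> sing_points"
  proof
    fix L assume L: "L \<in> singular_locus Dvar"
    then have LD: "L \<in> Dvar" unfolding singular_locus_def by blast
    then obtain R where R: "L = line (minors_wedge R)" "minors_wedge R \<noteq> 0" "minors_wedge R $ T_top = 0"
      unfolding Dvar_eq by blast
    show "L \<in> sing_points"
    proof (cases "kernel_vec R = 0")
      case True
      then show ?thesis using R unfolding sing_points_def by blast
    next
      case False
      have "vec.dim (cone_tangent_space Dvar L) = 6"
        unfolding R(1) by (rule tangent_Dvar_dim_regular[OF R(2,3) False])
      then show ?thesis
        using L Dvar_krull_dim_at[OF LD] unfolding singular_locus_def by (simp add: numeral_eq_enat)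
    qed
  qed
  show "sing_points \<subseteq> singular_locus Dvar"
  proof
    fix L assume L: "L \<in> sing_points"
    then have LD: "L \<in> Dvar" using sing_points_subset_Dvar by blast
    obtain R where R: "L = line (minors_wedge R)" "minors_wedge R \<noteq> 0" "kernel_vec R = 0"
      using L unfolding sing_points_def by blast
    have "7 \<le> vec.dim (cone_tangent_space Dvar L)"
      unfolding R(1) by (rule tangent_Dvar_dim_sing[OF R(2,3)])
    then show "L \<in> singular_locus Dvar"
      unfolding singular_locus_def using LD by (simp add: Dvar_krull_dim_at numeral_eq_enat)
  qed
qed

theorem proposition3p13:
  shows "irreducible_space (subtopology zariski (singular_locus Dvar)) \<and>
    krull_dim (subtopology zariski (singular_locus Dvar)) = 4 \<and>
    singular_locus Dvar =
      (subtopology zariski Yvar) closure_of cell (line (wedge3 (yW \<bullet>\<^sub>S yW) (yW \<bullet>\<^sub>S zW) (xW \<bullet>\<^sub>S zW)))"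
  unfolding singular_locus_Dvar closure_cell_sing irreducible_space_zariski_iff[OF sing_points_proj]
  using prime_locus_sing_points antisym[OF sing_points_krull_dim_le sing_points_krull_dim_ge] by blast

end
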